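(* Let $D_q\in\mathcal U(\mathfrak g)\otimes L(H^q(\mathfrak g),H^{q+1}(\mathfrak g))$ denote the Rumin differentials associated with the 5-dimensional graded Lie algebra $\mathfrak g=\mathfrak g_{-3}\oplus\mathfrak g_{-2}\oplus\mathfrak g_{-1}$. Let $h_g$ denote the Hermitian inner product on $H^*(\mathfrak g)$ induced from a graded Euclidean inner product $g=g_{-3}\oplus g_{-2}\oplus g_{-1}$ on $\mathfrak g$. Then, in the nontrivial scalar representation $\rho_\alpha$ on $\mathbb C$ corresponding to $0\neq\alpha\in\mathfrak g_1^*=(\mathfrak g_{-1})^*$, we have $$\det\nolimits_*|\rho_\alpha(D_4)|_{h_g}=\det\nolimits_*|\rho_\alpha(D_0)|_{h_g}=\|\alpha\|_g,$$ $$\det\nolimits_*|\rho_\alpha(D_3)|_{h_g}=\det\nolimits_*|\rho_\alpha(D_1)|_{h_g}=\frac{\|\alpha\|_g^2\,\|\alpha\|_{b_g}}{\sqrt{a_g}},$$ $$\det\nolimits_*|\rho_\alpha(D_2)|_{h_g}=\frac{\|\alpha\|_g^2\,\|\alpha\|_{b_g}^2}{a_g\cdot\operatorname{tr}(b_g^{-1}g_{-1})}.$$ For the torsion we find $$\tau_{h_g}(\rho_\alpha(D))=\frac1{\operatorname{tr}(b_g^{-1}g_{-1})}.$$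
   Context: **Algebra and group.** $\mathfrak g=\mathfrak g_{-3}\oplus\mathfrak g_{-2}\oplus\mathfrak g_{-1}$ is the 5-dimensional real graded nilpotent Lie algebra with basis $X_1,X_2$ of $\mathfrak g_{-1}$, $X_3=[X_1,X_2]$ of $\mathfrak g_{-2}$, and $X_4=[X_1,X_3]$, $X_5=[X_2,X_3]$ of $\mathfrak g_{-3}$ (all other brackets of basis elements vanish up to antisymmetry). $G$ is the simply connected Lie group with Lie algebra $\mathfrak g$. **Rumin differentials.** $H^q(\mathfrak g)=\ker\partial_q/\operatorname{img}\partial_{q-1}$ is the cohomology of the Chevalley–Eilenberg complex $(\Lambda^*\mathfrak g^*\otimes\mathbb C,\partial)$. With $\chi^1,\dots,\chi^5$ the dual basis and $\chi^{j_1\cdots j_k}=\chi^{j_1}\wedge\cdots\wedge\chi^{j_k}$, the following forms induce bases of $H^q(\mathfrak g)$: $q=0$: $1$; $q=1$: $\chi^1,\chi^2$; $q=2$: $\chi^{14},\tfrac1{\sqrt2}(\chi^{15}+\chi^{24}),\chi^{25}$; $q=3$: $\chi^{134},\tfrac1{\sqrt2}(\chi^{135}+\chi^{234}),\chi^{235}$; $q=4$: $\chi^{1345},\chi^{2345}$; $q=5$: $\chi^{12345}$. With respect to these bases, writing $X_{j_1\cdots j_k}=X_{j_1}\cdots X_{j_k}\in\mathcal U(\mathfrak g)$, the Rumin differentials are $$D_0=\begin{pmatrix}X_1\\ X_2\end{pmatrix},\quad D_1=\begin{pmatrix}-X_{112}-X_{13}-X_4&X_{111}\\ -\sqrt2X_{122}-\sqrt2X_5&\sqrt2X_{211}-\sqrt2X_4\\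 -X_{222}&X_{221}-X_{23}-X_5\end{pmatrix},$$ $$D_2=\begin{pmatrix}-X_{12}-X_3&X_{11}/\sqrt2&0\\ -X_{22}/\sqrt2&-\tfrac32X_3&X_{11}/\sqrt2\\ 0&-X_{22}/\sqrt2&X_{21}-X_3\end{pmatrix},$$ $$D_3=\begin{pmatrix}X_{122}+X_{32}-X_5&-\sqrt2X_{112}+\sqrt2X_4&X_{111}\\ X_{222}&-\sqrt2X_{221}-\sqrt2X_5&X_{211}-X_{31}+X_4\end{pmatrix},\quad D_4=\begin{pmatrix}-X_2&X_1\end{pmatrix}.$$ (These elements do not depend on the choice of the basis $X_1,X_2$ of $\mathfrak g_{-1}$.) **Scalar representation.** $\rho_\alpha(X_1)=\mathbf i\alpha(X_1)$, $\rho_\alpha(X_2)=\mathbf i\alpha(X_2)$, $\rho_\alpha(X_3)=\rho_\alpha(X_4)=\rho_\alpha(X_5)=0$; thus $\rho_\alpha(D_q)\colon H^q(\mathfrak g)\to H^{q+1}(\mathfrak g)$ is a linear map of finite dimensional spaces. **Inner products.** A graded Euclidean inner product $g=g_{-3}\oplus g_{-2}\oplus g_{-1}$ induces a Hermitian inner product on $\Lambda^*\mathfrak g^*\otimes\mathbb C$, and $h_g$ on $H^q(\mathfrak g)$ is obtained by restricting it to harmonic forms $\ker\partial_q\cap\ker\partial_{q-1}^{*}\cong H^q(\mathfrak g)$ ($\partial^*$ the adjoint with respect to $g$). The number $a_g>0$ and the Euclidean inner product $b_g$ on $\mathfrak g_{-1}$ are defined by $$g_{-2}([X,Y],[X,Y])=a_g\bigl(g_{-1}(X,X)g_{-1}(Y,Y)-g_{-1}(X,Y)^2\bigr),\qquad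 g_{-3}([X,Z],[Y,Z])=g_{-2}(Z,Z)\,b_g(X,Y)$$ for all $X,Y\in\mathfrak g_{-1}$, $Z\in\mathfrak g_{-2}$. $\|\alpha\|_g$ and $\|\alpha\|_{b_g}$ are the norms on $(\mathfrak g_{-1})^*$ dual to $g_{-1}$ and $b_g$; in $\operatorname{tr}(b_g^{-1}g_{-1})$ both inner products are viewed as isomorphisms $\mathfrak g_{-1}\to(\mathfrak g_{-1})^*$. **Determinants and torsion.** $|\rho(D_q)|_h=\sqrt{\rho(D_q)^{*_h}\rho(D_q)}$, with $*_h$ the adjoint with respect to $h$; $\det_*$ is the product of all nonzero eigenvalues (with multiplicity); and $$\tau_h(\rho(D))=\frac{\det_*|\rho(D_0)|_h\cdot\det_*|\rho(D_2)|_h\cdot\det_*|\rho(D_4)|_h}{\det_*|\rho(D_1)|_h\cdot\det_*|\rho(D_3)|_h}.$$ *)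

theory Defs
  imports
    "HOL-Analysis.Analysis"
    "Jordan_Normal_Form.Char_Poly"
    "HOL-Library.Poly_Mapping"
begin

hide_const (open) Determinants.det Finite_Cartesian_Product.mat

no_notation vec_index (infixl "$" 100)


section \<open>The graded Lie algebra\<close>

text \<open>The triple \<open>(x, z, w)\<close> has components \<open>x\<close>, \<open>z\<close>, \<open>w\<close> of degree -1, -2, -3.
  The basis is \<open>X\<^sub>1 = (e\<^sub>1, 0, 0)\<close>, \<open>X\<^sub>2 = (e\<^sub>2, 0, 0)\<close>, \<open>X\<^sub>3 = (0, 1, 0)\<close>,
  \<open>X\<^sub>4 = (0, 0, e\<^sub>1)\<close>, \<open>X\<^sub>5 = (0, 0, e\<^sub>2)\<close>, and the only nonzero brackets are
  \<open>[X\<^sub>1, X\<^sub>2] = X\<^sub>3\<close>, \<open>[X\<^sub>1, X\<^sub>3] = X\<^sub>4\<close>, \<open>[X\<^sub>2, X\<^sub>3] = X\<^sub>5\<close>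
  and those that follow by antisymmetry.\<close>

type_synonym g5 = "(real ^ 2) \<times> real \<times> (real ^ 2)"

fun bracket :: "g5 \<Rightarrow> g5 \<Rightarrow> g5" where
  "bracket (x, z, w) (x', z', w') =
     (0, x $ 1 * x' $ 2 - x $ 2 * x' $ 1, z' *\<^sub>R x - z *\<^sub>R x')"

definition deg1 :: "real ^ 2 \<Rightarrow> g5" where "deg1 x = (x, 0, 0)"
definition deg2 :: "real \<Rightarrow> g5" where "deg2 z = (0, z, 0)"
definition deg3 :: "real ^ 2 \<Rightarrow> g5" where "deg3 w = (0, 0, w)"

definition bas :: "nat \<Rightarrow> g5" where
  "bas i = [deg1 (axis 1 1), deg1 (axis 2 1), deg2 1, deg3 (axis 1 1), deg3 (axis 2 1)] ! (i - 1)"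

definition chi :: "nat \<Rightarrow> g5 \<Rightarrow> real" where
  "chi i = (\<lambda>(x, z, w). [x $ 1, x $ 2, z, w $ 1, w $ 2] ! (i - 1))"


section \<open>Inner products\<close>

definition inner_product :: "('a::real_vector \<Rightarrow> 'a \<Rightarrow> real) \<Rightarrow> bool" where
  "inner_product b \<longleftrightarrow>
     (\<forall>u. linear (b u)) \<and> (\<forall>v. linear (\<lambda>u. b u v)) \<and>
     (\<forall>u v. b u v = b v u) \<and> (\<forall>u. u \<noteq> 0 \<longrightarrow> 0 < b u u)"

definition graded_inner_product :: "(g5 \<Rightarrow> g5 \<Rightarrow> real) \<Rightarrow> bool" where
  "graded_inner_product g \<longleftrightarrow> inner_product g \<and>
     (\<forall>x z w. g (deg1 x) (deg2 z) = 0 \<and> g (deg1 x) (deg3 w) = 0 \<and> g (deg2 z) (deg3 w) = 0)"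

text \<open>A curried inner product \<open>b\<close> is literally the isomorphism \<open>u \<mapsto> b u\<close> onto the dual space,
  so its inverse sends a linear functional to the vector representing it.\<close>

definition dual_ip :: "('a \<Rightarrow> 'a \<Rightarrow> real) \<Rightarrow> ('a \<Rightarrow> real) \<Rightarrow> ('a \<Rightarrow> real) \<Rightarrow> real" where
  "dual_ip b \<phi> \<psi> = b (inv_into UNIV b \<phi>) (inv_into UNIV b \<psi>)"

definition dual_norm :: "('a \<Rightarrow> 'a \<Rightarrow> real) \<Rightarrow> ('a \<Rightarrow> real) \<Rightarrow> real" where
  "dual_norm b \<phi> = sqrt (dual_ip b \<phi> \<phi>)"

definition tr_inv :: "(real ^ 2 \<Rightarrow> real ^ 2 \<Rightarrow> real) \<Rightarrow> (real ^ 2 \<Rightarrow> real ^ 2 \<Rightarrow> real) \<Rightarrow> real" where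
  "tr_inv b c = trace (matrix (\<lambda>x. inv_into UNIV b (c x)))"

definition g_m1 :: "(g5 \<Rightarrow> g5 \<Rightarrow> real) \<Rightarrow> real ^ 2 \<Rightarrow> real ^ 2 \<Rightarrow> real" where
  "g_m1 g = (\<lambda>x y. g (deg1 x) (deg1 y))"

definition a_coeff :: "(g5 \<Rightarrow> g5 \<Rightarrow> real) \<Rightarrow> real" where
  "a_coeff g = (THE a. \<forall>x y.
     g (bracket (deg1 x) (deg1 y)) (bracket (deg1 x) (deg1 y)) =
       a * (g_m1 g x x * g_m1 g y y - (g_m1 g x y)\<^sup>2))"

definition b_form :: "(g5 \<Rightarrow> g5 \<Rightarrow> real) \<Rightarrow> real ^ 2 \<Rightarrow> real ^ 2 \<Rightarrow> real" where
  "b_form g = (THE b. \<forall>x y z.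
     g (bracket (deg1 x) (deg2 z)) (bracket (deg1 y) (deg2 z)) = g (deg2 z) (deg2 z) * b x y)"


section \<open>Chevalley--Eilenberg cohomology\<close>

text \<open>A \<open>q\<close>-form takes a list of \<open>q\<close> vectors; it is extended by 0 to lists of other lengths.\<close>

type_synonym form = "g5 list \<Rightarrow> complex"

definition forms :: "nat \<Rightarrow> form set" where
  "forms q = {\<omega>.
     (\<forall>vs. length vs \<noteq> q \<longrightarrow> \<omega> vs = 0) \<and>
     (\<forall>vs i. length vs = q \<longrightarrow> i < q \<longrightarrow> linear (\<lambda>v. \<omega> (vs[i := v]))) \<and>
     (\<forall>vs i j. length vs = q \<longrightarrow> i < j \<longrightarrow> j < q \<longrightarrow> vs ! i = vs ! j \<longrightarrow> \<omega> vs = 0)}"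

definition ce_diff :: "form \<Rightarrow> form" where
  "ce_diff \<omega> vs =
     (\<Sum>j<length vs. \<Sum>i<j. (-1) ^ (i + j) *
        \<omega> (bracket (vs ! i) (vs ! j) # nths vs (- {i, j})))"

definition ce_closed :: "nat \<Rightarrow> form set" where
  "ce_closed q = {\<omega> \<in> forms q. ce_diff \<omega> = (\<lambda>_. 0)}"

definition ce_exact :: "nat \<Rightarrow> form set" where
  "ce_exact q = (case q of 0 \<Rightarrow> {\<lambda>_. 0} | Suc p \<Rightarrow> ce_diff ` forms p)"

definition coh_class :: "nat \<Rightarrow> form \<Rightarrow> form set" where
  "coh_class q \<omega> = {\<eta> \<in> forms q. (\<lambda>vs. \<eta> vs - \<omega> vs) \<in> ce_exact q}"

text \<open>\<open>wedge [j\<^sub>1, \<dots>, j\<^sub>k]\<close> is \<open>\<chi>\<^bsup>j\<^sub>1\<^esup> \<and> \<dots> \<and> \<chi>\<^bsup>j\<^sub>k\<^esup>\<close>, without a factor \<open>1 / k!\<close>.\<close>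

definition wedge :: "nat list \<Rightarrow> form" where
  "wedge js vs =
     (if length vs = length js
      then of_real (det (mat (length js) (length js) (\<lambda>(a, b). chi (js ! a) (vs ! b))))
      else 0)"

text \<open>Hermitian inner product on \<open>q\<close>-forms, linear in the first argument, normalised by
  \<open>\<langle>\<phi>\<^sub>1 \<and> \<dots> \<and> \<phi>\<^sub>q, \<psi>\<^sub>1 \<and> \<dots> \<and> \<psi>\<^sub>q\<rangle> = det \<langle>\<phi>\<^sub>i, \<psi>\<^sub>j\<rangle>\<close> for real covectors.  The coefficient of
  \<open>\<omega>\<close> at \<open>wedge I\<close>, for \<open>I\<close> strictly increasing, is \<open>\<omega> (map bas I)\<close>.\<close>

definition multi_indices :: "nat \<Rightarrow> nat list set" where
  "multi_indices q = {I. length I = q \<and> sorted_wrt (<) I \<and> set I \<subseteq> {1..5}}"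

definition form_ip :: "(g5 \<Rightarrow> g5 \<Rightarrow> real) \<Rightarrow> nat \<Rightarrow> form \<Rightarrow> form \<Rightarrow> complex" where
  "form_ip g q \<omega> \<eta> =
     (\<Sum>I \<in> multi_indices q. \<Sum>J \<in> multi_indices q.
        \<omega> (map bas I) * cnj (\<eta> (map bas J)) *
        of_real (det (mat q q (\<lambda>(i, j). dual_ip g (chi (I ! i)) (chi (J ! j))))))"

text \<open>\<open>ce_adjoint_rel g p \<omega> \<xi>\<close> is the graph of the adjoint \<open>\<partial>\<^sub>p\<^sup>*\<close>: it says
  \<open>\<xi> = \<partial>\<^sub>p\<^sup>* \<omega>\<close> for \<open>\<omega>\<close> in \<open>forms (Suc p)\<close>.  The adjoint of \<open>\<partial>\<close> with index -1 is zero,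
  so there is no condition for \<open>q = 0\<close>.\<close>

definition ce_adjoint_rel :: "(g5 \<Rightarrow> g5 \<Rightarrow> real) \<Rightarrow> nat \<Rightarrow> form \<Rightarrow> form \<Rightarrow> bool" where
  "ce_adjoint_rel g p \<omega> \<xi> \<longleftrightarrow> \<xi> \<in> forms p \<and>
     (\<forall>\<eta> \<in> forms p. form_ip g (Suc p) (ce_diff \<eta>) \<omega> = form_ip g p \<eta> \<xi>)"

definition harmonic :: "(g5 \<Rightarrow> g5 \<Rightarrow> real) \<Rightarrow> nat \<Rightarrow> form set" where
  "harmonic g q =
     {\<omega> \<in> ce_closed q. \<forall>p. q = Suc p \<longrightarrow> ce_adjoint_rel g p \<omega> (\<lambda>_. 0)}"

definition harmonic_rep :: "(g5 \<Rightarrow> g5 \<Rightarrow> real) \<Rightarrow> nat \<Rightarrow> form set \<Rightarrow> form" where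
  "harmonic_rep g q c = (THE \<omega>. \<omega> \<in> c \<and> \<omega> \<in> harmonic g q)"

definition coh_ip :: "(g5 \<Rightarrow> g5 \<Rightarrow> real) \<Rightarrow> nat \<Rightarrow> form set \<Rightarrow> form set \<Rightarrow> complex" where
  "coh_ip g q c c' = form_ip g q (harmonic_rep g q c) (harmonic_rep g q c')"

definition coh_basis :: "nat \<Rightarrow> form list" where
  "coh_basis q =
     [[wedge []],
      [wedge [1], wedge [2]],
      [wedge [1,4], (\<lambda>vs. (wedge [1,5] vs + wedge [2,4] vs) / of_real (sqrt 2)), wedge [2,5]],
      [wedge [1,3,4], (\<lambda>vs. (wedge [1,3,5] vs + wedge [2,3,4] vs) / of_real (sqrt 2)),
       wedge [2,3,5]],
      [wedge [1,3,4,5], wedge [2,3,4,5]],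
      [wedge [1,2,3,4,5]]] ! q"

text \<open>The cohomology class with coordinates \<open>c\<close> with respect to the classes of \<open>coh_basis q\<close>,
  and the Hermitian inner product on cohomology in these coordinates.\<close>

definition class_of_coords :: "nat \<Rightarrow> complex Matrix.vec \<Rightarrow> form set" where
  "class_of_coords q c =
     coh_class q (\<lambda>vs. \<Sum>i<length (coh_basis q). vec_index c i * (coh_basis q ! i) vs)"

definition h_ip :: "(g5 \<Rightarrow> g5 \<Rightarrow> real) \<Rightarrow> nat \<Rightarrow> complex Matrix.vec \<Rightarrow> complex Matrix.vec \<Rightarrow> complex" where
  "h_ip g q c c' = coh_ip g q (class_of_coords q c) (class_of_coords q c')"


section \<open>The universal enveloping algebra\<close>

text \<open>The free associative algebra on the set of vectors, modulo the two-sided ideal that makes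
  the inclusion of the Lie algebra linear and turns brackets into commutators.\<close>

datatype word = Word (letters: "g5 list")

instantiation word :: monoid_add
begin
definition "0 = Word []"
definition "u + v = Word (letters u @ letters v)"
instance by standard (simp_all add: zero_word_def plus_word_def)
end

type_synonym free_alg = "word \<Rightarrow>\<^sub>0 real"

abbreviation scal :: "real \<Rightarrow> free_alg" where "scal c \<equiv> Poly_Mapping.single 0 c"
abbreviation gen :: "g5 \<Rightarrow> free_alg" where "gen v \<equiv> Poly_Mapping.single (Word [v]) 1"

inductive_set uea_ideal :: "free_alg set" where
  zero: "0 \<in> uea_ideal"
| plus: "p \<in> uea_ideal \<Longrightarrow> q \<in> uea_ideal \<Longrightarrow> p + q \<in> uea_ideal"
| lin_add: "p * (gen (u + v) - gen u - gen v) * q \<in> uea_ideal"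
| lin_scale: "p * (gen (c *\<^sub>R v) - scal c * gen v) * q \<in> uea_ideal"
| commutator: "p * (gen u * gen v - gen v * gen u - gen (bracket u v)) * q \<in> uea_ideal"

lemma uea_ideal_mult_left: "p \<in> uea_ideal \<Longrightarrow> r * p \<in> uea_ideal"
proof (induction rule: uea_ideal.induct)
  case (lin_add p u v q)
  then show ?case using uea_ideal.lin_add[of "r * p"] by (simp add: mult.assoc)
next
  case (lin_scale p c v q)
  then show ?case using uea_ideal.lin_scale[of "r * p"] by (simp add: mult.assoc)
next
  case (commutator p u v q)
  then show ?case using uea_ideal.commutator[of "r * p"] by (simp add: mult.assoc)
qed (auto simp: distrib_left intro: uea_ideal.intros)

lemma uea_ideal_mult_right: "p \<in> uea_ideal \<Longrightarrow> p * r \<in> uea_ideal"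
proof (induction rule: uea_ideal.induct)
  case (lin_add p u v q)
  then show ?case using uea_ideal.lin_add[of p u v "q * r"] by (simp add: mult.assoc)
next
  case (lin_scale p c v q)
  then show ?case using uea_ideal.lin_scale[of p c v "q * r"] by (simp add: mult.assoc)
next
  case (commutator p u v q)
  then show ?case using uea_ideal.commutator[of p u v "q * r"] by (simp add: mult.assoc)
qed (auto simp: distrib_right intro: uea_ideal.intros)

lemma uea_ideal_uminus: "p \<in> uea_ideal \<Longrightarrow> - p \<in> uea_ideal"
  using uea_ideal_mult_left[of p "-1"] by simp

lemma uea_ideal_diff: "p \<in> uea_ideal \<Longrightarrow> q \<in> uea_ideal \<Longrightarrow> p - q \<in> uea_ideal"
  using uea_ideal.plus[of p "- q"] uea_ideal_uminus[of q] by simp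

text \<open>The algebra homomorphism from the free algebra to the complex numbers that extends a map
  \<open>f\<close> on generators.\<close>

definition free_eval :: "(g5 \<Rightarrow> complex) \<Rightarrow> free_alg \<Rightarrow> complex" where
  "free_eval f p = (\<Sum>w \<in> Poly_Mapping.keys p. of_real (Poly_Mapping.lookup p w) * prod_list (map f (letters w)))"

lemma free_alg_induct [case_names zero single plus]:
  fixes p :: free_alg
  assumes "P 0" "\<And>w c. P (Poly_Mapping.single w c)" "\<And>p q. P p \<Longrightarrow> P q \<Longrightarrow> P (p + q)"
  shows "P p"
proof (induction p rule: update_induct)
  case const
  then show ?case by (rule assms(1))
next
  case (update p w c)
  have "Poly_Mapping.update w c p = p + Poly_Mapping.single w c"
    using update(1) by (intro poly_mapping_eqI) (auto simp: lookup_update lookup_add lookup_single when_def in_keys_iff)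
  then show ?case using update assms by simp
qed

lemma free_eval_single [simp]:
  "free_eval f (Poly_Mapping.single w c) = of_real c * prod_list (map f (letters w))"
  by (cases "c = 0") (simp_all add: free_eval_def)

lemma free_eval_zero [simp]: "free_eval f 0 = 0"
  by (simp add: free_eval_def)

lemma free_eval_add: "free_eval f (p + q) = free_eval f p + free_eval f q"
proof -
  let ?t = "\<lambda>p w. of_real (Poly_Mapping.lookup p w) * prod_list (map f (letters w))"
  have *: "free_eval f r = (\<Sum>w \<in> Poly_Mapping.keys p \<union> Poly_Mapping.keys q. ?t r w)" if "Poly_Mapping.keys r \<subseteq> Poly_Mapping.keys p \<union> Poly_Mapping.keys q" for r
    unfolding free_eval_def using that
    by (intro sum.mono_neutral_left) (auto simp: in_keys_iff)
  show ?thesis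
    using *[of p] *[of q] *[of "p + q"] Poly_Mapping.keys_add[of p q]
    by (simp add: lookup_add ring_distribs sum.distrib)
qed

lemma free_eval_mult: "free_eval f (p * q) = free_eval f p * free_eval f q"
proof (induction p rule: free_alg_induct)
  case (single w c)
  show ?case
    by (induction q rule: free_alg_induct)
       (simp_all add: mult_single plus_word_def distrib_left free_eval_add algebra_simps)
qed (simp_all add: distrib_right free_eval_add)

lemma free_eval_diff: "free_eval f (p - q) = free_eval f p - free_eval f q"
  using free_eval_add[of f "p - q" q] by simp

lemma free_eval_ideal:
  assumes "p \<in> uea_ideal" "linear f" "\<And>u v. f (bracket u v) = 0"
  shows "free_eval f p = 0"
  using assms(1)
  by induction
     (simp_all add: free_eval_add free_eval_mult free_eval_diff linear_add[OF assms(2)]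
        linear_scale[OF assms(2)] assms(3) scaleR_conv_of_real zero_word_def)

definition uea_rel :: "free_alg \<Rightarrow> free_alg \<Rightarrow> bool" where
  "uea_rel p q \<longleftrightarrow> p - q \<in> uea_ideal"

lemma equivp_uea_rel: "equivp uea_rel"
proof (rule equivpI)
  show "reflp uea_rel" by (rule reflpI) (simp add: uea_rel_def uea_ideal.zero)
  show "symp uea_rel"
    by (rule sympI) (metis uea_rel_def uea_ideal_uminus minus_diff_eq)
  show "transp uea_rel"
  proof (rule transpI)
    fix p q r assume "uea_rel p q" "uea_rel q r"
    then show "uea_rel p r"
      using uea_ideal.plus[of "p - q" "q - r"] by (simp add: uea_rel_def)
  qed
qed

quotient_type uea = free_alg / uea_rel
  by (rule equivp_uea_rel)

instantiation uea :: real_algebra_1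
begin

lift_definition zero_uea :: uea is 0 .
lift_definition one_uea :: uea is 1 .

lift_definition plus_uea :: "uea \<Rightarrow> uea \<Rightarrow> uea" is "(+)"
  unfolding uea_rel_def by (simp only: add_diff_add uea_ideal.plus)

lift_definition uminus_uea :: "uea \<Rightarrow> uea" is uminus
  unfolding uea_rel_def by (simp only: minus_diff_minus uea_ideal_uminus)

lift_definition minus_uea :: "uea \<Rightarrow> uea \<Rightarrow> uea" is "(-)"
  unfolding uea_rel_def
proof -
  fix p p' q q' :: free_alg assume "p - p' \<in> uea_ideal" "q - q' \<in> uea_ideal"
  then show "p - q - (p' - q') \<in> uea_ideal"
    using uea_ideal_diff[of "p - p'" "q - q'"] by (simp add: algebra_simps)
qed

lift_definition times_uea :: "uea \<Rightarrow> uea \<Rightarrow> uea" is "(*)"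
proof -
  fix p p' q q' assume *: "uea_rel p p'" "uea_rel q q'"
  have "p * q - p' * q' = (p - p') * q + p' * (q - q')"
    by (simp add: algebra_simps)
  then show "uea_rel (p * q) (p' * q')"
    using * unfolding uea_rel_def
    by (simp add: uea_ideal.plus uea_ideal_mult_left uea_ideal_mult_right)
qed

lift_definition scaleR_uea :: "real \<Rightarrow> uea \<Rightarrow> uea" is "\<lambda>c p. scal c * p"
  unfolding uea_rel_def by (simp only: uea_ideal_mult_left flip: right_diff_distrib)

lemma scal_commute: "scal c * p = p * scal c"
  by (induction p rule: free_alg_induct)
     (simp_all add: mult_single distrib_left distrib_right mult.commute)

lemma uea_rel_refl: "uea_rel p p"
  by (simp add: uea_rel_def uea_ideal.zero)

instance
proof
  fix a b c :: uea and x y :: real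
  show "a + b + c = a + (b + c)" by transfer (simp add: uea_rel_refl add.assoc)
  show "a + b = b + a" by transfer (simp add: uea_rel_refl add.commute)
  show "0 + a = a" by transfer (simp add: uea_rel_refl)
  show "- a + a = 0" by transfer (simp add: uea_rel_refl)
  show "a - b = a + - b" by transfer (simp add: uea_rel_refl)
  show "a * b * c = a * (b * c)" by transfer (simp add: uea_rel_refl mult.assoc)
  show "(a + b) * c = a * c + b * c" by transfer (simp add: uea_rel_refl distrib_right)
  show "a * (b + c) = a * b + a * c" by transfer (simp add: uea_rel_refl distrib_left)
  show "1 * a = a" by transfer (simp add: uea_rel_refl)
  show "a * 1 = a" by transfer (simp add: uea_rel_refl)
  show "x *\<^sub>R (a + b) = x *\<^sub>R a + x *\<^sub>R b" by transfer (simp add: uea_rel_refl distrib_left)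
  show "(x + y) *\<^sub>R a = x *\<^sub>R a + y *\<^sub>R a"
    by transfer (simp add: uea_rel_refl single_add distrib_right)
  show "x *\<^sub>R y *\<^sub>R a = (x * y) *\<^sub>R a"
    by transfer (simp add: uea_rel_refl mult_single flip: mult.assoc)
  show "1 *\<^sub>R a = a" by transfer (simp add: uea_rel_refl)
  show "x *\<^sub>R a * b = x *\<^sub>R (a * b)" by transfer (simp add: uea_rel_refl mult.assoc)
  show "a * x *\<^sub>R b = x *\<^sub>R (a * b)"
  proof transfer
    fix p q :: free_alg and x :: real
    have "p * (scal x * q) = scal x * (p * q)"
      by (simp only: scal_commute mult.assoc)
    then show "uea_rel (p * (scal x * q)) (scal x * (p * q))"
      by (simp only: uea_rel_refl)
  qed
  show "(0::uea) \<noteq> 1"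
  proof (transfer, rule notI)
    assume "uea_rel 0 1"
    then have "free_eval (\<lambda>_. 0) (0 - 1) = 0"
      unfolding uea_rel_def by (rule free_eval_ideal) (simp_all add: linear_iff)
    moreover have "free_eval (\<lambda>_. 0) 1 = 1"
      unfolding single_one[symmetric] by (simp add: zero_word_def)
    ultimately show False
      by (simp only: free_eval_diff free_eval_zero) simp
  qed
qed

end

lift_definition incl :: "g5 \<Rightarrow> uea" is gen .

definition XU :: "nat list \<Rightarrow> uea" where
  "XU js = prod_list (map (\<lambda>j. incl (bas j)) js)"


section \<open>Rumin differentials and scalar representations\<close>

definition rumin :: "nat \<Rightarrow> uea mat" where
  "rumin q =
    [mat_of_rows_list 1
      [[XU [1]],
       [XU [2]]],
     mat_of_rows_list 2
      [[- XU [1,1,2] - XU [1,3] - XU [4],                    XU [1,1,1]],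
       [- (sqrt 2 *\<^sub>R XU [1,2,2]) - sqrt 2 *\<^sub>R XU [5],     sqrt 2 *\<^sub>R XU [2,1,1] - sqrt 2 *\<^sub>R XU [4]],
       [- XU [2,2,2],                                        XU [2,2,1] - XU [2,3] - XU [5]]],
     mat_of_rows_list 3
      [[- XU [1,2] - XU [3],          (1 / sqrt 2) *\<^sub>R XU [1,1],     0],
       [- ((1 / sqrt 2) *\<^sub>R XU [2,2]), - ((3 / 2) *\<^sub>R XU [3]),        (1 / sqrt 2) *\<^sub>R XU [1,1]],
       [0,                            - ((1 / sqrt 2) *\<^sub>R XU [2,2]), XU [2,1] - XU [3]]],
     mat_of_rows_list 3
      [[XU [1,2,2] + XU [3,2] - XU [5], - (sqrt 2 *\<^sub>R XU [1,1,2]) + sqrt 2 *\<^sub>R XU [4], XU [1,1,1]],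
       [XU [2,2,2], - (sqrt 2 *\<^sub>R XU [2,2,1]) - sqrt 2 *\<^sub>R XU [5], XU [2,1,1] - XU [3,1] + XU [4]]],
     mat_of_rows_list 2
      [[- XU [2], XU [1]]]] ! q"

lift_definition scalar_rep :: "((real ^ 2) \<Rightarrow>\<^sub>L real) \<Rightarrow> uea \<Rightarrow> complex"
  is "\<lambda>\<alpha>. free_eval (\<lambda>v. \<i> * of_real (blinfun_apply \<alpha> (fst v)))"
proof -
  fix \<alpha> :: "(real ^ 2) \<Rightarrow>\<^sub>L real" and p q
  let ?f = "\<lambda>v::g5. \<i> * complex_of_real (blinfun_apply \<alpha> (fst v))"
  assume "uea_rel p q"
  then have "free_eval ?f (p - q) = 0"
    unfolding uea_rel_def
  proof (rule free_eval_ideal)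
    show "linear ?f"
      by (rule linearI) (simp_all add: blinfun.add_right blinfun.scaleR_right algebra_simps
          scaleR_conv_of_real[where 'a = complex])
    show "?f (bracket u v) = 0" for u v
      by (cases "(u, v)" rule: bracket.cases) (simp add: blinfun.zero_right)
  qed
  then show "free_eval ?f p = free_eval ?f q"
    by (simp add: free_eval_diff)
qed

lemma scalar_rep_incl: "scalar_rep \<alpha> (incl v) = \<i> * of_real (blinfun_apply \<alpha> (fst v))"
  by transfer simp

lemma scalar_rep_hom:
  "scalar_rep \<alpha> 0 = 0"
  "scalar_rep \<alpha> 1 = 1"
  "scalar_rep \<alpha> (a + b) = scalar_rep \<alpha> a + scalar_rep \<alpha> b"
  "scalar_rep \<alpha> (a - b) = scalar_rep \<alpha> a - scalar_rep \<alpha> b"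
  "scalar_rep \<alpha> (- a) = - scalar_rep \<alpha> a"
  "scalar_rep \<alpha> (a * b) = scalar_rep \<alpha> a * scalar_rep \<alpha> b"
  "scalar_rep \<alpha> (c *\<^sub>R a) = c *\<^sub>R scalar_rep \<alpha> a"
proof -
  show *: "scalar_rep \<alpha> 0 = 0" by transfer simp
  show "scalar_rep \<alpha> 1 = 1" by transfer (simp add: zero_word_def flip: single_one)
  show "scalar_rep \<alpha> (a + b) = scalar_rep \<alpha> a + scalar_rep \<alpha> b"
    by transfer (simp add: free_eval_add)
  show diff: "scalar_rep \<alpha> (a - b) = scalar_rep \<alpha> a - scalar_rep \<alpha> b" for a b
    by transfer (simp add: free_eval_diff)
  show "scalar_rep \<alpha> (- a) = - scalar_rep \<alpha> a"
    using diff[of 0 a] * by simp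
  show "scalar_rep \<alpha> (a * b) = scalar_rep \<alpha> a * scalar_rep \<alpha> b"
    by transfer (simp add: free_eval_mult)
  show "scalar_rep \<alpha> (c *\<^sub>R a) = c *\<^sub>R scalar_rep \<alpha> a"
    by transfer (simp add: free_eval_mult zero_word_def scaleR_conv_of_real)
qed

text \<open>The matrix of the linear map \<open>\<rho>\<^sub>\<alpha>(D\<^sub>q)\<close> from \<open>H\<^sup>q\<close> to \<open>H\<^bsup>q+1\<^esup>\<close> with respect to
  \<open>coh_basis\<close>.\<close>

definition rho_D :: "((real ^ 2) \<Rightarrow>\<^sub>L real) \<Rightarrow> nat \<Rightarrow> complex mat" where
  "rho_D \<alpha> q = map_mat (scalar_rep \<alpha>) (rumin q)"


section \<open>Determinants and torsion\<close>

text \<open>In the following, \<open>h\<close> and \<open>h'\<close> are Hermitian inner products on the source and the target of the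
  linear map given by a matrix \<open>A\<close>.\<close>

type_synonym herm = "complex Matrix.vec \<Rightarrow> complex Matrix.vec \<Rightarrow> complex"

definition adjoint_wrt :: "herm \<Rightarrow> herm \<Rightarrow> complex mat \<Rightarrow> complex mat" where
  "adjoint_wrt h h' A =
     (THE B. B \<in> carrier_mat (dim_col A) (dim_row A) \<and>
        (\<forall>x \<in> carrier_vec (dim_col A). \<forall>y \<in> carrier_vec (dim_row A).
           h' (A *\<^sub>v x) y = h x (B *\<^sub>v y)))"

definition sqrt_wrt :: "herm \<Rightarrow> complex mat \<Rightarrow> complex mat" where
  "sqrt_wrt h M =
     (THE P. P \<in> carrier_mat (dim_row M) (dim_row M) \<and>
        (\<forall>x \<in> carrier_vec (dim_row M). \<forall>y \<in> carrier_vec (dim_row M).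
           h (P *\<^sub>v x) y = h x (P *\<^sub>v y)) \<and>
        (\<forall>x \<in> carrier_vec (dim_row M). h (P *\<^sub>v x) x \<in> \<real>\<^sub>\<ge>\<^sub>0) \<and>
        P * P = M)"

definition abs_wrt :: "herm \<Rightarrow> herm \<Rightarrow> complex mat \<Rightarrow> complex mat" where
  "abs_wrt h h' A = sqrt_wrt h (adjoint_wrt h h' A * A)"

definition det_star :: "complex mat \<Rightarrow> complex" where
  "det_star P = (\<Prod>z \<in> {z. eigenvalue P z \<and> z \<noteq> 0}. z ^ Polynomial.order z (char_poly P))"

definition det_star_abs :: "(g5 \<Rightarrow> g5 \<Rightarrow> real) \<Rightarrow> ((real ^ 2) \<Rightarrow>\<^sub>L real) \<Rightarrow> nat \<Rightarrow> complex" where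
  "det_star_abs g \<alpha> q = det_star (abs_wrt (h_ip g q) (h_ip g (Suc q)) (rho_D \<alpha> q))"

definition torsion :: "(g5 \<Rightarrow> g5 \<Rightarrow> real) \<Rightarrow> ((real ^ 2) \<Rightarrow>\<^sub>L real) \<Rightarrow> complex" where
  "torsion g \<alpha> =
     (det_star_abs g \<alpha> 0 * det_star_abs g \<alpha> 2 * det_star_abs g \<alpha> 4) /
     (det_star_abs g \<alpha> 1 * det_star_abs g \<alpha> 3)"

end

theory Submission
  imports Defs
begin

text \<open>Write \<open>P\<close>, \<open>k\<close>, \<open>Q\<close> for the metrics dual to \<open>g\<^bsub>-1\<^esub>\<close>, \<open>g\<^bsub>-2\<^esub>\<close>, \<open>g\<^bsub>-3\<^esub>\<close>.  The weight
  grading makes the basis forms harmonic except in degree 3, where a multiple of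
  \<open>\<chi>\<^sup>1\<^sup>3\<^sup>5 - \<chi>\<^sup>2\<^sup>3\<^sup>4\<close>, the only relevant exact form, has to be added.  Hence \<open>h\<close> is \<open>P\<close> in degree 1
  and \<open>P \<otimes> Q\<close> restricted to symmetric tensors in degree 2; in degrees 3 and 4 it is \<open>k\<close> times
  \<open>P \<otimes> Q\<close> on the quotient by the skew tensors, and \<open>k det Q\<close> times \<open>P\<close>.

  For \<open>\<alpha> = (x, y)\<close> the maps \<open>\<rho>(D\<^sub>q)\<close> with \<open>q \<noteq> 2\<close> have rank one, \<open>c \<mapsto> \<langle>w, c\<rangle> v\<close>, so that
  \<open>det\<^sub>* = \<parallel>w\<parallel> \<parallel>v\<parallel>\<close>.  The map \<open>A = \<rho>(D\<^sub>2)\<close> has rank two.  For \<open>M = A\<^sup>* A\<close> with elementary symmetric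
  functions \<open>e\<^sub>1\<close>, \<open>e\<^sub>2 = s\<^sup>2\<close>, \<open>e\<^sub>3 = 0\<close>, Cayley--Hamilton gives the explicit root
  \<open>\<surd>M = ((1 + e\<^sub>1 / s) M - M\<^sup>2 / s) / \<surd>(e\<^sub>1 + 2 s)\<close>, and \<open>det\<^sub>*\<close> is \<open>s\<close>.  Since the adjugate of \<open>A\<close> is half the
  product of the vectors spanning the kernel of \<open>A\<close> and the annihilator of its image, \<open>e\<^sub>2\<close> follows from the norms of these
  two vectors and the Gram determinants.\<close>

section \<open>Determinants and characteristic polynomials of small matrices\<close>

text \<open>The harmonic representative, the adjoint and the square root are definite descriptions,
  so each needs an explicit candidate and a uniqueness proof resting on definiteness. No spectral
  theorem enters, because the roots are polynomials in \<open>M\<close>. The forms \<open>P\<close>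
  and \<open>Q\<close> live on the same plane and are unrelated. Diagonalising both would mean
  transporting the Rumin matrices to another basis of the plane, so seven numbers p, q, r, s, t, u,
  k stay as parameters and the metric facts become polynomial identities. The invariants translate
  as follows. The squared norms of \<alpha> for g and for b are \<open>NP\<close> and
  \<open>NQ\<close> / k, a_g is \<open>dP\<close> / k, and the trace is \<open>Delta\<close> / (k
  \<open>dP\<close>). Here \<open>dP\<close> and \<open>dQ\<close> are the determinants of
  \<open>P\<close> and \<open>Q\<close>, and \<open>Delta\<close> = p u - 2 q t + r s is their
  polarisation. The determinants are sqrt \<open>NP\<close> in degrees 0 and 4, \<open>NP\<close>
  sqrt (\<open>NQ\<close> / \<open>dP\<close>) in degrees 1 and 3, and k \<open>NP\<close>
  \<open>NQ\<close> / \<open>Delta\<close> in degree 2. \<open>dQ\<close> cancels from all of them;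
  \<open>Delta\<close>, the squared norm of the skew tensor, is the origin of the trace.\<close>

lemma det_mat_Suc:
  fixes f :: "nat \<times> nat \<Rightarrow> 'a::comm_ring_1"
  shows "det (mat (Suc n) (Suc n) f) =
    (\<Sum>i<Suc n. f (i, 0) * ((-1) ^ i * det (mat n n (\<lambda>(a, b). f (if a < i then a else Suc a, Suc b)))))"
proof -
  have "mat_delete (mat (Suc n) (Suc n) f) i 0 =
      mat n n (\<lambda>(a, b). f (if a < i then a else Suc a, Suc b))" if "i < Suc n" for i
    using that by (intro eq_matI) (auto simp: mat_delete_def)
  then show ?thesis
    by (subst laplace_expansion_column[of _ "Suc n" 0]) (auto simp: cofactor_def intro!: sum.cong)
qed

lemma det_mat_0: "det (mat 0 0 f) = (1 :: 'a::comm_ring_1)"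
  by (rule det_dim_zero) simp

lemma det_carrier_1:
  fixes A :: "'a::comm_ring_1 mat"
  assumes "A \<in> carrier_mat 1 1"
  shows "det A = A $$ (0,0)"
proof -
  have "A = mat (Suc 0) (Suc 0) (($$) A)" using assms by (intro eq_matI) auto
  then have "det A = det (mat (Suc 0) (Suc 0) (($$) A))" by simp
  also have "\<dots> = A $$ (0,0)" by (simp add: det_mat_Suc det_mat_0)
  finally show ?thesis .
qed

lemma det_carrier_2:
  fixes A :: "'a::comm_ring_1 mat"
  assumes "A \<in> carrier_mat 2 2"
  shows "det A = A $$ (0,0) * A $$ (1,1) - A $$ (1,0) * A $$ (0,1)"
proof -
  have "A = mat (Suc 1) (Suc 1) (($$) A)" using assms by (intro eq_matI) auto
  then have "det A = det (mat (Suc 1) (Suc 1) (($$) A))" by simp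
  also have "\<dots> = A $$ (0,0) * A $$ (1,1) - A $$ (1,0) * A $$ (0,1)"
    by (simp add: det_mat_Suc det_mat_0)
  finally show ?thesis .
qed

lemma det_carrier_3:
  fixes A :: "'a::comm_ring_1 mat"
  assumes "A \<in> carrier_mat 3 3"
  shows "det A = A $$ (0,0) * (A $$ (1,1) * A $$ (2,2) - A $$ (2,1) * A $$ (1,2))
    - A $$ (1,0) * (A $$ (0,1) * A $$ (2,2) - A $$ (2,1) * A $$ (0,2))
    + A $$ (2,0) * (A $$ (0,1) * A $$ (1,2) - A $$ (1,1) * A $$ (0,2))"
proof -
  have "A = mat (Suc 2) (Suc 2) (($$) A)" using assms by (intro eq_matI) auto
  then have "det A = det (mat (Suc 2) (Suc 2) (($$) A))" by simp
  also have "\<dots> = A $$ (0,0) * (A $$ (1,1) * A $$ (2,2) - A $$ (2,1) * A $$ (1,2))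
    - A $$ (1,0) * (A $$ (0,1) * A $$ (2,2) - A $$ (2,1) * A $$ (0,2))
    + A $$ (2,0) * (A $$ (0,1) * A $$ (1,2) - A $$ (1,1) * A $$ (0,2))"
    by (simp add: det_mat_Suc det_mat_0 eval_nat_numeral algebra_simps)
  finally show ?thesis .
qed

text \<open>By Vieta, the product of the roots of a monic polynomial, with multiplicity, is its
  constant term up to sign; splitting off the power of the variable removes exactly the eigenvalue
  0.\<close>

lemma det_star_eq:
  assumes A: "A \<in> carrier_mat n n" and cp: "char_poly A = Polynomial.monom 1 k * q"
    and q0: "poly q 0 \<noteq> 0" and q1: "lead_coeff q = 1"
  shows "det_star A = (-1) ^ degree q * poly q 0"
proof -
  have qn: "q \<noteq> 0" using q0 by auto
  have roots: "{z. eigenvalue A z \<and> z \<noteq> 0} = {z. poly q z = 0}"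
    using q0 by (auto simp: eigenvalue_root_char_poly[OF A] cp poly_monom)
  have ord: "Polynomial.order z (char_poly A) = Polynomial.order z q" if "poly q z = 0" for z
  proof -
    have "z \<noteq> 0" using that q0 by auto
    then have "Polynomial.order z (Polynomial.monom (1::complex) k) = 0"
      by (simp add: order_0I poly_monom)
    moreover have "Polynomial.monom (1::complex) k * q \<noteq> 0" using qn by (simp add: monom_eq_0_iff)
    ultimately show ?thesis by (simp add: cp order_mult)
  qed
  have dec: "(\<Prod>z | poly q z = 0. [:- z, 1:] ^ Polynomial.order z q) = q"
    using complex_poly_decompose[of q] q1 by simp
  have deg: "degree q = (\<Sum>z | poly q z = 0. Polynomial.order z q)"
  proof -
    have "degree q = degree (\<Prod>z | poly q z = 0. [:- z, 1:] ^ Polynomial.order z q)"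
      by (simp add: dec)
    also have "\<dots> = (\<Sum>z | poly q z = 0. Polynomial.order z q)"
      by (subst degree_prod_eq_sum_degree) (auto simp: degree_power_eq)
    finally show ?thesis .
  qed
  have "poly q 0 = (\<Prod>z | poly q z = 0. (- z) ^ Polynomial.order z q)"
    by (subst dec[symmetric]) (simp add: poly_prod)
  also have "\<dots> = (-1) ^ degree q * (\<Prod>z | poly q z = 0. z ^ Polynomial.order z q)"
    by (subst power_minus) (simp only: prod.distrib deg power_sum)
  finally have "(\<Prod>z | poly q z = 0. z ^ Polynomial.order z q) = (-1) ^ degree q * poly q 0"
    by (simp add: mult.assoc[symmetric] power_add[symmetric] mult_2[symmetric])
  moreover have "det_star A = (\<Prod>z | poly q z = 0. z ^ Polynomial.order z q)"
    unfolding det_star_def roots by (rule prod.cong) (auto simp: ord)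
  ultimately show ?thesis by simp
qed

definition e2 :: "'a::comm_ring_1 mat \<Rightarrow> 'a" where
  "e2 A = A $$ (0,0) * A $$ (1,1) - A $$ (0,1) * A $$ (1,0) +
          A $$ (0,0) * A $$ (2,2) - A $$ (0,2) * A $$ (2,0) +
          A $$ (1,1) * A $$ (2,2) - A $$ (1,2) * A $$ (2,1)"

definition tr3 :: "'a::comm_ring_1 mat \<Rightarrow> 'a" where
  "tr3 A = A $$ (0,0) + A $$ (1,1) + A $$ (2,2)"

lemma char_poly_matrix_index:
  fixes A :: "'a::comm_ring_1 mat"
  assumes "A \<in> carrier_mat n n" "i < n" "j < n"
  shows "char_poly_matrix A $$ (i, j) = [:- A $$ (i, j), if i = j then 1 else 0:]"
  using assms by (auto simp: char_poly_matrix_def)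

lemma char_poly_3:
  fixes A :: "'a::comm_ring_1 mat"
  assumes A: "A \<in> carrier_mat 3 3"
  shows "char_poly A = [:- det A, e2 A, - tr3 A, 1:]"
proof -
  have C: "char_poly_matrix A \<in> carrier_mat 3 3" using A by simp
  show ?thesis
    unfolding char_poly_def det_carrier_3[OF C] det_carrier_3[OF A] e2_def tr3_def
    by (simp add: char_poly_matrix_index[OF A]) (simp add: algebra_simps)
qed

lemma det_star_1:
  assumes A: "A \<in> carrier_mat 1 1" and "A $$ (0,0) \<noteq> 0"
  shows "det_star A = A $$ (0,0)"
proof -
  have "char_poly A = [:- A $$ (0,0), 1:]"
    unfolding char_poly_def using A
    by (subst det_carrier_1) (simp_all add: char_poly_matrix_index[OF A])
  then show ?thesis
    using det_star_eq[OF A, of 0 "[:- A $$ (0,0), 1:]"] assms by simp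
qed

lemma det_star_2:
  assumes A: "A \<in> carrier_mat 2 2" and d: "det A = 0" and t: "A $$ (0,0) + A $$ (1,1) \<noteq> 0"
  shows "det_star A = A $$ (0,0) + A $$ (1,1)"
proof -
  have "char_poly A = [:det A, - (A $$ (0,0) + A $$ (1,1)), 1:]"
    unfolding char_poly_def det_carrier_2[OF A] using A
    by (subst det_carrier_2) (simp_all add: char_poly_matrix_index[OF A] algebra_simps)
  then have "char_poly A = Polynomial.monom 1 1 * [:- (A $$ (0,0) + A $$ (1,1)), 1:]"
    using d by (simp add: monom_Suc monom_0)
  then show ?thesis
    using det_star_eq[OF A, of 1 "[:- (A $$ (0,0) + A $$ (1,1)), 1:]"] t
    by (simp add: add_eq_0_iff)
qed

lemma det_star_3_rank_1:
  assumes A: "A \<in> carrier_mat 3 3" and d: "det A = 0" and e: "e2 A = 0" and t: "tr3 A \<noteq> 0"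
  shows "det_star A = tr3 A"
proof -
  have "char_poly A = Polynomial.monom 1 2 * [:- tr3 A, 1:]"
    using d e by (simp add: char_poly_3[OF A] monom_Suc monom_0 eval_nat_numeral)
  then show ?thesis
    using det_star_eq[OF A, of 2 "[:- tr3 A, 1:]"] t by simp
qed

lemma det_star_3_rank_2:
  assumes A: "A \<in> carrier_mat 3 3" and d: "det A = 0" and e: "e2 A \<noteq> 0"
  shows "det_star A = e2 A"
proof -
  have "char_poly A = Polynomial.monom 1 1 * [:e2 A, - tr3 A, 1:]"
    using d by (simp add: char_poly_3[OF A] monom_Suc monom_0)
  then show ?thesis
    using det_star_eq[OF A, of 1 "[:e2 A, - tr3 A, 1:]"] e by simp
qed

section \<open>Hermitian inner products and square roots\<close>

text \<open>The axioms are restricted to \<open>carrier_vec n\<close> because a \<open>herm\<close>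
  is a total function on vectors of all dimensions.\<close>

definition hermitian_ip :: "nat \<Rightarrow> herm \<Rightarrow> bool" where
  "hermitian_ip n h \<longleftrightarrow>
     (\<forall>x\<in>carrier_vec n. \<forall>y\<in>carrier_vec n. \<forall>z\<in>carrier_vec n. h (x + y) z = h x z + h y z) \<and>
     (\<forall>x\<in>carrier_vec n. \<forall>y\<in>carrier_vec n. \<forall>c. h (c \<cdot>\<^sub>v x) y = c * h x y) \<and>
     (\<forall>x\<in>carrier_vec n. \<forall>y\<in>carrier_vec n. h y x = cnj (h x y)) \<and>
     (\<forall>x\<in>carrier_vec n. h x x \<in> \<real>\<^sub>\<ge>\<^sub>0) \<and>
     (\<forall>x\<in>carrier_vec n. h x x = 0 \<longrightarrow> x = 0\<^sub>v n)"

lemma mat_eqI_mult_vec: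
  fixes A B :: "'a::comm_ring_1 mat"
  assumes A: "A \<in> carrier_mat m n" and B: "B \<in> carrier_mat m n"
    and eq: "\<And>x. x \<in> carrier_vec n \<Longrightarrow> A *\<^sub>v x = B *\<^sub>v x"
  shows "A = B"
proof (rule eq_matI)
  show "dim_row A = dim_row B" "dim_col A = dim_col B" using A B by auto
  fix i j assume "i < dim_row B" "j < dim_col B"
  then have ij: "i < m" "j < n" using B by auto
  have "vec_index (A *\<^sub>v unit_vec n j) i = vec_index (B *\<^sub>v unit_vec n j) i"
    by (simp add: eq)
  then show "A $$ (i, j) = B $$ (i, j)" using A B ij by simp
qed

context
  fixes n :: nat and h :: herm
  assumes h: "hermitian_ip n h"
begin

lemma ip_add_left: "x \<in> carrier_vec n \<Longrightarrow> y \<in> carrier_vec n \<Longrightarrow> z \<in> carrier_vec n \<Longrightarrow>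
    h (x + y) z = h x z + h y z"
  and ip_smult_left: "x \<in> carrier_vec n \<Longrightarrow> y \<in> carrier_vec n \<Longrightarrow> h (c \<cdot>\<^sub>v x) y = c * h x y"
  and ip_cnj: "x \<in> carrier_vec n \<Longrightarrow> y \<in> carrier_vec n \<Longrightarrow> h y x = cnj (h x y)"
  and ip_nonneg: "x \<in> carrier_vec n \<Longrightarrow> h x x \<in> \<real>\<^sub>\<ge>\<^sub>0"
  and ip_definite: "x \<in> carrier_vec n \<Longrightarrow> h x x = 0 \<Longrightarrow> x = 0\<^sub>v n"
  using h unfolding hermitian_ip_def by blast+

lemma ip_add_right: "x \<in> carrier_vec n \<Longrightarrow> y \<in> carrier_vec n \<Longrightarrow> z \<in> carrier_vec n \<Longrightarrow>
    h z (x + y) = h z x + h z y"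
  by (simp add: ip_cnj[of _ z] ip_add_left)

lemma ip_smult_right: "x \<in> carrier_vec n \<Longrightarrow> y \<in> carrier_vec n \<Longrightarrow> h x (c \<cdot>\<^sub>v y) = cnj c * h x y"
  by (simp add: ip_cnj[of _ x] ip_smult_left)

lemma smult_zero_vec: "c \<cdot>\<^sub>v 0\<^sub>v n = (0\<^sub>v n :: complex Matrix.vec)"
  by (intro eq_vecI) auto

lemma ip_zero_left: "x \<in> carrier_vec n \<Longrightarrow> h (0\<^sub>v n) x = 0"
  using ip_smult_left[of "0\<^sub>v n" x 0] by (simp add: smult_zero_vec)

lemma ip_zero_right: "x \<in> carrier_vec n \<Longrightarrow> h x (0\<^sub>v n) = 0"
  using ip_smult_right[of x "0\<^sub>v n" 0] by (simp add: smult_zero_vec)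

lemma ip_eqI:
  assumes "x \<in> carrier_vec n" "y \<in> carrier_vec n" "\<And>z. z \<in> carrier_vec n \<Longrightarrow> h z x = h z y"
  shows "x = y"
proof -
  let ?d = "x + (-1) \<cdot>\<^sub>v y"
  have d: "?d \<in> carrier_vec n" using assms by simp
  have "h ?d ?d = 0"
    using assms d by (subst ip_add_right) (auto simp: ip_smult_right)
  then have 0: "?d = 0\<^sub>v n" using d ip_definite by blast
  show ?thesis
  proof (rule eq_vecI)
    show "dim_vec x = dim_vec y" using assms by auto
    fix i assume "i < dim_vec y"
    then have "vec_index ?d i = 0" using 0 assms by simp
    then show "vec_index x i = vec_index y i" using \<open>i < dim_vec y\<close> assms by simp
  qed
qed

text \<open>With w = P z, the form of P at z - t w is b t^2 - 2 t a, where a is the squared norm of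
  w. Nonnegativity for small positive t forces a = 0.\<close>

lemma psd_kernel:
  assumes P: "P \<in> carrier_mat n n"
    and sa: "\<And>x y. x \<in> carrier_vec n \<Longrightarrow> y \<in> carrier_vec n \<Longrightarrow> h (P *\<^sub>v x) y = h x (P *\<^sub>v y)"
    and pos: "\<And>x. x \<in> carrier_vec n \<Longrightarrow> h (P *\<^sub>v x) x \<in> \<real>\<^sub>\<ge>\<^sub>0"
    and z: "z \<in> carrier_vec n" and hz: "h (P *\<^sub>v z) z = 0"
  shows "P *\<^sub>v z = 0\<^sub>v n"
proof -
  define w where "w = P *\<^sub>v z"
  have w: "w \<in> carrier_vec n" using P z by (simp add: w_def)
  obtain a where a: "h w w = of_real a" "a \<ge> 0" using ip_nonneg[OF w] by (auto elim: nonneg_Reals_cases)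
  obtain b where b: "h (P *\<^sub>v w) w = of_real b" "b \<ge> 0" using pos[OF w] by (auto elim: nonneg_Reals_cases)
  have q: "b * t\<^sup>2 - 2 * t * a \<ge> 0" for t :: real
  proof -
    let ?c = "- complex_of_real t"
    have Pw: "P *\<^sub>v w \<in> carrier_vec n" using P w by simp
    have "h (P *\<^sub>v (z + ?c \<cdot>\<^sub>v w)) (z + ?c \<cdot>\<^sub>v w) =
        h (w + ?c \<cdot>\<^sub>v (P *\<^sub>v w)) (z + ?c \<cdot>\<^sub>v w)"
      using P z w by (simp add: mult_add_distrib_mat_vec[of P n n] w_def[symmetric] mult_mat_vec[of P n n])
    also have "\<dots> = h w z + ?c * h w w + ?c * h (P *\<^sub>v w) z + ?c * ?c * h (P *\<^sub>v w) w"
      using z w Pw by (simp add: ip_add_left ip_add_right ip_smult_left ip_smult_right algebra_simps)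
    also have "h (P *\<^sub>v w) z = h w w" using sa[OF w z] by (simp add: w_def)
    also have "h w z = 0" using hz by (simp add: w_def)
    finally have "h (P *\<^sub>v (z + ?c \<cdot>\<^sub>v w)) (z + ?c \<cdot>\<^sub>v w) = of_real (b * t\<^sup>2 - 2 * t * a)"
      by (simp add: a b power2_eq_square algebra_simps)
    moreover have "h (P *\<^sub>v (z + ?c \<cdot>\<^sub>v w)) (z + ?c \<cdot>\<^sub>v w) \<in> \<real>\<^sub>\<ge>\<^sub>0"
      using z w by (intro pos) simp
    ultimately have "b * t\<^sup>2 - 2 * t * a \<ge> 0" by (metis nonneg_Reals_of_real_iff)
    then show ?thesis .
  qed
  have "a = 0"
  proof (rule ccontr)
    assume "a \<noteq> 0"
    then have a0: "a > 0" using a by simp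
    \<comment> \<open>The denominator b + 1 also covers b = 0; at t = c the quadratic takes the
      value - c^2 (b + 2).\<close>
    define c where "c = a / (b + 1)"
    have c: "a = c * (b + 1)" "c > 0" using a0 b by (simp_all add: c_def)
    have "b * c\<^sup>2 - 2 * c * a = - (c\<^sup>2 * (b + 2))"
      by (simp add: c(1) power2_eq_square algebra_simps)
    also have "\<dots> < 0" using c b by simp
    finally show False using q[of c] by linarith
  qed
  then show ?thesis using a ip_definite[OF w] by (simp add: w_def)
qed

text \<open>For y = (P - R) x, commutation gives (P + R) y = (P^2 - R^2) x = 0. Both nonnegative
  forms then vanish at y, so P y = R y = 0, and self-adjointness moves P - R from x onto y in h y
  y.\<close>

lemma psd_sqrt_unique:
  assumes P: "P \<in> carrier_mat n n"
    and Psa: "\<And>x y. x \<in> carrier_vec n \<Longrightarrow> y \<in> carrier_vec n \<Longrightarrow> h (P *\<^sub>v x) y = h x (P *\<^sub>v y)"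
    and Ppos: "\<And>x. x \<in> carrier_vec n \<Longrightarrow> h (P *\<^sub>v x) x \<in> \<real>\<^sub>\<ge>\<^sub>0"
    and R: "R \<in> carrier_mat n n"
    and Rsa: "\<And>x y. x \<in> carrier_vec n \<Longrightarrow> y \<in> carrier_vec n \<Longrightarrow> h (R *\<^sub>v x) y = h x (R *\<^sub>v y)"
    and Rpos: "\<And>x. x \<in> carrier_vec n \<Longrightarrow> h (R *\<^sub>v x) x \<in> \<real>\<^sub>\<ge>\<^sub>0"
    and sq: "P * P = R * R" and comm: "P * R = R * P"
  shows "P = R"
proof (rule mat_eqI_mult_vec[OF P R])
  fix x :: "complex Matrix.vec" assume x: "x \<in> carrier_vec n"
  define y where "y = P *\<^sub>v x + (-1) \<cdot>\<^sub>v (R *\<^sub>v x)"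
  have Px: "P *\<^sub>v x \<in> carrier_vec n" and Rx: "R *\<^sub>v x \<in> carrier_vec n" using P R x by auto
  have y: "y \<in> carrier_vec n" using Px Rx by (simp add: y_def)
  have Py: "P *\<^sub>v y \<in> carrier_vec n" and Ry: "R *\<^sub>v y \<in> carrier_vec n" using P R y by auto
  have "P *\<^sub>v y + R *\<^sub>v y =
      ((P * P) *\<^sub>v x + (-1) \<cdot>\<^sub>v ((P * R) *\<^sub>v x)) + ((R * P) *\<^sub>v x + (-1) \<cdot>\<^sub>v ((R * R) *\<^sub>v x))"
    using P R x Px Rx
    by (simp add: y_def mult_add_distrib_mat_vec[of _ n n] mult_mat_vec[of _ n n] assoc_mult_mat_vec[of _ n n _ n])
  also have "\<dots> = 0\<^sub>v n"
    unfolding sq comm using P R x by (intro eq_vecI) auto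
  finally have PR: "P *\<^sub>v y + R *\<^sub>v y = 0\<^sub>v n" .
  have "h (P *\<^sub>v y) y + h (R *\<^sub>v y) y = 0"
    using arg_cong[OF PR, of "\<lambda>v. h v y"] y Py Ry by (simp add: ip_add_left ip_zero_left)
  then have 0: "h (P *\<^sub>v y) y = 0" "h (R *\<^sub>v y) y = 0"
    using Ppos[OF y] Rpos[OF y] by (auto simp: complex_nonneg_Reals_iff complex_eq_iff)
  have "P *\<^sub>v y = 0\<^sub>v n" "R *\<^sub>v y = 0\<^sub>v n"
    using psd_kernel[OF P Psa Ppos y 0(1)] psd_kernel[OF R Rsa Rpos y 0(2)] by auto
  have "h y y = h (P *\<^sub>v x) y + (-1) * h (R *\<^sub>v x) y"
    using Px Rx y by (subst (1) y_def) (simp add: ip_add_left ip_smult_left)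
  also have "\<dots> = 0"
    using \<open>P *\<^sub>v y = _\<close> \<open>R *\<^sub>v y = _\<close> Psa[OF x y] Rsa[OF x y] x by (simp add: ip_zero_right)
  finally have y0: "y = 0\<^sub>v n" using ip_definite[OF y] by simp
  show "P *\<^sub>v x = R *\<^sub>v x"
  proof (rule eq_vecI)
    show "dim_vec (P *\<^sub>v x) = dim_vec (R *\<^sub>v x)" using P R by simp
    fix i assume i: "i < dim_vec (R *\<^sub>v x)"
    then have "vec_index y i = 0" using y0 R by simp
    then show "vec_index (P *\<^sub>v x) i = vec_index (R *\<^sub>v x) i" using i P R Px Rx by (simp add: y_def)
  qed
qed

text \<open>A root that is a polynomial in \<open>M\<close> commutes with every other root of \<open>M\<close>.\<close>

lemma sqrt_wrt_eqI:
  assumes M: "M \<in> carrier_mat n n" and R_def: "R = a \<cdot>\<^sub>m M + b \<cdot>\<^sub>m (M * M)"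
    and sa: "\<And>x y. x \<in> carrier_vec n \<Longrightarrow> y \<in> carrier_vec n \<Longrightarrow> h (R *\<^sub>v x) y = h x (R *\<^sub>v y)"
    and pos: "\<And>x. x \<in> carrier_vec n \<Longrightarrow> h (R *\<^sub>v x) x \<in> \<real>\<^sub>\<ge>\<^sub>0"
    and sq: "R * R = M"
  shows "sqrt_wrt h M = R"
proof -
  have R: "R \<in> carrier_mat n n" using M by (simp add: R_def)
  have dM: "dim_row M = n" using M by simp
  show ?thesis unfolding sqrt_wrt_def dM
  proof (rule the_equality, goal_cases)
    case 1
    then show ?case using R sa pos sq by auto
  next
    case prems: (2 P)
    then have P: "P \<in> carrier_mat n n" and PP: "M = P * P" by auto
    have 1: "P * M = M * P"
      using P unfolding PP by (simp add: assoc_mult_mat[of _ n n _ n _ n])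
    have "P * (M * M) = P * M * M"
      using P M by (intro assoc_mult_mat[of _ n n _ n _ n, symmetric]) auto
    also have "\<dots> = M * P * M" by (simp only: 1)
    also have "\<dots> = M * (P * M)"
      using P M by (intro assoc_mult_mat[of _ n n _ n _ n]) auto
    also have "\<dots> = M * M * P"
      unfolding 1 using P M by (intro assoc_mult_mat[of _ n n _ n _ n, symmetric]) auto
    finally have 2: "P * (M * M) = M * M * P" .
    have MM: "M * M \<in> carrier_mat n n" using M by simp
    have "P * R = a \<cdot>\<^sub>m (P * M) + b \<cdot>\<^sub>m (P * (M * M))"
      unfolding R_def using P M MM
      by (simp add: mult_add_distrib_mat[of _ n n _ n] mult_smult_distrib[of _ n n _ n])
    also have "\<dots> = R * P"
      unfolding R_def 1 2 using P M MM
      by (simp add: add_mult_distrib_mat[of _ n n _ _ n] mult_smult_assoc_mat[of _ n n _ n])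
    finally have comm: "P * R = R * P" .
    show ?case
      by (rule psd_sqrt_unique[OF P _ _ R sa pos _ comm]) (use prems sq in auto)
  qed
qed

end

lemma adjoint_wrt_eqI:
  assumes h: "hermitian_ip n h" and A: "A \<in> carrier_mat m n" and B: "B \<in> carrier_mat n m"
    and eq: "\<And>x y. x \<in> carrier_vec n \<Longrightarrow> y \<in> carrier_vec m \<Longrightarrow> h' (A *\<^sub>v x) y = h x (B *\<^sub>v y)"
  shows "adjoint_wrt h h' A = B"
proof -
  have d: "dim_col A = n" "dim_row A = m" using A by auto
  show ?thesis unfolding adjoint_wrt_def d
  proof (rule the_equality, goal_cases)
    case 1
    then show ?case using B eq by auto
  next
    case (2 C)
    then have C: "C \<in> carrier_mat n m" by simp
    show ?case
    proof (rule mat_eqI_mult_vec[OF C B])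
      fix y :: "complex Matrix.vec" assume y: "y \<in> carrier_vec m"
      have "h x (C *\<^sub>v y) = h x (B *\<^sub>v y)" if "x \<in> carrier_vec n" for x
        using 2 eq that y by auto
      then show "C *\<^sub>v y = B *\<^sub>v y" using B C y by (intro ip_eqI[OF h]) auto
    qed
  qed
qed

section \<open>Singular values of maps of rank one and two\<close>

text \<open>Symmetry and positivity of \<open>B * A\<close> are inherited from the pullback of h'
  along A.\<close>

lemma adjoint_product_psd:
  assumes h: "hermitian_ip n h" and h': "hermitian_ip m h'"
    and A: "A \<in> carrier_mat m n" and B: "B \<in> carrier_mat n m"
    and eq: "\<forall>x\<in>carrier_vec n. \<forall>y\<in>carrier_vec m. h' (A *\<^sub>v x) y = h x (B *\<^sub>v y)"
  shows "\<And>x y. x \<in> carrier_vec n \<Longrightarrow> y \<in> carrier_vec n \<Longrightarrow> h (B * A *\<^sub>v x) y = h' (A *\<^sub>v x) (A *\<^sub>v y)"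
    and "\<And>x y. x \<in> carrier_vec n \<Longrightarrow> y \<in> carrier_vec n \<Longrightarrow> h (B * A *\<^sub>v x) y = h x (B * A *\<^sub>v y)"
    and "\<And>x. x \<in> carrier_vec n \<Longrightarrow> h (B * A *\<^sub>v x) x \<in> \<real>\<^sub>\<ge>\<^sub>0"
proof -
  have r: "h x (B * A *\<^sub>v y) = h' (A *\<^sub>v x) (A *\<^sub>v y)"
    if "x \<in> carrier_vec n" "y \<in> carrier_vec n" for x y
    using bspec[OF bspec[OF eq], of x "A *\<^sub>v y"] that A B by (simp add: assoc_mult_mat_vec[of _ n m _ n])
  show l: "h (B * A *\<^sub>v x) y = h' (A *\<^sub>v x) (A *\<^sub>v y)"
    if xy: "x \<in> carrier_vec n" "y \<in> carrier_vec n" for x y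
  proof -
    have "B * A *\<^sub>v x \<in> carrier_vec n" "A *\<^sub>v x \<in> carrier_vec m" "A *\<^sub>v y \<in> carrier_vec m"
      using A B xy by auto
    then show ?thesis
      using ip_cnj[OF h xy(2), of "B * A *\<^sub>v x"] ip_cnj[OF h', of "A *\<^sub>v y" "A *\<^sub>v x"] r[OF xy(2) xy(1)]
      by simp
  qed
  show "h (B * A *\<^sub>v x) y = h x (B * A *\<^sub>v y)"
    if "x \<in> carrier_vec n" "y \<in> carrier_vec n" for x y
    using r[OF that] l[OF that] by simp
  show "h (B * A *\<^sub>v x) x \<in> \<real>\<^sub>\<ge>\<^sub>0" if "x \<in> carrier_vec n" for x
    using l[OF that that] ip_nonneg[OF h', of "A *\<^sub>v x"] A that by simp
qed

text \<open>Only coordinates below n are read, so that \<open>h_ip\<close> can equal such a form as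
  a function and not just on carrier vectors.\<close>

definition gram_ip :: "nat \<Rightarrow> (nat \<Rightarrow> nat \<Rightarrow> real) \<Rightarrow> herm" where
  "gram_ip n H x y = (\<Sum>i<n. \<Sum>j<n. of_real (H i j) * vec_index x i * cnj (vec_index y j))"

lemma gram_ip_scalar_prod:
  assumes "x \<in> carrier_vec n" "y \<in> carrier_vec n"
  shows "gram_ip n H x y =
    scalar_prod x (mat n n (\<lambda>(i, j). of_real (H i j)) *\<^sub>v map_vec cnj y)"
  using assms
  by (auto simp: gram_ip_def scalar_prod_def sum_distrib_left atLeast0LessThan mult_ac intro!: sum.cong)

text \<open>For Gram matrices G and G' the adjoint is the complex conjugate of G^-1 A^T G'. G is
  invertible because the conjugate of a null vector would be isotropic for a definite form.\<close>

lemma adjoint_gram_exists: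
  assumes h: "hermitian_ip n (gram_ip n H)" and A: "A \<in> carrier_mat m n"
  obtains B where "B \<in> carrier_mat n m"
    and "\<And>x y. x \<in> carrier_vec n \<Longrightarrow> y \<in> carrier_vec m \<Longrightarrow>
      gram_ip m H' (A *\<^sub>v x) y = gram_ip n H x (B *\<^sub>v y)"
proof -
  let ?G = "mat n n (\<lambda>(i, j). complex_of_real (H i j))"
  let ?G' = "mat m m (\<lambda>(i, j). complex_of_real (H' i j))"
  have d: "det ?G \<noteq> 0"
  proof
    assume "det ?G = 0"
    then obtain v where v: "v \<in> carrier_vec n" "v \<noteq> 0\<^sub>v n" "?G *\<^sub>v v = 0\<^sub>v n"
      using det_0_iff_vec_prod_zero[of ?G n] by auto
    let ?w = "map_vec cnj v"
    have ww: "?w \<in> carrier_vec n" "map_vec cnj ?w = v" using v by (auto intro!: eq_vecI)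
    then have "gram_ip n H ?w ?w = 0"
      using v by (subst gram_ip_scalar_prod) simp_all
    then have "?w = 0\<^sub>v n" using ip_definite[OF h] ww by simp
    then have "v = 0\<^sub>v n" using ww v(1) by (metis complex_cnj_zero eq_vecI index_map_vec index_zero_vec carrier_vecD)
    then show False using v by simp
  qed
  define I where "I = (1 / det ?G) \<cdot>\<^sub>m adj_mat ?G"
  have I: "I \<in> carrier_mat n n" using adj_mat(1)[of ?G n] by (simp add: I_def)
  have GI: "?G * I = 1\<^sub>m n"
    unfolding I_def using adj_mat[of ?G n] d
    by (subst mult_smult_distrib[of _ n n _ n]) (auto intro!: eq_matI)
  define C where "C = I * (transpose_mat A * ?G')"
  have C: "C \<in> carrier_mat n m" using I A by (simp add: C_def)
  have "?G * C = ?G * I * (transpose_mat A * ?G')"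
    unfolding C_def using I A by (intro assoc_mult_mat[symmetric, of _ n n _ n _ m]) auto
  also have "\<dots> = transpose_mat A * ?G'" unfolding GI using A by (intro left_mult_one_mat[of _ n m]) auto
  finally have GC: "?G * C = transpose_mat A * ?G'" .
  show thesis
  proof (rule that)
    show B: "map_mat cnj C \<in> carrier_mat n m" using C by simp
    fix x y :: "complex Matrix.vec" assume x: "x \<in> carrier_vec n" and y: "y \<in> carrier_vec m"
    have cy: "map_vec cnj y \<in> carrier_vec m" using y by simp
    have conj: "map_vec cnj (map_mat cnj C *\<^sub>v y) = C *\<^sub>v map_vec cnj y"
      using C y by (intro eq_vecI) (auto simp: scalar_prod_def)
    have "gram_ip n H x (map_mat cnj C *\<^sub>v y) = scalar_prod x (?G *\<^sub>v (C *\<^sub>v map_vec cnj y))"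
      using x y B by (subst gram_ip_scalar_prod) (auto simp: conj)
    also have "?G *\<^sub>v (C *\<^sub>v map_vec cnj y) = transpose_mat A * ?G' *\<^sub>v map_vec cnj y"
      using C cy by (subst assoc_mult_mat_vec[symmetric, of _ n n _ m]) (auto simp: GC)
    also have "\<dots> = transpose_mat A *\<^sub>v (?G' *\<^sub>v map_vec cnj y)"
      using A cy by (intro assoc_mult_mat_vec[of _ n m _ m]) auto
    also have "scalar_prod x \<dots> = scalar_prod (A *\<^sub>v x) (?G' *\<^sub>v map_vec cnj y)"
    proof -
      have w: "?G' *\<^sub>v map_vec cnj y \<in> carrier_vec m" using mult_mat_vec_carrier[of ?G' m m] cy by simp
      then have tw: "transpose_mat A *\<^sub>v (?G' *\<^sub>v map_vec cnj y) \<in> carrier_vec n"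
        using A mult_mat_vec_carrier[of "transpose_mat A" n m] by simp
      show ?thesis
        using transpose_vec_mult_scalar[OF A x w] comm_scalar_prod[OF x tw]
          comm_scalar_prod[OF w, of "A *\<^sub>v x"] A x by simp
    qed
    also have "\<dots> = gram_ip m H' (A *\<^sub>v x) y"
      using A x y by (subst gram_ip_scalar_prod) auto
    finally show "gram_ip m H' (A *\<^sub>v x) y = gram_ip n H x (map_mat cnj C *\<^sub>v y)" ..
  qed
qed

text \<open>An outer product has rank at most one, so its trace is the only eigenvalue that can be
  nonzero. The sizes 1, 2, 3 are the dimensions of the cohomology spaces.\<close>

lemma det_star_outer_product:
  assumes "n \<in> {1, 2, 3}" and ne: "(\<Sum>i<n. a i * w i) \<noteq> 0"
  shows "det_star (mat n n (\<lambda>(i, j). a i * w j)) = (\<Sum>i<n. a i * w i)"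
proof -
  consider "n = 1" | "n = 2" | "n = 3" using assms by auto
  then show ?thesis
  proof cases
    case 1
    then show ?thesis using ne by (subst det_star_1) auto
  next
    case 2
    then show ?thesis
      using ne by (subst det_star_2) (auto simp: det_carrier_2 eval_nat_numeral)
  next
    case 3
    let ?A = "mat 3 3 (\<lambda>(i, j). a i * w j)"
    have s: "(\<Sum>i<3. a i * w i) = tr3 ?A" by (simp add: tr3_def eval_nat_numeral)
    have "det_star ?A = tr3 ?A"
    proof (rule det_star_3_rank_1)
      show "det ?A = 0" by (subst det_carrier_3) (simp_all add: algebra_simps)
      show "e2 ?A = 0" by (simp add: e2_def)
      show "tr3 ?A \<noteq> 0" using s ne 3 by simp
    qed simp
    then show ?thesis using 3 s by simp
  qed
qed

text \<open>The vector u represents the functional w, so A x = h(x, u) v, and the adjoint sends v to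
  k u. Hence M, the adjoint times A, satisfies M^2 = k l M, where k and l are the squared norms of v
  and u. Its root M / sqrt (k l) has rank one and trace sqrt (k l).\<close>

lemma det_star_abs_rank_1:
  assumes h: "hermitian_ip n (gram_ip n H)" and h': "hermitian_ip m (gram_ip m H')"
    and n: "n \<in> {1, 2, 3}"
    and A: "A = mat m n (\<lambda>(i, j). v i * w j)"
    and riesz: "\<And>x. x \<in> carrier_vec n \<Longrightarrow> gram_ip n H x (Matrix.vec n u) = (\<Sum>j<n. w j * vec_index x j)"
    and k: "gram_ip m H' (Matrix.vec m v) (Matrix.vec m v) = of_real k"
    and l: "(\<Sum>j<n. w j * u j) = of_real l"
    and pos: "k > 0" "l > 0"
  shows "det_star (abs_wrt (gram_ip n H) (gram_ip m H') A) = of_real (sqrt (k * l))"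
proof -
  let ?h = "gram_ip n H" and ?h' = "gram_ip m H'" and ?u = "Matrix.vec n u" and ?v = "Matrix.vec m v"
  have A': "A \<in> carrier_mat m n" by (simp add: A)
  have uc: "?u \<in> carrier_vec n" and vc: "?v \<in> carrier_vec m" by auto
  obtain B where B: "B \<in> carrier_mat n m"
    and adj: "\<And>x y. x \<in> carrier_vec n \<Longrightarrow> y \<in> carrier_vec m \<Longrightarrow> ?h' (A *\<^sub>v x) y = ?h x (B *\<^sub>v y)"
    using adjoint_gram_exists[OF h A'] by metis
  have Ax: "A *\<^sub>v x = ?h x ?u \<cdot>\<^sub>v ?v" if x: "x \<in> carrier_vec n" for x
    using x by (intro eq_vecI)
      (auto simp: riesz A scalar_prod_def sum_distrib_left sum_distrib_right atLeast0LessThan mult_ac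
        intro!: sum.cong)
  have Bv: "B *\<^sub>v ?v = of_real k \<cdot>\<^sub>v ?u"
  proof (rule ip_eqI[OF h])
    fix x :: "complex Matrix.vec" assume x: "x \<in> carrier_vec n"
    have "?h x (B *\<^sub>v ?v) = ?h x ?u * of_real k"
      using adj[OF x vc] ip_smult_left[OF h' vc vc] by (simp add: Ax[OF x] k)
    then show "?h x (B *\<^sub>v ?v) = ?h x (of_real k \<cdot>\<^sub>v ?u)"
      using x by (simp add: ip_smult_right[OF h])
  qed (use B in auto)
  define M where "M = B * A"
  have M: "M \<in> carrier_mat n n" using A' B by (simp add: M_def)
  have Mx: "M *\<^sub>v x = (?h x ?u * of_real k) \<cdot>\<^sub>v ?u" if x: "x \<in> carrier_vec n" for x
  proof -
    have "M *\<^sub>v x = B *\<^sub>v (A *\<^sub>v x)"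
      unfolding M_def using A' B x by (intro assoc_mult_mat_vec[of _ n m _ n]) auto
    also have "\<dots> = ?h x ?u \<cdot>\<^sub>v (B *\<^sub>v ?v)"
      unfolding Ax[OF x] using B by (intro mult_mat_vec[of _ n m]) auto
    finally show ?thesis by (simp add: Bv smult_smult_assoc)
  qed
  have uu: "?h ?u ?u = of_real l" using riesz[OF uc] l by simp
  have MM: "M *\<^sub>v (M *\<^sub>v x) = of_real (k * l) \<cdot>\<^sub>v (M *\<^sub>v x)" if x: "x \<in> carrier_vec n" for x
    using uc by (simp add: Mx x ip_smult_left[OF h] uu smult_smult_assoc mult_ac)
  \<comment> \<open>The zero multiple of \<open>M * M\<close> only brings the root into the shape
    required by \<open>sqrt_wrt_eqI\<close>.\<close>
  define R where "R = of_real (1 / sqrt (k * l)) \<cdot>\<^sub>m M + 0 \<cdot>\<^sub>m (M * M)"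
  have R: "R \<in> carrier_mat n n" using M by (simp add: R_def)
  have R': "R = of_real (1 / sqrt (k * l)) \<cdot>\<^sub>m M"
    unfolding R_def using M by (intro eq_matI) auto
  have Rx: "R *\<^sub>v x = of_real (1 / sqrt (k * l)) \<cdot>\<^sub>v (M *\<^sub>v x)" if "x \<in> carrier_vec n" for x
    unfolding R' using M that by (intro eq_vecI) auto
  have "\<forall>x\<in>carrier_vec n. \<forall>y\<in>carrier_vec m. ?h' (A *\<^sub>v x) y = ?h x (B *\<^sub>v y)"
    using adj by auto
  note psd = adjoint_product_psd[OF h h' A' B this, folded M_def]
  have "sqrt_wrt ?h M = R"
  proof (rule sqrt_wrt_eqI[OF h M R_def])
    fix x y :: "complex Matrix.vec" assume x: "x \<in> carrier_vec n" and y: "y \<in> carrier_vec n"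
    have Mc: "M *\<^sub>v x \<in> carrier_vec n" "M *\<^sub>v y \<in> carrier_vec n" using M x y by auto
    show "?h (R *\<^sub>v x) y = ?h x (R *\<^sub>v y)"
      using psd(2)[OF x y] x y Mc by (simp add: Rx ip_smult_left[OF h] ip_smult_right[OF h] del: of_real_divide)
  next
    fix x :: "complex Matrix.vec" assume x: "x \<in> carrier_vec n"
    have Mc: "M *\<^sub>v x \<in> carrier_vec n" using M x by auto
    have "?h (R *\<^sub>v x) x = of_real (1 / sqrt (k * l)) * ?h (M *\<^sub>v x) x"
      using x Mc by (simp add: Rx ip_smult_left[OF h] del: of_real_divide)
    then show "?h (R *\<^sub>v x) x \<in> \<real>\<^sub>\<ge>\<^sub>0"
      using psd(3)[OF x] pos by (simp only:) (intro nonneg_Reals_mult_I, auto)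
  next
    show "R * R = M"
    proof (rule mat_eqI_mult_vec[of _ n n])
      fix x :: "complex Matrix.vec" assume x: "x \<in> carrier_vec n"
      have Mc: "M *\<^sub>v x \<in> carrier_vec n" using M x by auto
      have "complex_of_real (1 / sqrt (k * l) * (1 / sqrt (k * l)) * (k * l)) = 1"
        using pos by (simp add: field_simps real_sqrt_mult)
      then have c: "complex_of_real (1 / sqrt (k * l)) * (of_real (1 / sqrt (k * l)) * of_real (k * l)) = 1"
        by (simp only: of_real_mult mult.assoc)
      have "R * R *\<^sub>v x = R *\<^sub>v (R *\<^sub>v x)" using R x by (intro assoc_mult_mat_vec[of _ n n _ n]) auto
      also have "\<dots> = of_real (1 / sqrt (k * l)) \<cdot>\<^sub>v (of_real (1 / sqrt (k * l)) \<cdot>\<^sub>v (M *\<^sub>v (M *\<^sub>v x)))"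
        using M x Mc by (simp add: Rx mult_mat_vec[of _ n n] del: of_real_divide)
      also have "\<dots> = M *\<^sub>v x"
        unfolding MM[OF x] smult_smult_assoc c by simp
      finally show "R * R *\<^sub>v x = M *\<^sub>v x" .
    qed (use R M in auto)
  qed
  moreover have "adjoint_wrt ?h ?h' A = B" by (rule adjoint_wrt_eqI[OF h A' B adj])
  ultimately have abs: "abs_wrt ?h ?h' A = R" by (simp add: abs_wrt_def M_def)
  define c where "c = complex_of_real (k / sqrt (k * l))"
  have "R = mat n n (\<lambda>(i, j). (c * u i) * w j)"
  proof (rule eq_matI)
    fix i j assume "i < dim_row (mat n n (\<lambda>(i, j). (c * u i) * w j))" "j < dim_col (mat n n (\<lambda>(i, j). (c * u i) * w j))"
    then have ij: "i < n" "j < n" by auto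
    have "R $$ (i, j) = vec_index (R *\<^sub>v unit_vec n j) i" using R ij by simp
    also have "\<dots> = of_real (1 / sqrt (k * l)) * (?h (unit_vec n j) ?u * of_real k * u i)"
      using ij M by (simp add: Rx Mx)
    also have "?h (unit_vec n j) ?u = w j"
      using ij by (subst riesz) (auto simp: unit_vec_def if_distrib cong: if_cong)
    finally show "R $$ (i, j) = mat n n (\<lambda>(i, j). (c * u i) * w j) $$ (i, j)"
      using ij by (simp add: c_def)
  qed (use R in auto)
  moreover have sum: "(\<Sum>i<n. c * u i * w i) = of_real (sqrt (k * l))"
  proof -
    have "(\<Sum>i<n. c * u i * w i) = c * of_real l"
      unfolding l[symmetric] by (simp add: sum_distrib_left mult_ac)
    also have "\<dots> = of_real (k * l / sqrt (k * l))" by (simp add: c_def)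
    also have "k * l / sqrt (k * l) = sqrt (k * l)" using pos by (simp add: real_div_sqrt)
    finally show ?thesis .
  qed
  moreover have "complex_of_real (sqrt (k * l)) \<noteq> 0" using pos by simp
  ultimately show ?thesis
    using det_star_outer_product[OF n, of "\<lambda>i. c * u i" w] abs by simp
qed


lemma cayley_hamilton_3:
  fixes M :: "'a::comm_ring_1 mat"
  assumes M: "M \<in> carrier_mat 3 3" and d: "det M = 0"
  shows "M * M * M = tr3 M \<cdot>\<^sub>m (M * M) + (- e2 M) \<cdot>\<^sub>m M"
proof (rule eq_matI)
  show "dim_row (M * M * M) = dim_row (tr3 M \<cdot>\<^sub>m (M * M) + (- e2 M) \<cdot>\<^sub>m M)"
    "dim_col (M * M * M) = dim_col (tr3 M \<cdot>\<^sub>m (M * M) + (- e2 M) \<cdot>\<^sub>m M)" using M by auto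
  fix i j assume "i < dim_row (tr3 M \<cdot>\<^sub>m (M * M) + (- e2 M) \<cdot>\<^sub>m M)"
    "j < dim_col (tr3 M \<cdot>\<^sub>m (M * M) + (- e2 M) \<cdot>\<^sub>m M)"
  then have ij: "i < 3" "j < 3" using M by auto
  \<comment> \<open>With the correction term \<open>det M\<close> times the identity this is a
    polynomial identity in nine arbitrary entries.\<close>
  have "(M * M * M) $$ (i, j) = (tr3 M \<cdot>\<^sub>m (M * M) + (- e2 M) \<cdot>\<^sub>m M) $$ (i, j) +
      det M * (1\<^sub>m 3 $$ (i, j))"
    using ij M unfolding det_carrier_3[OF M] tr3_def e2_def less_Suc_eq[of _ 2] numeral_3_eq_3 numeral_2_eq_2
    by (auto simp: less_Suc_eq scalar_prod_def algebra_simps)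
  then show "(M * M * M) $$ (i, j) = (tr3 M \<cdot>\<^sub>m (M * M) + (- e2 M) \<cdot>\<^sub>m M) $$ (i, j)"
    using d by simp
qed

text \<open>Newton's identity for power sums. It serves twice: for \<open>M\<close>, to find the
  trace of its square, and for the root \<open>R\<close>, to recover \<open>e2 R\<close> from the
  traces of \<open>R\<close> and \<open>R * R\<close>.\<close>

lemma tr3_square:
  fixes M :: "'a::comm_ring_1 mat"
  assumes M: "M \<in> carrier_mat 3 3"
  shows "tr3 (M * M) = (tr3 M)\<^sup>2 - 2 * e2 M"
proof -
  have i: "(M * M) $$ (i, j) = M $$ (i,0) * M $$ (0,j) + M $$ (i,1) * M $$ (1,j) + M $$ (i,2) * M $$ (2,j)"
    if "i < 3" "j < 3" for i j
    using that M by (simp add: scalar_prod_def eval_nat_numeral)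
  show ?thesis
    unfolding tr3_def e2_def by (simp add: i power2_eq_square algebra_simps)
qed

text \<open>Since det M = 0, both roots of z^2 - (tr M) z + e2 are eigenvalues of M. Each is
  nonnegative because h (M v) v = z h v v at an eigenvector v, and their sum is the trace.\<close>

lemma psd_tr3_nonneg:
  assumes h: "hermitian_ip 3 h" and M: "M \<in> carrier_mat 3 3"
    and pos: "\<And>x. x \<in> carrier_vec 3 \<Longrightarrow> h (M *\<^sub>v x) x \<in> \<real>\<^sub>\<ge>\<^sub>0"
    and d: "det M = 0"
  shows "tr3 M \<in> \<real>\<^sub>\<ge>\<^sub>0"
proof -
  have ev: "z \<in> \<real>\<^sub>\<ge>\<^sub>0" if root: "z * z - tr3 M * z + e2 M = 0" for z
  proof -
    have "poly (char_poly M) z = z * (z * z - tr3 M * z + e2 M)"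
      using d by (simp add: char_poly_3[OF M] algebra_simps)
    then have "eigenvalue M z" using root eigenvalue_root_char_poly[OF M] by simp
    then obtain v where v: "v \<in> carrier_vec 3" "v \<noteq> 0\<^sub>v 3" "M *\<^sub>v v = z \<cdot>\<^sub>v v"
      using M by (auto simp: eigenvalue_def eigenvector_def)
    obtain a where a: "h v v = of_real a" "a \<ge> 0" using ip_nonneg[OF h v(1)] by (auto elim: nonneg_Reals_cases)
    have "a \<noteq> 0" using ip_definite[OF h v(1)] v(2) a(1) by auto
    have "h (M *\<^sub>v v) v = z * of_real a" using v a by (simp add: ip_smult_left[OF h])
    then have "z * of_real a \<in> \<real>\<^sub>\<ge>\<^sub>0" using pos[OF v(1)] by simp
    then have "z * of_real a * of_real (1 / a) \<in> \<real>\<^sub>\<ge>\<^sub>0"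
      by (rule nonneg_Reals_mult_I) (use a in auto)
    moreover have "z * of_real a * of_real (1 / a) = z" using \<open>a \<noteq> 0\<close> by simp
    ultimately show ?thesis by metis
  qed
  \<comment> \<open>A complex root of the discriminant, as neither the trace nor \<open>e2 M\<close>
    is known to be real here.\<close>
  obtain r where r: "r * r = (tr3 M)\<^sup>2 - 4 * e2 M" by (metis power2_csqrt power2_eq_square)
  have key: "((tr3 M + c * r) / 2) * ((tr3 M + c * r) / 2) - tr3 M * ((tr3 M + c * r) / 2) + e2 M =
      (c * c * (r * r) - ((tr3 M)\<^sup>2 - 4 * e2 M)) / 4" for c
    by (simp add: field_simps power2_eq_square)
  have "(tr3 M + c * r) / 2 \<in> \<real>\<^sub>\<ge>\<^sub>0" if "c * c = 1" for c
    by (rule ev) (simp only: key r that, simp)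
  from this[of 1] this[of "-1"]
  have "(tr3 M + 1 * r) / 2 \<in> \<real>\<^sub>\<ge>\<^sub>0" "(tr3 M + (- 1) * r) / 2 \<in> \<real>\<^sub>\<ge>\<^sub>0" by auto
  then have "(tr3 M + 1 * r) / 2 + (tr3 M + (- 1) * r) / 2 \<in> \<real>\<^sub>\<ge>\<^sub>0" by (rule nonneg_Reals_add_I)
  then show ?thesis by (simp add: field_simps)
qed

lemma smult_mat_mult_vec:
  fixes A :: "'a::comm_ring_1 mat"
  assumes "A \<in> carrier_mat m n" "v \<in> carrier_vec n"
  shows "(c \<cdot>\<^sub>m A) *\<^sub>v v = c \<cdot>\<^sub>v (A *\<^sub>v v)"
  using assms by (intro eq_vecI) auto

text \<open>On the two-dimensional image of M the root N satisfies N^2 - (tr N) N + s = 0, so N = (M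
  + s) / t with t = tr N and t^2 = e + 2 s. Replacing the identity of the image by (e M - M^2) / s^2
  turns this into a polynomial in M.\<close>

lemma det_star_sqrt_rank_2:
  assumes h: "hermitian_ip 3 h" and M: "M \<in> carrier_mat 3 3"
    and sa: "\<And>x y. x \<in> carrier_vec 3 \<Longrightarrow> y \<in> carrier_vec 3 \<Longrightarrow> h (M *\<^sub>v x) y = h x (M *\<^sub>v y)"
    and pos: "\<And>x. x \<in> carrier_vec 3 \<Longrightarrow> h (M *\<^sub>v x) x \<in> \<real>\<^sub>\<ge>\<^sub>0"
    and d: "det M = 0" and e2: "e2 M = of_real (s\<^sup>2)" and s: "s > 0"
  shows "det_star (sqrt_wrt h M) = of_real s"
proof -
  obtain e where e: "tr3 M = of_real e" "e \<ge> 0"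
    using psd_tr3_nonneg[OF h M pos d] by (auto elim: nonneg_Reals_cases)
  define t where "t = sqrt (e + 2 * s)"
  have t: "t > 0" "t\<^sup>2 = e + 2 * s" using e s by (simp_all add: t_def)
  define a where "a = (1 + e / s) / t"
  define b where "b = - 1 / (s * t)"
  \<comment> \<open>\<open>c1\<close> and \<open>c2\<close> concern the coefficients of M^2 and of M
    in R^2, after Cayley-Hamilton has reduced M^3 and M^4; they must be 0 and 1.\<close>
  have c1: "a\<^sup>2 + 2 * a * b * e + b\<^sup>2 * (e\<^sup>2 - s\<^sup>2) = 0"
    using s t(1) by (simp add: a_def b_def field_simps power2_eq_square)
  have "(2 * a * b + b\<^sup>2 * e) * (- s\<^sup>2) = (e + 2 * s) / t\<^sup>2"
    using s t(1) by (simp add: a_def b_def field_simps power2_eq_square)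
  then have c2: "(2 * a * b + b\<^sup>2 * e) * (- s\<^sup>2) = 1"
    unfolding t(2)[symmetric] using t(1) by simp
  define R where "R = of_real a \<cdot>\<^sub>m M + of_real b \<cdot>\<^sub>m (M * M)"
  have R: "R \<in> carrier_mat 3 3" using M by (simp add: R_def)
  have Mc: "M *\<^sub>v x \<in> carrier_vec 3" if "x \<in> carrier_vec 3" for x using M that by simp
  have comb: "(x \<cdot>\<^sub>m M + y \<cdot>\<^sub>m (M * M)) *\<^sub>v v = x \<cdot>\<^sub>v (M *\<^sub>v v) + y \<cdot>\<^sub>v (M *\<^sub>v (M *\<^sub>v v))"
    if v: "v \<in> carrier_vec 3" for x y v
  proof -
    have "(x \<cdot>\<^sub>m M + y \<cdot>\<^sub>m (M * M)) *\<^sub>v v = (x \<cdot>\<^sub>m M) *\<^sub>v v + (y \<cdot>\<^sub>m (M * M)) *\<^sub>v v"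
      using M v by (intro add_mult_distrib_mat_vec[of _ 3 3]) auto
    also have "(x \<cdot>\<^sub>m M) *\<^sub>v v = x \<cdot>\<^sub>v (M *\<^sub>v v)"
      by (rule smult_mat_mult_vec[OF M v])
    also have "(y \<cdot>\<^sub>m (M * M)) *\<^sub>v v = y \<cdot>\<^sub>v ((M * M) *\<^sub>v v)"
      using M v by (intro smult_mat_mult_vec[of _ 3 3]) auto
    also have "(M * M) *\<^sub>v v = M *\<^sub>v (M *\<^sub>v v)"
      using M v by (intro assoc_mult_mat_vec[of _ 3 3 _ 3]) auto
    finally show ?thesis .
  qed
  have M3: "M *\<^sub>v (M *\<^sub>v (M *\<^sub>v v)) = of_real e \<cdot>\<^sub>v (M *\<^sub>v (M *\<^sub>v v)) + (- of_real (s\<^sup>2)) \<cdot>\<^sub>v (M *\<^sub>v v)"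
    if v: "v \<in> carrier_vec 3" for v
  proof -
    have "M *\<^sub>v (M *\<^sub>v (M *\<^sub>v v)) = (M * M * M) *\<^sub>v v"
      using M v Mc by (simp add: assoc_mult_mat_vec[of _ 3 3 _ 3])
    also have "M * M * M = (- of_real (s\<^sup>2)) \<cdot>\<^sub>m M + of_real e \<cdot>\<^sub>m (M * M)"
      unfolding cayley_hamilton_3[OF M d] e e2 using M by (intro comm_add_mat) auto
    also have "\<dots> *\<^sub>v v = (- of_real (s\<^sup>2)) \<cdot>\<^sub>v (M *\<^sub>v v) + of_real e \<cdot>\<^sub>v (M *\<^sub>v (M *\<^sub>v v))"
      by (rule comb[OF v])
    finally show ?thesis using v Mc by (simp add: comm_add_vec[of _ 3])
  qed
  have self_adj: "h (x \<cdot>\<^sub>v (M *\<^sub>v v) + y \<cdot>\<^sub>v (M *\<^sub>v (M *\<^sub>v v))) w =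
      h v (x \<cdot>\<^sub>v (M *\<^sub>v w) + y \<cdot>\<^sub>v (M *\<^sub>v (M *\<^sub>v w)))"
    if "v \<in> carrier_vec 3" "w \<in> carrier_vec 3" "cnj x = x" "cnj y = y" for x y v w
    using that Mc by (simp add: ip_add_left[OF h] ip_add_right[OF h] ip_smult_left[OF h] ip_smult_right[OF h] sa)
  have mult_comb: "M *\<^sub>v (x \<cdot>\<^sub>v v + y \<cdot>\<^sub>v w) = x \<cdot>\<^sub>v (M *\<^sub>v v) + y \<cdot>\<^sub>v (M *\<^sub>v w)"
    if "v \<in> carrier_vec 3" "w \<in> carrier_vec 3" for x y v w
    using that M by (simp add: mult_add_distrib_mat_vec[of _ 3 3] mult_mat_vec[of _ 3 3])
  \<comment> \<open>\<open>T\<close> is the orthogonal projection onto the image of \<open>M\<close>.\<close>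
  define T where "T v = of_real (e / s\<^sup>2) \<cdot>\<^sub>v (M *\<^sub>v v) + of_real (- 1 / s\<^sup>2) \<cdot>\<^sub>v (M *\<^sub>v (M *\<^sub>v v))" for v
  have T: "T v \<in> carrier_vec 3" if "v \<in> carrier_vec 3" for v using that Mc by (simp add: T_def)
  have MT: "M *\<^sub>v T v = M *\<^sub>v v" if v: "v \<in> carrier_vec 3" for v
    unfolding T_def using v Mc s
    by (subst mult_comb) (auto simp: M3 intro!: eq_vecI simp: field_simps)
  have TT: "T (T v) = T v" if "v \<in> carrier_vec 3" for v
    by (subst (1 3) T_def) (simp add: MT that)
  have Tpos: "h (T v) v \<in> \<real>\<^sub>\<ge>\<^sub>0" if v: "v \<in> carrier_vec 3" for v
  proof -
    have "h (T (T v)) v = h (T v) (T v)"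
      by (subst (1 4) T_def) (rule self_adj[OF T[OF v] v], simp_all)
    then show ?thesis using ip_nonneg[OF h T[OF v]] TT[OF v] by simp
  qed
  have Rx: "R *\<^sub>v v = of_real a \<cdot>\<^sub>v (M *\<^sub>v v) + of_real b \<cdot>\<^sub>v (M *\<^sub>v (M *\<^sub>v v))" if "v \<in> carrier_vec 3" for v
    unfolding R_def by (rule comb[OF that])
  \<comment> \<open>In this form R is a sum of two positive semidefinite maps, which is not visible
    from its coefficients a and b of opposite sign.\<close>
  have RT: "R *\<^sub>v v = of_real (1 / t) \<cdot>\<^sub>v (M *\<^sub>v v) + of_real (s / t) \<cdot>\<^sub>v T v" if v: "v \<in> carrier_vec 3" for v
    unfolding Rx[OF v] T_def using v M Mc[OF v] Mc[OF Mc[OF v]] s t(1)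
    by (intro eq_vecI) (auto simp: a_def b_def field_simps power2_eq_square)
  have RR: "R * R = M"
  proof (rule mat_eqI_mult_vec[of _ 3 3])
    fix v :: "complex Matrix.vec" assume v: "v \<in> carrier_vec 3"
    have "R * R *\<^sub>v v = R *\<^sub>v (R *\<^sub>v v)" using R v by (intro assoc_mult_mat_vec[of _ 3 3 _ 3]) auto
    also have "\<dots> = M *\<^sub>v v"
    proof (rule eq_vecI)
      show "dim_vec (R *\<^sub>v (R *\<^sub>v v)) = dim_vec (M *\<^sub>v v)" using R M by simp
      fix i assume "i < dim_vec (M *\<^sub>v v)"
      then have i: "i < 3" using M by simp
      let ?A = "vec_index (M *\<^sub>v v) i" and ?B = "vec_index (M *\<^sub>v (M *\<^sub>v v)) i"
      have "vec_index (R *\<^sub>v (R *\<^sub>v v)) i =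
        of_real (a\<^sup>2 + 2 * a * b * e + b\<^sup>2 * (e\<^sup>2 - s\<^sup>2)) * ?B + of_real ((2 * a * b + b\<^sup>2 * e) * (- s\<^sup>2)) * ?A"
        using v Mc i M R by (simp add: Rx mult_comb mult_mat_vec[OF M] M3 power2_eq_square algebra_simps del: index_mult_mat_vec)
      then show "vec_index (R *\<^sub>v (R *\<^sub>v v)) i = ?A" unfolding c1 c2 by simp
    qed
    finally show "R * R *\<^sub>v v = M *\<^sub>v v" .
  qed (use R M in auto)
  have sqrt: "sqrt_wrt h M = R"
  proof (rule sqrt_wrt_eqI[OF h M R_def _ _ RR])
    fix x y :: "complex Matrix.vec" assume "x \<in> carrier_vec 3" "y \<in> carrier_vec 3"
    then show "h (R *\<^sub>v x) y = h x (R *\<^sub>v y)" by (simp add: Rx self_adj)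
  next
    fix x :: "complex Matrix.vec" assume x: "x \<in> carrier_vec 3"
    have "h (R *\<^sub>v x) x = of_real (1 / t) * h (M *\<^sub>v x) x + of_real (s / t) * h (T x) x"
      using x Mc T by (simp add: RT ip_add_left[OF h] ip_smult_left[OF h] del: of_real_divide)
    then show "h (R *\<^sub>v x) x \<in> \<real>\<^sub>\<ge>\<^sub>0"
      using pos[OF x] Tpos[OF x] s t(1)
      by (simp only:) (intro nonneg_Reals_add_I nonneg_Reals_mult_I, auto)
  qed
  have "tr3 R = of_real a * tr3 M + of_real b * tr3 (M * M)"
    using M unfolding tr3_def by (simp add: R_def algebra_simps)
  also have "\<dots> = of_real (a * e + b * (e\<^sup>2 - 2 * s\<^sup>2))"
    by (simp add: tr3_square[OF M] e e2)
  also have "a * e + b * (e\<^sup>2 - 2 * s\<^sup>2) = (e + 2 * s) / t"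
    using s t(1) by (simp add: a_def b_def field_simps power2_eq_square)
  finally have "(tr3 R)\<^sup>2 = of_real (((e + 2 * s) / t)\<^sup>2)" by simp
  also have "((e + 2 * s) / t)\<^sup>2 = e + 2 * s"
    using t by (simp add: power_divide) (simp add: power2_eq_square)
  \<comment> \<open>Newton's identity for R: the squared trace minus the trace of R^2 is (e + 2 s) -
    e.\<close>
  finally have "2 * e2 R = 2 * of_real s"
    using tr3_square[OF R] by (simp add: RR e)
  then have "e2 R = of_real s" by simp
  moreover have "det R = 0" using det_mult[OF R R] d by (simp add: RR)
  ultimately show ?thesis using det_star_3_rank_2[OF R] s by (simp add: sqrt)
qed

section \<open>Alternating forms\<close>

text \<open>Splitting off the least entry; the lower bound a varies because the remaining entries
  lie above it.\<close>

lemma multi_indices_Suc: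
  "{I. length I = Suc n \<and> sorted_wrt (<) I \<and> set I \<subseteq> {a..b::nat}} =
   (\<Union>i\<in>{a..b}. (#) i ` {I. length I = n \<and> sorted_wrt (<) I \<and> set I \<subseteq> {Suc i..b}})" (is "?L = ?R")
proof (rule Set.set_eqI)
  fix I
  show "I \<in> ?L \<longleftrightarrow> I \<in> ?R"
  proof (cases I)
    case (Cons i J)
    have "(\<forall>x\<in>set J. i < x) \<and> i \<in> {a..b} \<and> set J \<subseteq> {a..b} \<longleftrightarrow> i \<in> {a..b} \<and> set J \<subseteq> {Suc i..b}"
      by (fastforce simp: subset_iff)
    then show ?thesis by (auto simp: Cons)
  qed auto
qed

lemma multi_indices_eq:
  "multi_indices 0 = {[]}"
  "multi_indices 1 = {[1],[2],[3],[4],[5]}"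
  "multi_indices 2 = {[1,2],[1,3],[1,4],[1,5],[2,3],[2,4],[2,5],[3,4],[3,5],[4,5]}"
  "multi_indices 3 = {[1,2,3],[1,2,4],[1,2,5],[1,3,4],[1,3,5],[1,4,5],[2,3,4],[2,3,5],[2,4,5],[3,4,5]}"
  "multi_indices 4 = {[1,2,3,4],[1,2,3,5],[1,2,4,5],[1,3,4,5],[2,3,4,5]}"
  "multi_indices 5 = {[1,2,3,4,5]}"
proof -
  define M where "M n a = {I. length I = n \<and> sorted_wrt (<) I \<and> set I \<subseteq> {a..5::nat}}" for n a
  have eq: "multi_indices n = M n 1" for n by (simp add: multi_indices_def M_def)
  have 0: "M 0 a = {[]}" for a by (auto simp: M_def)
  have Suc: "M (Suc n) a = (\<Union>i\<in>{a..5}. (#) i ` M n (Suc i))" for n a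
    unfolding M_def by (rule multi_indices_Suc)
  have upto: "{1..5::nat} = {1,2,3,4,5}" "{2..5::nat} = {2,3,4,5}" "{3..5::nat} = {3,4,5}"
    "{4..5::nat} = {4,5}" "{5..5::nat} = {5}" "{6..5::nat} = {}" by auto
  have S: "M (Suc n) 1 = (#) 1 ` M n 2 \<union> (#) 2 ` M n 3 \<union> (#) 3 ` M n 4 \<union> (#) 4 ` M n 5 \<union> (#) 5 ` M n 6"
    "M (Suc n) 2 = (#) 2 ` M n 3 \<union> (#) 3 ` M n 4 \<union> (#) 4 ` M n 5 \<union> (#) 5 ` M n 6"
    "M (Suc n) 3 = (#) 3 ` M n 4 \<union> (#) 4 ` M n 5 \<union> (#) 5 ` M n 6"
    "M (Suc n) 4 = (#) 4 ` M n 5 \<union> (#) 5 ` M n 6"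
    "M (Suc n) 5 = (#) 5 ` M n 6"
    "M (Suc n) 6 = {}" for n
    unfolding Suc upto by (simp_all add: numeral_2_eq_2[symmetric] Un_assoc del: One_nat_def)
  have n: "M 1 a = M (Suc 0) a" "M 2 a = M (Suc (Suc 0)) a" "M 3 a = M (Suc (Suc (Suc 0))) a"
    "M 4 a = M (Suc (Suc (Suc (Suc 0)))) a" "M 5 a = M (Suc (Suc (Suc (Suc (Suc 0))))) a" for a
    by (simp_all add: eval_nat_numeral)
  note e = eq n 0 S image_Un image_insert image_empty Un_insert_left Un_empty_left Un_empty_right
  show "multi_indices 0 = {[]}" by (simp only: e)
  show "multi_indices 1 = {[1],[2],[3],[4],[5]}"
    by (simp only: e)
  show "multi_indices 2 = {[1,2],[1,3],[1,4],[1,5],[2,3],[2,4],[2,5],[3,4],[3,5],[4,5]}"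
    by (simp only: e)
  show "multi_indices 3 = {[1,2,3],[1,2,4],[1,2,5],[1,3,4],[1,3,5],[1,4,5],[2,3,4],[2,3,5],[2,4,5],[3,4,5]}"
    by (simp only: e)
  show "multi_indices 4 = {[1,2,3,4],[1,2,3,5],[1,2,4,5],[1,3,4,5],[2,3,4,5]}"
    by (simp only: e)
  show "multi_indices 5 = {[1,2,3,4,5]}"
    by (simp only: e)
qed

section \<open>Multilinearity and values on basis vectors\<close>

lemma formsD:
  assumes "\<omega> \<in> forms q"
  shows "length vs \<noteq> q \<Longrightarrow> \<omega> vs = 0"
    and "length vs = q \<Longrightarrow> i < q \<Longrightarrow> linear (\<lambda>v. \<omega> (vs[i := v]))"
    and "length vs = q \<Longrightarrow> i < j \<Longrightarrow> j < q \<Longrightarrow> vs ! i = vs ! j \<Longrightarrow> \<omega> vs = 0"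
  using assms unfolding forms_def by auto

lemma forms_lincomb:
  assumes "\<omega> \<in> forms q" "\<eta> \<in> forms q"
  shows "(\<lambda>vs. c * \<omega> vs + d * \<eta> vs) \<in> forms q"
proof -
  have "linear (\<lambda>v. c * \<omega> (vs[i := v]) + d * \<eta> (vs[i := v]))" if "length vs = q" "i < q" for vs i
  proof -
    note l = formsD(2)[OF assms(1) that] formsD(2)[OF assms(2) that]
    show ?thesis
      by (rule linearI) (simp_all add: l[THEN linear_add] l[THEN linear_scale] algebra_simps)
  qed
  then show ?thesis using formsD(1,3)[OF assms(1)] formsD(1,3)[OF assms(2)]
    unfolding forms_def by simp
qed

lemma forms_zero: "(\<lambda>_. 0) \<in> forms q"
  unfolding forms_def by (auto intro!: linearI)

lemma forms_diff: "\<omega> \<in> forms q \<Longrightarrow> \<eta> \<in> forms q \<Longrightarrow> (\<lambda>vs. \<omega> vs - \<eta> vs) \<in> forms q"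
  using forms_lincomb[of \<omega> q \<eta> 1 "-1"] by simp

lemma forms_add: "\<omega> \<in> forms q \<Longrightarrow> \<eta> \<in> forms q \<Longrightarrow> (\<lambda>vs. \<omega> vs + \<eta> vs) \<in> forms q"
  using forms_lincomb[of \<omega> q \<eta> 1 1] by simp

lemma linear_chi: "i \<in> {1..5} \<Longrightarrow> linear (chi i)"
proof -
  assume "i \<in> {1..5}"
  then have "i \<in> {1,2,3,4,5}" by auto
  then show ?thesis by (auto intro!: linearI simp: chi_def split: prod.splits)
qed

lemma wedge_forms:
  assumes js: "set js \<subseteq> {1..5}"
  shows "wedge js \<in> forms (length js)"
proof -
  let ?n = "length js"
  let ?A = "\<lambda>vs. mat ?n ?n (\<lambda>(a, b). chi (js ! a) (vs ! b))"
  have lin: "linear (\<lambda>v. wedge js (vs[i := v]))" if vs: "length vs = ?n" and i: "i < ?n" for vs i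
  proof -
    have "wedge js (vs[i := v]) = of_real (\<Sum>a<?n. chi (js ! a) v * cofactor (?A vs) a i)" for v
    proof -
      have "mat_delete (?A (vs[i := v])) a i = mat_delete (?A vs) a i" for a
        using i vs by (intro eq_matI) (auto simp: mat_delete_def nth_list_update)
      then have "cofactor (?A (vs[i := v])) a i = cofactor (?A vs) a i" for a
        by (simp add: cofactor_def)
      moreover have "det (?A (vs[i := v])) =
          (\<Sum>a<?n. ?A (vs[i := v]) $$ (a, i) * cofactor (?A (vs[i := v])) a i)"
        using i by (intro laplace_expansion_column) auto
      ultimately show ?thesis using i vs by (simp add: wedge_def)
    qed
    moreover have "linear (chi (js ! a))" if "a < ?n" for a
      using js that by (intro linear_chi) (meson nth_mem subsetD)
    ultimately show ?thesis
      by (intro linearI) (simp_all add: linear_add linear_scale sum.distrib scaleR_conv_of_real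
          sum_distrib_left algebra_simps)
  qed
  have alt: "wedge js vs = 0" if "length vs = ?n" "i < j" "j < ?n" "vs ! i = vs ! j" for vs i j
  proof -
    have "det (?A vs) = 0"
      by (rule det_identical_columns[of _ ?n i j]) (use that in \<open>auto intro!: eq_vecI\<close>)
    then show ?thesis using that by (simp add: wedge_def)
  qed
  show ?thesis unfolding forms_def using lin alt by (auto simp: wedge_def)
qed

lemma upto_5: "{1..5::nat} = {1,2,3,4,5}"
  by auto

lemma bas_expansion: "v = (\<Sum>i\<in>{1..5}. chi i v *\<^sub>R bas i)"
proof -
  obtain x z w where v: "v = (x, z, w)" by (cases v)
  show ?thesis unfolding upto_5
    by (simp add: v chi_def bas_def deg1_def deg2_def deg3_def)
      (simp add: Finite_Cartesian_Product.vec_eq_iff axis_def forall_2)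
qed

text \<open>Polarisation: a form with v + w in both positions vanishes, and so do its two diagonal
  terms.\<close>

lemma forms_swap:
  assumes \<omega>: "\<omega> \<in> forms q" and vs: "length vs = q" and ij: "i < j" "j < q"
  shows "\<omega> (vs[i := vs ! j, j := vs ! i]) = - \<omega> vs"
proof -
  let ?f = "\<lambda>v w. \<omega> (vs[i := v, j := w])"
  have z: "?f v v = 0" for v using ij vs by (intro formsD(3)[OF \<omega>, of _ i j]) auto
  have 2: "?f v (w + w') = ?f v w + ?f v w'" for v w w'
    using linear_add[OF formsD(2)[OF \<omega>, of "vs[i := v]" j]] vs ij by simp
  have 1: "?f (v + v') w = ?f v w + ?f v' w" for v v' w
    using linear_add[OF formsD(2)[OF \<omega>, of "vs[j := w]" i]] vs ij
    by (simp add: list_update_swap[of i j])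
  have "?f (vs ! i + vs ! j) (vs ! i + vs ! j) = ?f (vs ! i) (vs ! j) + ?f (vs ! j) (vs ! i)"
    by (simp only: 1 2) (simp only: z add_0_left add_0_right add.commute)
  from trans[OF this[symmetric] z] show ?thesis
    by (metis eq_neg_iff_add_eq_0 add.commute list_update_id)
qed

text \<open>Sorting by transpositions: swapping an inversion of \<open>K\<close> increases \<open>\<Sum>i. i * K ! i\<close>.\<close>

lemma forms_eq_zero_basis:
  assumes \<omega>: "\<omega> \<in> forms q" and I: "\<And>I. I \<in> multi_indices q \<Longrightarrow> \<omega> (map bas I) = 0"
    and K: "length K = q" "set K \<subseteq> {1..5}"
  shows "\<omega> (map bas K) = 0"
  using K
proof (induction "5 * q * q - (\<Sum>i<q. i * K ! i)" arbitrary: K rule: less_induct)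
  case (less K)
  show ?case
  proof (cases "sorted_wrt (<) K")
    case True
    then show ?thesis using less I by (simp add: multi_indices_def)
  next
    case False
    then obtain i j where ij: "i < j" "j < q" "K ! j \<le> K ! i"
      using less by (auto simp: sorted_wrt_iff_nth_less not_less)
    show ?thesis
    proof (cases "K ! i = K ! j")
      case True
      then show ?thesis using ij less by (intro formsD(3)[OF \<omega>, of _ i j]) auto
    next
      case False
      define L where "L = K[i := K ! j, j := K ! i]"
      have L: "length L = q" "set L \<subseteq> {1..5}"
        using less ij by (auto simp: L_def set_swap)
      have b: "(\<Sum>i<q. i * L ! i) \<le> 5 * q * q"
      proof -
        have "L ! i \<le> 5" if "i < q" for i using L that by (meson atLeastAtMost_iff nth_mem subsetD)
        then have "(\<Sum>i<q. i * L ! i) \<le> (\<Sum>i<q. q * 5)" by (intro sum_mono mult_mono) auto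
        then show ?thesis by (simp add: algebra_simps)
      qed
      have s: "(\<Sum>a<q. f a) = (\<Sum>a\<in>{..<q} - {i, j}. f a) + f i + f j" for f :: "nat \<Rightarrow> nat"
      proof -
        have "(\<Sum>a<q. f a) = (\<Sum>a\<in>{..<q} - {i, j}. f a) + (\<Sum>a\<in>{i, j}. f a)"
          using ij by (intro sum.subset_diff) auto
        then show ?thesis using ij by simp
      qed
      have "(\<Sum>a\<in>{..<q} - {i, j}. a * L ! a) = (\<Sum>a\<in>{..<q} - {i, j}. a * K ! a)"
        by (intro sum.cong) (auto simp: L_def)
      moreover have "i * K ! i + j * K ! j < i * K ! j + j * K ! i"
      proof -
        obtain d where "j = i + Suc d" using ij(1) less_iff_Suc_add by auto
        moreover obtain e where "K ! i = K ! j + Suc e"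
          using ij(3) False by (metis le_neq_implies_less less_iff_Suc_add add_Suc_right)
        ultimately show ?thesis by (simp add: algebra_simps)
      qed
      ultimately have lt: "(\<Sum>i<q. i * K ! i) < (\<Sum>i<q. i * L ! i)"
        using ij less by (simp add: s L_def)
      have "\<omega> (map bas L) = 0"
        using lt b L by (intro less(1)) auto
      moreover have "map bas L = (map bas K)[i := map bas K ! j, j := map bas K ! i]"
        using ij less by (simp add: L_def map_update)
      ultimately show ?thesis
        using forms_swap[OF \<omega>, of "map bas K" i j] ij less by simp
    qed
  qed
qed

text \<open>Arguments are replaced by basis vectors one position at a time; in the induction, m
  counts the leading positions that may still be arbitrary.\<close>

lemma forms_eq_zeroI:
  assumes \<omega>: "\<omega> \<in> forms q" and I: "\<And>I. I \<in> multi_indices q \<Longrightarrow> \<omega> (map bas I) = 0"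
  shows "\<omega> = (\<lambda>_. 0)"
proof -
  have "\<omega> vs = 0" if "m \<le> q" "length vs = q" "\<And>i. m \<le> i \<Longrightarrow> i < q \<Longrightarrow> vs ! i \<in> bas ` {1..5}" for m vs
    using that
  proof (induction m arbitrary: vs)
    case 0
    have "set vs \<subseteq> bas ` {1..5}"
    proof
      fix v assume "v \<in> set vs"
      then obtain i where "i < length vs" "v = vs ! i" by (metis in_set_conv_nth)
      then show "v \<in> bas ` {1..5}" using 0(3)[of i] 0(2) by simp
    qed
    then have "vs \<in> map bas ` lists {1..5}" by (metis in_lists_conv_set lists_image subset_code(1))
    then obtain K where K: "vs = map bas K" "K \<in> lists {1..5}" by blast
    show ?case unfolding K(1)
      by (rule forms_eq_zero_basis[OF \<omega> I]) (use 0(2) K in \<open>auto simp: in_lists_conv_set\<close>)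
  next
    case (Suc m)
    have lin: "linear (\<lambda>v. \<omega> (vs[m := v]))" using Suc by (intro formsD(2)[OF \<omega>]) auto
    have "\<omega> (vs[m := bas i]) = 0" if "i \<in> {1..5}" for i
      using Suc.prems that by (intro Suc.IH) (auto simp: nth_list_update)
    then have "(\<Sum>i\<in>{1..5}. chi i (vs ! m) *\<^sub>R \<omega> (vs[m := bas i])) = 0" by simp
    also have "(\<Sum>i\<in>{1..5}. chi i (vs ! m) *\<^sub>R \<omega> (vs[m := bas i])) =
        \<omega> (vs[m := (\<Sum>i\<in>{1..5}. chi i (vs ! m) *\<^sub>R bas i)])"
      by (simp add: linear_sum[OF lin] linear_scale[OF lin])
    finally show ?case by (simp only: bas_expansion[symmetric] list_update_id)
  qed
  from this[of q] formsD(1)[OF \<omega>] show ?thesis by force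
qed

section \<open>The Chevalley--Eilenberg differential on basis forms\<close>

lemma wedge_Nil: "wedge [] vs = (if vs = [] then 1 else 0)"
  by (simp add: wedge_def det_mat_0)

lemma wedge_Cons_Nil: "wedge (j # js) [] = 0"
  by (simp add: wedge_def)

text \<open>Expansion along the first column, that is, contraction with the first argument.
  Iterated, it evaluates wedges without determinants.\<close>

lemma wedge_expand:
  "wedge js (u # vs) =
     (\<Sum>a<length js. (-1) ^ a * of_real (chi (js ! a) u) * wedge (take a js @ drop (Suc a) js) vs)"
proof (cases "length js = Suc (length vs)")
  case True
  let ?n = "length vs"
  have m: "mat ?n ?n (\<lambda>(c, b). chi (js ! (if c < a then c else Suc c)) (vs ! b)) =
      mat ?n ?n (\<lambda>(c, b). chi ((take a js @ drop (Suc a) js) ! c) (vs ! b))" if "a < Suc ?n" for a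
    using that True by (intro eq_matI) (auto simp: nth_append)
  have "wedge js (u # vs) = of_real (\<Sum>a<Suc ?n. chi (js ! a) u * ((-1) ^ a *
      det (mat ?n ?n (\<lambda>(c, b). chi (js ! (if c < a then c else Suc c)) (vs ! b)))))"
    using True unfolding wedge_def by (simp add: det_mat_Suc del: sum.lessThan_Suc)
  also have "\<dots> = (\<Sum>a<Suc ?n. (-1) ^ a * of_real (chi (js ! a) u) * wedge (take a js @ drop (Suc a) js) vs)"
    unfolding of_real_sum using True
    by (intro sum.cong) (simp_all add: m wedge_def min_def)
  finally show ?thesis using True by simp
next
  case False
  have "wedge (take a js @ drop (Suc a) js) vs = 0" if "a < length js" for a
    using False that by (auto simp: wedge_def min_def)
  moreover have "wedge js (u # vs) = 0" using False by (simp add: wedge_def)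
  ultimately show ?thesis by simp
qed

lemma wedge_1: "wedge [i] (u # vs) = of_real (chi i u) * wedge [] vs"
  and wedge_2: "wedge [i, j] (u # vs) =
    of_real (chi i u) * wedge [j] vs - of_real (chi j u) * wedge [i] vs"
  and wedge_3: "wedge [i, j, l] (u # vs) =
    of_real (chi i u) * wedge [j, l] vs - of_real (chi j u) * wedge [i, l] vs + of_real (chi l u) * wedge [i, j] vs"
  and wedge_4: "wedge [i, j, l, m] (u # vs) =
    of_real (chi i u) * wedge [j, l, m] vs - of_real (chi j u) * wedge [i, l, m] vs
    + of_real (chi l u) * wedge [i, j, m] vs - of_real (chi m u) * wedge [i, j, l] vs"
  and wedge_5: "wedge [i, j, l, m, n] (u # vs) =
    of_real (chi i u) * wedge [j, l, m, n] vs - of_real (chi j u) * wedge [i, l, m, n] vs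
    + of_real (chi l u) * wedge [i, j, m, n] vs - of_real (chi m u) * wedge [i, j, l, n] vs
    + of_real (chi n u) * wedge [i, j, l, m] vs"
  by (simp_all add: wedge_expand)

lemmas wedge_simps = wedge_1 wedge_2 wedge_3 wedge_4 wedge_5 wedge_Nil wedge_Cons_Nil

lemma chi_bas: "i \<in> {1..5} \<Longrightarrow> j \<in> {1..5} \<Longrightarrow> chi i (bas j) = (if i = j then 1 else 0)"
  unfolding upto_5
  by (auto simp: chi_def bas_def deg1_def deg2_def deg3_def axis_def)

lemma chi_bracket:
  "chi 1 (bracket u v) = 0"
  "chi 2 (bracket u v) = 0"
  "chi 3 (bracket u v) = chi 1 u * chi 2 v - chi 2 u * chi 1 v"
  "chi 4 (bracket u v) = chi 1 u * chi 3 v - chi 3 u * chi 1 v"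
  "chi 5 (bracket u v) = chi 2 u * chi 3 v - chi 3 u * chi 2 v"
  by (cases u; cases v; simp add: chi_def)+

lemma bracket_bas:
  "bracket (bas 1) (bas 2) = bas 3" "bracket (bas 1) (bas 3) = bas 4" "bracket (bas 2) (bas 3) = bas 5"
  "bracket (bas 1) (bas 4) = 0" "bracket (bas 1) (bas 5) = 0" "bracket (bas 2) (bas 4) = 0"
  "bracket (bas 2) (bas 5) = 0" "bracket (bas 3) (bas 4) = 0" "bracket (bas 3) (bas 5) = 0"
  "bracket (bas 4) (bas 5) = 0"
  by (simp_all add: bas_def deg1_def deg2_def deg3_def zero_prod_def axis_def)

text \<open>Counting arguments from 0 instead of 1 does not change the parity of i + j, so a single
  pair of arguments carries the sign -1.\<close>

lemma ce_diff_1: "ce_diff \<omega> [a] = 0"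
  and ce_diff_2: "ce_diff \<omega> [a, b] = - \<omega> [bracket a b]"
  and ce_diff_3: "ce_diff \<omega> [a, b, c] =
    - \<omega> [bracket a b, c] + \<omega> [bracket a c, b] - \<omega> [bracket b c, a]"
  and ce_diff_4: "ce_diff \<omega> [a, b, c, d] =
    - \<omega> [bracket a b, c, d] + \<omega> [bracket a c, b, d] - \<omega> [bracket b c, a, d]
    - \<omega> [bracket a d, b, c] + \<omega> [bracket b d, a, c] - \<omega> [bracket c d, a, b]"
  and ce_diff_5: "ce_diff \<omega> [a, b, c, d, e] =
    - \<omega> [bracket a b, c, d, e] + \<omega> [bracket a c, b, d, e] - \<omega> [bracket b c, a, d, e]
    - \<omega> [bracket a d, b, c, e] + \<omega> [bracket b d, a, c, e] - \<omega> [bracket c d, a, b, e]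
    + \<omega> [bracket a e, b, c, d] - \<omega> [bracket b e, a, c, d] + \<omega> [bracket c e, a, b, d]
    - \<omega> [bracket d e, a, b, c]"
  and ce_diff_6: "ce_diff \<omega> [a, b, c, d, e, f] =
    - \<omega> [bracket a b, c, d, e, f] + \<omega> [bracket a c, b, d, e, f] - \<omega> [bracket b c, a, d, e, f]
    - \<omega> [bracket a d, b, c, e, f] + \<omega> [bracket b d, a, c, e, f] - \<omega> [bracket c d, a, b, e, f]
    + \<omega> [bracket a e, b, c, d, f] - \<omega> [bracket b e, a, c, d, f] + \<omega> [bracket c e, a, b, d, f]
    - \<omega> [bracket d e, a, b, c, f]
    - \<omega> [bracket a f, b, c, d, e] + \<omega> [bracket b f, a, c, d, e] - \<omega> [bracket c f, a, b, d, e]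
    + \<omega> [bracket d f, a, b, c, e] - \<omega> [bracket e f, a, b, c, d]"
  by (simp_all add: ce_diff_def nths_Cons lessThan_Suc)

lemmas ce_diff_simps = ce_diff_1 ce_diff_2 ce_diff_3 ce_diff_4 ce_diff_5 ce_diff_6

lemma ce_diff_lincomb:
  "ce_diff (\<lambda>vs. c * \<omega> vs + d * \<eta> vs) = (\<lambda>vs. c * ce_diff \<omega> vs + d * ce_diff \<eta> vs)"
  by (rule ext) (simp add: ce_diff_def sum_distrib_left sum.distrib algebra_simps)

lemma ce_diff_zero: "ce_diff (\<lambda>_. 0) = (\<lambda>_. 0)"
  by (rule ext) (simp add: ce_diff_def)

lemma ce_diff_wrong_length:
  assumes "\<omega> \<in> forms q" "length vs \<noteq> Suc q"
  shows "ce_diff \<omega> vs = 0"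
proof -
  have "length (nths vs (- {i, j})) = length vs - 2" if "i < j" "j < length vs" for i j
  proof -
    have "{k. k < length vs \<and> k \<in> - {i, j}} = {..<length vs} - {i, j}" by auto
    then show ?thesis using that by (simp add: length_nths card_Diff_subset)
  qed
  then have "\<omega> (bracket (vs ! i) (vs ! j) # nths vs (- {i, j})) = 0" if "i < j" "j < length vs" for i j
    using assms that by (intro formsD(1)[OF assms(1)]) auto
  then show ?thesis unfolding ce_diff_def by (intro sum.neutral ballI) simp
qed

lemma ce_closedI:
  assumes "\<omega> \<in> forms q" "\<And>vs. length vs = Suc q \<Longrightarrow> ce_diff \<omega> vs = 0"
  shows "\<omega> \<in> ce_closed q"
  unfolding ce_closed_def using assms ce_diff_wrong_length[OF assms(1)] by blast

lemma ce_closed_lincomb: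
  assumes "\<omega> \<in> ce_closed q" "\<eta> \<in> ce_closed q"
  shows "(\<lambda>vs. c * \<omega> vs + d * \<eta> vs) \<in> ce_closed q"
  using assms by (auto simp: ce_closed_def ce_diff_lincomb forms_lincomb)

lemma wedge_forms': "length js = q \<Longrightarrow> set js \<subseteq> {1..5} \<Longrightarrow> wedge js \<in> forms q"
  using wedge_forms by auto

lemma length_eq_conv:
  "length vs = Suc 0 \<longleftrightarrow> (\<exists>a. vs = [a])"
  "length vs = Suc 1 \<longleftrightarrow> (\<exists>a b. vs = [a, b])"
  "length vs = Suc 2 \<longleftrightarrow> (\<exists>a b c. vs = [a, b, c])"
  "length vs = Suc 3 \<longleftrightarrow> (\<exists>a b c d. vs = [a, b, c, d])"
  "length vs = Suc 4 \<longleftrightarrow> (\<exists>a b c d e. vs = [a, b, c, d, e])"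
  "length vs = Suc 5 \<longleftrightarrow> (\<exists>a b c d e f. vs = [a, b, c, d, e, f])"
  by (auto simp: length_Suc_conv eval_nat_numeral)

text \<open>Among the 2-forms only \<chi>^45 has weight 6, the weight of the classes in degree 3, so
  its differential is the only exact form that can meet them.\<close>

lemma ce_diff_wedge_45:
  "ce_diff (wedge [4, 5]) vs = wedge [2, 3, 4] vs - wedge [1, 3, 5] vs"
proof (cases "length vs = Suc 2")
  case True
  then obtain a b c where "vs = [a, b, c]" unfolding length_eq_conv by blast
  then show ?thesis
    by (simp add: ce_diff_simps wedge_simps chi_bracket algebra_simps del: One_nat_def)
next
  case False
  then show ?thesis using ce_diff_wrong_length[of "wedge [4, 5]" 2 vs]
    by (simp add: wedge_forms' wedge_def)
qed

lemma wedge_closed_0: "wedge [] \<in> ce_closed 0"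
proof (rule ce_closedI)
  fix vs :: "g5 list" assume "length vs = Suc 0"
  then obtain a where "vs = [a]" unfolding length_eq_conv by blast
  then show "ce_diff (wedge []) vs = 0" by (simp add: ce_diff_simps)
qed (simp add: wedge_forms')

lemma wedge_closed_1: "wedge [1] \<in> ce_closed 1" "wedge [2] \<in> ce_closed 1"
proof -
  have "ce_diff (wedge [i]) vs = 0" if len: "length vs = Suc 1" and ij: "i \<in> {1, 2}" for vs i
  proof -
    obtain a b where "vs = [a, b]" using len unfolding length_eq_conv by blast
    then show ?thesis using ij by (auto simp add: ce_diff_simps wedge_simps chi_bracket simp del: One_nat_def)
  qed
  then show "wedge [1] \<in> ce_closed 1" "wedge [2] \<in> ce_closed 1"
    by (auto intro!: ce_closedI wedge_forms')
qed

lemma wedge_closed_2: "wedge [1, 4] \<in> ce_closed 2" "wedge [2, 5] \<in> ce_closed 2"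
  "(\<lambda>vs. wedge [1, 5] vs + wedge [2, 4] vs) \<in> ce_closed 2"
proof -
  have "ce_diff (wedge [1, 4]) vs = 0 \<and> ce_diff (wedge [2, 5]) vs = 0 \<and>
      ce_diff (\<lambda>vs. wedge [1, 5] vs + wedge [2, 4] vs) vs = 0" if len: "length vs = Suc 2" for vs
  proof -
    obtain a b c where "vs = [a, b, c]" using len unfolding length_eq_conv by blast
    then show ?thesis
      by (simp add: ce_diff_simps wedge_simps chi_bracket del: One_nat_def) (simp add: algebra_simps)
  qed
  then show "wedge [1, 4] \<in> ce_closed 2" "wedge [2, 5] \<in> ce_closed 2"
    "(\<lambda>vs. wedge [1, 5] vs + wedge [2, 4] vs) \<in> ce_closed 2"
    by (auto intro!: ce_closedI wedge_forms' forms_add)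
qed

text \<open>Each of the four forms of this type is closed; modulo one exact combination they yield
  the three classes of degree 3.\<close>

lemma wedge_closed_3: "wedge [1, 3, 4] \<in> ce_closed 3" "wedge [1, 3, 5] \<in> ce_closed 3"
  "wedge [2, 3, 4] \<in> ce_closed 3" "wedge [2, 3, 5] \<in> ce_closed 3"
proof -
  have "ce_diff (wedge [i, 3, j]) vs = 0" if len: "length vs = Suc 3" and ij: "i \<in> {1, 2}" "j \<in> {4, 5}" for vs i j
  proof -
    obtain a b c d where "vs = [a, b, c, d]" using len unfolding length_eq_conv by blast
    then show ?thesis using ij
      by (elim insertE; simp add: ce_diff_simps wedge_simps chi_bracket del: One_nat_def)
        (simp_all add: algebra_simps)
  qed
  then show "wedge [1, 3, 4] \<in> ce_closed 3" "wedge [1, 3, 5] \<in> ce_closed 3"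
    "wedge [2, 3, 4] \<in> ce_closed 3" "wedge [2, 3, 5] \<in> ce_closed 3"
    by (auto intro!: ce_closedI wedge_forms')
qed

lemma wedge_closed_4: "wedge [1, 3, 4, 5] \<in> ce_closed 4" "wedge [2, 3, 4, 5] \<in> ce_closed 4"
proof -
  have "ce_diff (wedge [i, 3, 4, 5]) vs = 0" if len: "length vs = Suc 4" and ij: "i \<in> {1, 2}" for vs i
  proof -
    obtain a b c d e where "vs = [a, b, c, d, e]" using len unfolding length_eq_conv by blast
    then show ?thesis using ij
      by (elim insertE; simp add: ce_diff_simps wedge_simps chi_bracket del: One_nat_def)
        (simp_all add: algebra_simps)
  qed
  then show "wedge [1, 3, 4, 5] \<in> ce_closed 4" "wedge [2, 3, 4, 5] \<in> ce_closed 4"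
    by (auto intro!: ce_closedI wedge_forms')
qed

text \<open>Expansion along the first row peels off a covector instead of an argument. This is what
  exposes the repeated covectors in the differential of the volume form.\<close>

lemma wedge_expand_row:
  "wedge (j # js) vs =
     (\<Sum>b<length vs. (-1) ^ b * of_real (chi j (vs ! b)) * wedge js (take b vs @ drop (Suc b) vs))"
proof (cases "length vs = Suc (length js)")
  case True
  let ?n = "length js"
  let ?A = "mat (Suc ?n) (Suc ?n) (\<lambda>(a, b). chi ((j # js) ! a) (vs ! b))"
  have "mat_delete ?A 0 b = mat ?n ?n (\<lambda>(a, c). chi (js ! a) ((take b vs @ drop (Suc b) vs) ! c))"
    if "b < Suc ?n" for b
    using that True by (intro eq_matI) (auto simp: mat_delete_def nth_append)
  then have c: "of_real (cofactor ?A 0 b) = (-1) ^ b * wedge js (take b vs @ drop (Suc b) vs)"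
    if "b < Suc ?n" for b
    using that True by (simp add: cofactor_def wedge_def min_def)
  have "det ?A = (\<Sum>b<Suc ?n. ?A $$ (0, b) * cofactor ?A 0 b)"
    by (rule laplace_expansion_row) auto
  then have "wedge (j # js) vs = (\<Sum>b<Suc ?n. of_real (?A $$ (0, b) * cofactor ?A 0 b))"
    using True by (simp add: wedge_def del: sum.lessThan_Suc)
  also have "\<dots> = (\<Sum>b<Suc ?n. (-1) ^ b * of_real (chi j (vs ! b)) * wedge js (take b vs @ drop (Suc b) vs))"
    by (intro sum.cong) (simp_all add: c)
  finally show ?thesis using True by simp
next
  case False
  have "wedge js (take b vs @ drop (Suc b) vs) = 0" if "b < length vs" for b
    using False that by (auto simp: wedge_def min_def)
  moreover have "wedge (j # js) vs = 0" using False by (simp add: wedge_def)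
  ultimately show ?thesis by simp
qed

lemma wedge_not_distinct:
  assumes "\<not> distinct js"
  shows "wedge js vs = 0"
proof -
  obtain i j where "i < length js" "j < length js" "i \<noteq> j" "js ! i = js ! j"
    using assms by (auto simp: distinct_conv_nth)
  then have "det (mat (length js) (length js) (\<lambda>(a, b). chi (js ! a) (vs ! b))) = 0"
    by (intro det_identical_rows[of _ "length js" i j]) (auto intro!: eq_vecI)
  then show ?thesis by (simp add: wedge_def)
qed

lemma wedge_row_5:
  "wedge (j # js) [a, b, c, d, e] =
    of_real (chi j a) * wedge js [b, c, d, e] - of_real (chi j b) * wedge js [a, c, d, e]
    + of_real (chi j c) * wedge js [a, b, d, e] - of_real (chi j d) * wedge js [a, b, c, e]
    + of_real (chi j e) * wedge js [a, b, c, d]"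
  and wedge_row_6:
  "wedge (j # js) [a, b, c, d, e, f] =
    of_real (chi j a) * wedge js [b, c, d, e, f] - of_real (chi j b) * wedge js [a, c, d, e, f]
    + of_real (chi j c) * wedge js [a, b, d, e, f] - of_real (chi j d) * wedge js [a, b, c, e, f]
    + of_real (chi j e) * wedge js [a, b, c, d, f] - of_real (chi j f) * wedge js [a, b, c, d, e]"
  unfolding wedge_expand_row by simp_all

text \<open>On a bracket the volume form only sees \<open>\<chi>\<^sup>3, \<chi>\<^sup>4, \<chi>\<^sup>5\<close>, which are \<open>\<chi>\<^sup>1 \<and> \<chi>\<^sup>2\<close>,
  \<open>\<chi>\<^sup>1 \<and> \<chi>\<^sup>3\<close>, \<open>\<chi>\<^sup>2 \<and> \<chi>\<^sup>3\<close> there, so that every term of the differential repeats a factor.\<close>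

lemma wedge_closed_5: "wedge [1, 2, 3, 4, 5] \<in> ce_closed 5"
proof (rule ce_closedI)
  fix vs :: "g5 list" assume "length vs = Suc 5"
  then obtain a b c d e f where vs: "vs = [a, b, c, d, e, f]" unfolding length_eq_conv by blast
  let ?r = "\<lambda>i j js. wedge (i # j # js) [a, b, c, d, e, f]"
  have 1: "wedge [1, 2, 3, 4, 5] (bracket u v # ws) =
      (of_real (chi 1 u) * of_real (chi 2 v) - of_real (chi 2 u) * of_real (chi 1 v)) * wedge [1, 2, 4, 5] ws
      - (of_real (chi 1 u) * of_real (chi 3 v) - of_real (chi 3 u) * of_real (chi 1 v)) * wedge [1, 2, 3, 5] ws
      + (of_real (chi 2 u) * of_real (chi 3 v) - of_real (chi 3 u) * of_real (chi 2 v)) * wedge [1, 2, 3, 4] ws"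
    for u v ws
    by (simp only: wedge_5 chi_bracket) simp
  \<comment> \<open>Opaque names keep simp from expanding the 4-forms, so that the comparison with
    the row expansions is a plain ring identity in their values.\<close>
  obtain A B C where ABC: "A = wedge [1, 2, 4, 5]" "B = wedge [1, 2, 3, 5]" "C = wedge [1, 2, 3, 4]"
    by blast
  obtain x1 x2 x3 where x: "x1 = (\<lambda>u. complex_of_real (chi 1 u))" "x2 = (\<lambda>u. complex_of_real (chi 2 u))"
    "x3 = (\<lambda>u. complex_of_real (chi 3 u))" by blast
  have 1: "wedge [1, 2, 3, 4, 5] (bracket u v # ws) =
      (x1 u * x2 v - x2 u * x1 v) * A ws - (x1 u * x3 v - x3 u * x1 v) * B ws + (x2 u * x3 v - x3 u * x2 v) * C ws"
    for u v ws
    unfolding 1 ABC x ..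
  have r: "?r 1 2 [1, 2, 4, 5] = x1 a * wedge (2 # [1,2,4,5]) [b,c,d,e,f] - x1 b * wedge (2 # [1,2,4,5]) [a,c,d,e,f]
      + x1 c * wedge (2 # [1,2,4,5]) [a,b,d,e,f] - x1 d * wedge (2 # [1,2,4,5]) [a,b,c,e,f]
      + x1 e * wedge (2 # [1,2,4,5]) [a,b,c,d,f] - x1 f * wedge (2 # [1,2,4,5]) [a,b,c,d,e]"
    "?r 1 3 [1, 2, 3, 5] = x1 a * wedge (3 # [1,2,3,5]) [b,c,d,e,f] - x1 b * wedge (3 # [1,2,3,5]) [a,c,d,e,f]
      + x1 c * wedge (3 # [1,2,3,5]) [a,b,d,e,f] - x1 d * wedge (3 # [1,2,3,5]) [a,b,c,e,f]
      + x1 e * wedge (3 # [1,2,3,5]) [a,b,c,d,f] - x1 f * wedge (3 # [1,2,3,5]) [a,b,c,d,e]"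
    "?r 2 3 [1, 2, 3, 4] = x2 a * wedge (3 # [1,2,3,4]) [b,c,d,e,f] - x2 b * wedge (3 # [1,2,3,4]) [a,c,d,e,f]
      + x2 c * wedge (3 # [1,2,3,4]) [a,b,d,e,f] - x2 d * wedge (3 # [1,2,3,4]) [a,b,c,e,f]
      + x2 e * wedge (3 # [1,2,3,4]) [a,b,c,d,f] - x2 f * wedge (3 # [1,2,3,4]) [a,b,c,d,e]"
    unfolding x by (rule wedge_row_6)+
  have r': "wedge (2 # [1,2,4,5]) [a,b,c,d,e] = x2 a * A [b,c,d,e] - x2 b * A [a,c,d,e]
      + x2 c * A [a,b,d,e] - x2 d * A [a,b,c,e] + x2 e * A [a,b,c,d]"
    "wedge (3 # [1,2,3,5]) [a,b,c,d,e] = x3 a * B [b,c,d,e] - x3 b * B [a,c,d,e]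
      + x3 c * B [a,b,d,e] - x3 d * B [a,b,c,e] + x3 e * B [a,b,c,d]"
    "wedge (3 # [1,2,3,4]) [a,b,c,d,e] = x3 a * C [b,c,d,e] - x3 b * C [a,c,d,e]
      + x3 c * C [a,b,d,e] - x3 d * C [a,b,c,e] + x3 e * C [a,b,c,d]" for a b c d e
    unfolding x ABC by (rule wedge_row_5)+
  have "ce_diff (wedge [1, 2, 3, 4, 5]) vs = - ?r 1 2 [1, 2, 4, 5] + ?r 1 3 [1, 2, 3, 5] - ?r 2 3 [1, 2, 3, 4]"
    unfolding vs r r' ce_diff_6 1 by (simp add: algebra_simps)
  also have "\<dots> = 0"
    by (simp add: wedge_not_distinct del: One_nat_def)
  finally show "ce_diff (wedge [1, 2, 3, 4, 5]) vs = 0" .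
qed (simp add: wedge_forms')

section \<open>The inner product on forms\<close>

lemma det_mat_2: "det (mat 2 2 f) = f (0,0) * f (1,1) - f (1,0) * f (0,1)"
  for f :: "nat \<times> nat \<Rightarrow> 'a::comm_ring_1"
  by (simp add: det_carrier_2)

lemma det_mat_3: "det (mat 3 3 f) =
    f (0,0) * (f (1,1) * f (2,2) - f (2,1) * f (1,2))
    - f (1,0) * (f (0,1) * f (2,2) - f (2,1) * f (0,2))
    + f (2,0) * (f (0,1) * f (1,2) - f (1,1) * f (0,2))"
  for f :: "nat \<times> nat \<Rightarrow> 'a::comm_ring_1"
  by (simp add: det_carrier_3)

lemma det_mat_4: "det (mat 4 4 f) =
    f (0,0) * det (mat 3 3 (\<lambda>(a, b). f (if a < 0 then a else Suc a, Suc b)))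
    - f (1,0) * det (mat 3 3 (\<lambda>(a, b). f (if a < 1 then a else Suc a, Suc b)))
    + f (2,0) * det (mat 3 3 (\<lambda>(a, b). f (if a < 2 then a else Suc a, Suc b)))
    - f (3,0) * det (mat 3 3 (\<lambda>(a, b). f (if a < 3 then a else Suc a, Suc b)))"
  for f :: "nat \<times> nat \<Rightarrow> 'a::comm_ring_1"
  using det_mat_Suc[of 3 f] by (simp add: eval_nat_numeral)

lemma det_mat_5: "det (mat 5 5 f) =
    f (0,0) * det (mat 4 4 (\<lambda>(a, b). f (if a < 0 then a else Suc a, Suc b)))
    - f (1,0) * det (mat 4 4 (\<lambda>(a, b). f (if a < 1 then a else Suc a, Suc b)))
    + f (2,0) * det (mat 4 4 (\<lambda>(a, b). f (if a < 2 then a else Suc a, Suc b)))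
    - f (3,0) * det (mat 4 4 (\<lambda>(a, b). f (if a < 3 then a else Suc a, Suc b)))
    + f (4,0) * det (mat 4 4 (\<lambda>(a, b). f (if a < 4 then a else Suc a, Suc b)))"
  for f :: "nat \<times> nat \<Rightarrow> 'a::comm_ring_1"
  using det_mat_Suc[of 4 f] by (simp add: eval_nat_numeral)

text \<open>The Hermitian extension of the real symmetric matrix ((p, q), (q, r)).\<close>

definition sesq :: "real \<Rightarrow> real \<Rightarrow> real \<Rightarrow> complex \<times> complex \<Rightarrow> complex \<times> complex \<Rightarrow> complex" where
  "sesq p q r = (\<lambda>(a, b) (a', b'). of_real p * (a * cnj a') + of_real q * (a * cnj b' + b * cnj a') + of_real r * (b * cnj b'))"

type_synonym c4 = "complex \<times> complex \<times> complex \<times> complex"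

text \<open>The inner product on forms depends on g only through the Gram matrix of the basis
  covectors. Its blocks are ((p, q), (q, r)), k and ((s, t), (t, u)), with positivity stated by
  leading minors.\<close>

locale dual_metric =
  fixes g :: "g5 \<Rightarrow> g5 \<Rightarrow> real" and p q r s t u k :: real
  assumes pos: "0 < p" "0 < p * r - q\<^sup>2" "0 < s" "0 < s * u - t\<^sup>2" "0 < k"
    and dual: "dual_ip g (chi 1) (chi 1) = p" "dual_ip g (chi 1) (chi 2) = q"
      "dual_ip g (chi 2) (chi 1) = q" "dual_ip g (chi 2) (chi 2) = r"
      "dual_ip g (chi 3) (chi 3) = k"
      "dual_ip g (chi 4) (chi 4) = s" "dual_ip g (chi 4) (chi 5) = t"
      "dual_ip g (chi 5) (chi 4) = t" "dual_ip g (chi 5) (chi 5) = u"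
      "dual_ip g (chi 1) (chi 3) = 0" "dual_ip g (chi 2) (chi 3) = 0"
      "dual_ip g (chi 3) (chi 1) = 0" "dual_ip g (chi 3) (chi 2) = 0"
      "dual_ip g (chi 1) (chi 4) = 0" "dual_ip g (chi 2) (chi 4) = 0"
      "dual_ip g (chi 4) (chi 1) = 0" "dual_ip g (chi 4) (chi 2) = 0"
      "dual_ip g (chi 1) (chi 5) = 0" "dual_ip g (chi 2) (chi 5) = 0"
      "dual_ip g (chi 5) (chi 1) = 0" "dual_ip g (chi 5) (chi 2) = 0"
      "dual_ip g (chi 3) (chi 4) = 0" "dual_ip g (chi 3) (chi 5) = 0"
      "dual_ip g (chi 4) (chi 3) = 0" "dual_ip g (chi 5) (chi 3) = 0"
begin

abbreviation "P \<equiv> sesq p q r"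
abbreviation "Q \<equiv> sesq s t u"

text \<open>\<open>P \<otimes> Q\<close>; the four coordinates belong to \<open>\<chi>\<^sup>1\<^sup>4, \<chi>\<^sup>1\<^sup>5, \<chi>\<^sup>2\<^sup>4, \<chi>\<^sup>2\<^sup>5\<close>, or to the same forms with an additional \<open>\<chi>\<^sup>3\<close>.\<close>

definition tens :: "c4 \<Rightarrow> c4 \<Rightarrow> complex" where
  "tens = (\<lambda>(a, b, c, d) (a', b', c', d').
     of_real p * Q (a, b) (a', b') + of_real q * (Q (a, b) (c', d') + Q (c, d) (a', b'))
     + of_real r * Q (c, d) (c', d'))"

definition "dP = p * r - q\<^sup>2"
definition "dQ = s * u - t\<^sup>2"

text \<open>Needed where \<open>One_nat_def\<close> is kept out of the simp set so that rules about
  \<open>chi 1\<close> and \<open>bas 1\<close> still match.\<close>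

lemma nth_1: "(x # xs) ! 1 = xs ! 0"
  by simp

lemma form_ip_0: "form_ip g 0 \<omega> \<eta> = \<omega> [] * cnj (\<eta> [])"
  by (simp add: form_ip_def multi_indices_eq det_mat_0)

lemma form_ip_1: "form_ip g 1 \<omega> \<eta> = P (\<omega> [bas 1], \<omega> [bas 2]) (\<eta> [bas 1], \<eta> [bas 2])
    + of_real k * (\<omega> [bas 3] * cnj (\<eta> [bas 3]))
    + Q (\<omega> [bas 4], \<omega> [bas 5]) (\<eta> [bas 4], \<eta> [bas 5])"
proof -
  have d: "det (mat 1 1 f) = f (0, 0)" for f :: "nat \<times> nat \<Rightarrow> real" by (simp add: det_carrier_1)
  show ?thesis
    unfolding form_ip_def multi_indices_eq
    by (simp add: d dual sesq_def algebra_simps del: One_nat_def)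
qed

text \<open>Forms with different numbers of factors from the three degrees are orthogonal. Two
  covectors from the same plane contribute the determinant of that block.\<close>

lemma form_ip_2: "form_ip g 2 \<omega> \<eta> =
    of_real dP * (\<omega> [bas 1, bas 2] * cnj (\<eta> [bas 1, bas 2]))
    + of_real k * P (\<omega> [bas 1, bas 3], \<omega> [bas 2, bas 3]) (\<eta> [bas 1, bas 3], \<eta> [bas 2, bas 3])
    + tens (\<omega> [bas 1, bas 4], \<omega> [bas 1, bas 5], \<omega> [bas 2, bas 4], \<omega> [bas 2, bas 5])
        (\<eta> [bas 1, bas 4], \<eta> [bas 1, bas 5], \<eta> [bas 2, bas 4], \<eta> [bas 2, bas 5])
    + of_real k * Q (\<omega> [bas 3, bas 4], \<omega> [bas 3, bas 5]) (\<eta> [bas 3, bas 4], \<eta> [bas 3, bas 5])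
    + of_real dQ * (\<omega> [bas 4, bas 5] * cnj (\<eta> [bas 4, bas 5]))"
  unfolding form_ip_def multi_indices_eq
  by (simp add: det_mat_2 dual nth_1 del: One_nat_def)
    (simp add: sesq_def tens_def dP_def dQ_def power2_eq_square algebra_simps del: One_nat_def)

lemma form_ip_3: "form_ip g 3 \<omega> \<eta> =
    of_real (k * dP) * (\<omega> [bas 1, bas 2, bas 3] * cnj (\<eta> [bas 1, bas 2, bas 3]))
    + of_real dP * Q (\<omega> [bas 1, bas 2, bas 4], \<omega> [bas 1, bas 2, bas 5]) (\<eta> [bas 1, bas 2, bas 4], \<eta> [bas 1, bas 2, bas 5])
    + of_real k * tens (\<omega> [bas 1, bas 3, bas 4], \<omega> [bas 1, bas 3, bas 5], \<omega> [bas 2, bas 3, bas 4], \<omega> [bas 2, bas 3, bas 5])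
        (\<eta> [bas 1, bas 3, bas 4], \<eta> [bas 1, bas 3, bas 5], \<eta> [bas 2, bas 3, bas 4], \<eta> [bas 2, bas 3, bas 5])
    + of_real dQ * P (\<omega> [bas 1, bas 4, bas 5], \<omega> [bas 2, bas 4, bas 5]) (\<eta> [bas 1, bas 4, bas 5], \<eta> [bas 2, bas 4, bas 5])
    + of_real (k * dQ) * (\<omega> [bas 3, bas 4, bas 5] * cnj (\<eta> [bas 3, bas 4, bas 5]))"
  unfolding form_ip_def multi_indices_eq
  by (simp add: det_mat_3 dual nth_1 del: One_nat_def)
    (simp add: sesq_def tens_def dP_def dQ_def power2_eq_square algebra_simps del: One_nat_def)

lemma form_ip_4: "form_ip g 4 \<omega> \<eta> =
    of_real (k * dP) * Q (\<omega> [bas 1, bas 2, bas 3, bas 4], \<omega> [bas 1, bas 2, bas 3, bas 5])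
      (\<eta> [bas 1, bas 2, bas 3, bas 4], \<eta> [bas 1, bas 2, bas 3, bas 5])
    + of_real (dP * dQ) * (\<omega> [bas 1, bas 2, bas 4, bas 5] * cnj (\<eta> [bas 1, bas 2, bas 4, bas 5]))
    + of_real (k * dQ) * P (\<omega> [bas 1, bas 3, bas 4, bas 5], \<omega> [bas 2, bas 3, bas 4, bas 5])
      (\<eta> [bas 1, bas 3, bas 4, bas 5], \<eta> [bas 2, bas 3, bas 4, bas 5])"
  unfolding form_ip_def multi_indices_eq
  by (simp add: det_mat_4 det_mat_3 dual nth_1 del: One_nat_def)
    (simp add: sesq_def tens_def dP_def dQ_def power2_eq_square algebra_simps del: One_nat_def)

lemma form_ip_5: "form_ip g 5 \<omega> \<eta> =
    of_real (k * dP * dQ) * (\<omega> [bas 1, bas 2, bas 3, bas 4, bas 5] * cnj (\<eta> [bas 1, bas 2, bas 3, bas 4, bas 5]))"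
  unfolding form_ip_def multi_indices_eq
  by (simp add: det_mat_5 det_mat_4 det_mat_3 dual nth_1 del: One_nat_def)
    (simp add: sesq_def tens_def dP_def dQ_def power2_eq_square algebra_simps del: One_nat_def)

end

section \<open>Harmonic representatives\<close>

lemma nonneg_Reals_add_eq_0_iff:
  "x \<in> \<real>\<^sub>\<ge>\<^sub>0 \<Longrightarrow> y \<in> \<real>\<^sub>\<ge>\<^sub>0 \<Longrightarrow> x + y = 0 \<longleftrightarrow> x = 0 \<and> y = (0 :: complex)"
  by (auto simp: complex_nonneg_Reals_iff complex_eq_iff)

lemma mult_cnj_nonneg: "z * cnj z \<in> \<real>\<^sub>\<ge>\<^sub>0"
  by (simp add: complex_nonneg_Reals_iff)

lemma of_real_mult_nonneg: "0 < c \<Longrightarrow> z \<in> \<real>\<^sub>\<ge>\<^sub>0 \<Longrightarrow> complex_of_real c * z \<in> \<real>\<^sub>\<ge>\<^sub>0"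
  by (intro nonneg_Reals_mult_I) auto

text \<open>Completing the square in the first coordinate.\<close>

lemma sesq_positive:
  assumes "0 < p" "0 < p * r - q\<^sup>2"
  shows "sesq p q r z z \<in> \<real>\<^sub>\<ge>\<^sub>0" and "sesq p q r z z = 0 \<longleftrightarrow> z = (0, 0)"
proof -
  obtain a b where z: "z = (a, b)" by (cases z)
  let ?w = "of_real p * a + of_real q * b"
  have *: "sesq p q r z z = of_real (1 / p) * (?w * cnj ?w) + of_real ((p * r - q\<^sup>2) / p) * (b * cnj b)"
    using assms(1) by (simp add: z sesq_def field_simps power2_eq_square)
  have n: "of_real (1 / p) * (?w * cnj ?w) \<in> \<real>\<^sub>\<ge>\<^sub>0" "of_real ((p * r - q\<^sup>2) / p) * (b * cnj b) \<in> \<real>\<^sub>\<ge>\<^sub>0"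
    using assms by (intro of_real_mult_nonneg mult_cnj_nonneg; simp)+
  show "sesq p q r z z \<in> \<real>\<^sub>\<ge>\<^sub>0" unfolding * by (rule nonneg_Reals_add_I[OF n])
  have "complex_of_real ((p * r - q\<^sup>2) / p) \<noteq> 0" "complex_of_real (1 / p) \<noteq> 0"
    using assms by (simp_all del: of_real_divide)
  then show "sesq p q r z z = 0 \<longleftrightarrow> z = (0, 0)"
    unfolding * nonneg_Reals_add_eq_0_iff[OF n] using assms(1) by (auto simp: z simp del: of_real_divide)
qed

lemma forms_zero_arg:
  assumes "\<omega> \<in> forms q"
  shows "\<omega> (0 # vs) = 0"
proof (cases "length (0 # vs) = q")
  case True
  then have "linear (\<lambda>v. \<omega> ((0 # vs)[0 := v]))" by (intro formsD(2)[OF assms]) auto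
  from linear_0[OF this] show ?thesis by simp
qed (use formsD(1)[OF assms] in auto)

lemma forms_repeated:
  assumes "\<omega> \<in> forms q" "\<not> distinct vs"
  shows "\<omega> vs = 0"
proof (cases "length vs = q")
  case True
  obtain i j where "i < length vs" "j < length vs" "i < j" "vs ! i = vs ! j"
    using assms(2) by (metis distinct_conv_nth nat_neq_iff)
  then show ?thesis using True by (intro formsD(3)[OF assms(1), of _ i j]) auto
qed (use formsD(1)[OF assms(1)] in auto)

lemma form_ip_diff_right: "form_ip g q \<omega> (\<lambda>vs. \<eta> vs - \<theta> vs) = form_ip g q \<omega> \<eta> - form_ip g q \<omega> \<theta>"
  by (simp add: form_ip_def sum_subtractf algebra_simps)

lemma form_ip_zero_right: "form_ip g q \<omega> (\<lambda>_. 0) = 0"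
  by (simp add: form_ip_def)

lemma harmonicI:
  assumes "\<omega> \<in> ce_closed q"
    and "\<And>p \<theta>. q = Suc p \<Longrightarrow> \<theta> \<in> forms p \<Longrightarrow> form_ip g q (ce_diff \<theta>) \<omega> = 0"
  shows "\<omega> \<in> harmonic g q"
  using assms by (auto simp: harmonic_def ce_adjoint_rel_def forms_zero form_ip_zero_right)

text \<open>Two harmonic forms in one class differ by an exact form, which is orthogonal to both and
  hence to itself. In degree 0 a class is a single form, since only zero is exact.\<close>

lemma harmonic_rep_eqI:
  assumes \<omega>: "\<omega> \<in> coh_class q \<eta>" "\<omega> \<in> harmonic g q"
    and definite: "\<And>\<delta>. \<delta> \<in> forms q \<Longrightarrow> form_ip g q \<delta> \<delta> = 0 \<Longrightarrow> \<delta> = (\<lambda>_. 0)"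
  shows "harmonic_rep g q (coh_class q \<eta>) = \<omega>"
  unfolding harmonic_rep_def
proof (rule the_equality)
  fix \<xi> assume \<xi>: "\<xi> \<in> coh_class q \<eta> \<and> \<xi> \<in> harmonic g q"
  let ?\<delta> = "\<lambda>vs. \<xi> vs - \<omega> vs"
  have f: "?\<delta> \<in> forms q" using \<omega> \<xi> by (intro forms_diff) (auto simp: coh_class_def)
  have "?\<delta> = (\<lambda>_. 0)"
  proof (cases q)
    case 0
    then have "\<xi> vs - \<eta> vs = 0" "\<omega> vs - \<eta> vs = 0" for vs
      using \<omega> \<xi> by (auto simp: coh_class_def ce_exact_def fun_eq_iff)
    then show ?thesis by (simp add: fun_eq_iff)
  next
    case (Suc p)
    obtain \<theta>1 where 1: "\<theta>1 \<in> forms p" "(\<lambda>vs. \<xi> vs - \<eta> vs) = ce_diff \<theta>1"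
      using \<xi> Suc by (auto simp: coh_class_def ce_exact_def)
    obtain \<theta>2 where 2: "\<theta>2 \<in> forms p" "(\<lambda>vs. \<omega> vs - \<eta> vs) = ce_diff \<theta>2"
      using \<omega> Suc by (auto simp: coh_class_def ce_exact_def)
    let ?\<theta> = "\<lambda>vs. 1 * \<theta>1 vs + (-1) * \<theta>2 vs"
    have \<theta>: "?\<theta> \<in> forms p" using 1 2 by (intro forms_lincomb)
    have d: "?\<delta> = ce_diff ?\<theta>"
    proof
      fix vs
      show "?\<delta> vs = ce_diff ?\<theta> vs"
        by (simp only: ce_diff_lincomb 1(2)[symmetric] 2(2)[symmetric]) simp
    qed
    have "form_ip g q (ce_diff ?\<theta>) \<xi> = 0" "form_ip g q (ce_diff ?\<theta>) \<omega> = 0"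
      using \<theta> \<xi> \<omega>(2) unfolding harmonic_def ce_adjoint_rel_def Suc
      by (auto simp: form_ip_zero_right simp del: mult_1 mult_minus1)
    then have "form_ip g q ?\<delta> ?\<delta> = 0"
      by (subst (1) d) (simp only: form_ip_diff_right diff_self)
    then show ?thesis by (rule definite[OF f])
  qed
  then show "\<xi> = \<omega>" by (simp add: fun_eq_iff)
qed (use \<omega> in auto)

lemma coh_class_self:
  assumes "\<omega> \<in> forms q"
  shows "\<omega> \<in> coh_class q \<omega>"
proof -
  have "(\<lambda>_. 0) \<in> ce_exact q"
    using forms_zero ce_diff_zero by (cases q) (auto simp: ce_exact_def image_iff intro!: bexI[of _ "\<lambda>_. 0"])
  then show ?thesis using assms by (simp add: coh_class_def)
qed

lemma coh_basis_eq:
  "coh_basis 0 = [wedge []]"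
  "coh_basis 1 = [wedge [1], wedge [2]]"
  "coh_basis 2 = [wedge [1,4], (\<lambda>vs. (wedge [1,5] vs + wedge [2,4] vs) / of_real (sqrt 2)), wedge [2,5]]"
  "coh_basis 3 = [wedge [1,3,4], (\<lambda>vs. (wedge [1,3,5] vs + wedge [2,3,4] vs) / of_real (sqrt 2)), wedge [2,3,5]]"
  "coh_basis 4 = [wedge [1,3,4,5], wedge [2,3,4,5]]"
  "coh_basis 5 = [wedge [1,2,3,4,5]]"
  by (simp_all add: coh_basis_def)

context dual_metric
begin

lemma dPQ_pos: "0 < dP" "0 < dQ"
  using pos by (simp_all add: dP_def dQ_def)

text \<open>The completion of the square behind \<open>sesq_positive\<close>, with \<open>Q\<close>
  in place of the product of two numbers.\<close>

lemma tens_positive: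
  shows "tens z z \<in> \<real>\<^sub>\<ge>\<^sub>0" and "tens z z = 0 \<longleftrightarrow> z = (0, 0, 0, 0)"
proof -
  obtain a b c d where z: "z = (a, b, c, d)" by (cases z)
  let ?w = "(of_real p * a + of_real q * c, of_real p * b + of_real q * d)"
  have *: "tens z z = of_real (1 / p) * Q ?w ?w + of_real (dP / p) * Q (c, d) (c, d)"
    using pos(1) by (simp add: z tens_def sesq_def dP_def field_simps power2_eq_square)
  have n: "of_real (1 / p) * Q ?w ?w \<in> \<real>\<^sub>\<ge>\<^sub>0" "of_real (dP / p) * Q (c, d) (c, d) \<in> \<real>\<^sub>\<ge>\<^sub>0"
    using pos dPQ_pos by (intro of_real_mult_nonneg sesq_positive; simp)+
  show "tens z z \<in> \<real>\<^sub>\<ge>\<^sub>0" unfolding * by (rule nonneg_Reals_add_I[OF n])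
  have "complex_of_real (dP / p) \<noteq> 0" "complex_of_real (1 / p) \<noteq> 0"
    using pos dPQ_pos by (simp_all del: of_real_divide)
  then show "tens z z = 0 \<longleftrightarrow> z = (0, 0, 0, 0)"
    unfolding * nonneg_Reals_add_eq_0_iff[OF n] using pos(1)
    by (auto simp: z sesq_positive[OF pos(3,4)] simp del: of_real_divide)
qed

lemmas block_positive = sesq_positive(1)[OF pos(1,2)] sesq_positive(1)[OF pos(3,4)] tens_positive(1) mult_cnj_nonneg
lemmas block_definite = sesq_positive(2)[OF pos(1,2)] sesq_positive(2)[OF pos(3,4)] tens_positive(2)

text \<open>All blocks are nonnegative, so each one vanishes, and their definiteness kills the value
  at every increasing multi-index.\<close>

lemma form_ip_definite:
  assumes q: "n \<le> 5" and \<delta>: "\<delta> \<in> forms n" and 0: "form_ip g n \<delta> \<delta> = 0"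
  shows "\<delta> = (\<lambda>_. 0)"
proof (rule forms_eq_zeroI[OF \<delta>])
  fix I assume I: "I \<in> multi_indices n"
  have n: "n = 0 \<or> n = 1 \<or> n = 2 \<or> n = 3 \<or> n = 4 \<or> n = 5" using q by auto
  note s = nonneg_Reals_add_eq_0_iff nonneg_Reals_add_I of_real_mult_nonneg block_positive block_definite
    dPQ_pos pos(5) mult_pos_pos
  have nz: "p \<noteq> 0" "s \<noteq> 0" "k \<noteq> 0" "dP \<noteq> 0" "dQ \<noteq> 0" using pos dPQ_pos by auto
  have c: "complex_of_real x * z = 0 \<longleftrightarrow> z = 0" if "0 < x" for x z using that by simp
  from n I 0 show "\<delta> (map bas I) = 0"
    by (elim disjE)
      (simp add: multi_indices_eq form_ip_0 form_ip_1 form_ip_2 form_ip_3 form_ip_4 form_ip_5 s c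
        del: One_nat_def of_real_mult mult_eq_0_iff; auto simp: nz)+
qed

end

section \<open>The inner products on cohomology\<close>

lemma ce_closed_add: "\<omega> \<in> ce_closed q \<Longrightarrow> \<eta> \<in> ce_closed q \<Longrightarrow> (\<lambda>vs. \<omega> vs + \<eta> vs) \<in> ce_closed q"
  using ce_closed_lincomb[of \<omega> q \<eta> 1 1] by simp

lemma ce_closed_diff: "\<omega> \<in> ce_closed q \<Longrightarrow> \<eta> \<in> ce_closed q \<Longrightarrow> (\<lambda>vs. \<omega> vs - \<eta> vs) \<in> ce_closed q"
  using ce_closed_lincomb[of \<omega> q \<eta> 1 "-1"] by simp

lemma ce_closed_scale: "\<omega> \<in> ce_closed q \<Longrightarrow> (\<lambda>vs. c * \<omega> vs) \<in> ce_closed q"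
  using ce_closed_lincomb[of \<omega> q \<omega> c 0] by simp

lemma ce_closed_forms: "\<omega> \<in> ce_closed q \<Longrightarrow> \<omega> \<in> forms q"
  by (simp add: ce_closed_def)

lemma hermitian_gramI:
  assumes sym: "\<And>i j. i < n \<Longrightarrow> j < n \<Longrightarrow> H i j = H j i"
    and pos: "\<And>x. gram_ip n H x x \<in> \<real>\<^sub>\<ge>\<^sub>0"
    and def: "\<And>x i. gram_ip n H x x = 0 \<Longrightarrow> i < n \<Longrightarrow> vec_index x i = 0"
  shows "hermitian_ip n (gram_ip n H)"
  unfolding hermitian_ip_def
proof (intro conjI ballI allI impI)
  fix x y z :: "complex Matrix.vec" and c
  assume x: "x \<in> carrier_vec n" and y: "y \<in> carrier_vec n"
  show "gram_ip n H (c \<cdot>\<^sub>v x) y = c * gram_ip n H x y"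
    using x y unfolding gram_ip_def sum_distrib_left by (intro sum.cong) auto
  have "cnj (gram_ip n H x y) = (\<Sum>i<n. \<Sum>j<n. of_real (H j i) * vec_index y j * cnj (vec_index x i))"
    unfolding gram_ip_def cnj_sum by (intro sum.cong) (auto simp: sym)
  also have "\<dots> = gram_ip n H y x" unfolding gram_ip_def by (rule sum.swap)
  finally show "gram_ip n H y x = cnj (gram_ip n H x y)" ..
  assume z: "z \<in> carrier_vec n"
  show "gram_ip n H (x + y) z = gram_ip n H x z + gram_ip n H y z"
    using x y z unfolding gram_ip_def sum.distrib[symmetric] by (intro sum.cong) (auto simp: algebra_simps)
next
  fix x :: "complex Matrix.vec" assume x: "x \<in> carrier_vec n"
  show "gram_ip n H x x \<in> \<real>\<^sub>\<ge>\<^sub>0" by (rule pos)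
  assume "gram_ip n H x x = 0"
  then show "x = 0\<^sub>v n" using def x by (intro eq_vecI) auto
qed

lemma sum_lt:
  "(\<Sum>i<2. f i) = f 0 + f (1::nat)" "(\<Sum>i<3. f i) = f 0 + f 1 + f (2::nat)"
  for f :: "nat \<Rightarrow> 'a::comm_monoid_add"
  by (simp_all add: eval_nat_numeral)

text \<open>An opaque name, so that simp reduces products by \<open>rt * rt = 1 / 2\<close> and does
  not rearrange square roots.\<close>

definition rt :: real where "rt = 1 / sqrt 2"

lemma rt_mult: "rt * rt = 1 / 2"
  by (simp add: rt_def)

lemma rt_nonzero: "rt \<noteq> 0"
  by (simp add: rt_def)

context dual_metric
begin

text \<open>Each degree is thereby reduced to naming a harmonic form in every class.\<close>

lemma h_ip_eqI:
  assumes q: "n \<le> 5"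
    and F: "\<And>x. (\<lambda>vs. \<Sum>i<length (coh_basis n). vec_index x i * (coh_basis n ! i) vs) = F x"
    and R: "\<And>x. R x \<in> coh_class n (F x)" "\<And>x. R x \<in> harmonic g n"
  shows "h_ip g n x y = form_ip g n (R x) (R y)"
proof -
  have "harmonic_rep g n (coh_class n (F x)) = R x" for x
    by (rule harmonic_rep_eqI[OF R form_ip_definite[OF q]])
  then show ?thesis by (simp add: h_ip_def coh_ip_def class_of_coords_def F)
qed

section \<open>Gram matrices on the basis classes\<close>

definition "H1 i j = [[p, q], [q, r]] ! i ! (j::nat)"
definition "H2 i j =
  [[p * s, rt * (p * t + q * s), q * t],
   [rt * (p * t + q * s), rt * rt * (p * u + 2 * q * t + r * s), rt * (q * u + r * t)],
   [q * t, rt * (q * u + r * t), r * u]] ! i ! (j::nat)"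
text \<open>\<open>Delta\<close> is the squared norm of the skew tensor \<open>(0, 1, -1, 0)\<close> and \<open>dl\<close> its products with the basis,
  so \<open>H3\<close> is the Gram matrix of the quotient norm.\<close>

definition "Delta = p * u - 2 * q * t + r * s"
definition "dl i = [p * t - q * s, rt * (p * u - r * s), q * u - r * t] ! i"
definition "H3 i j = k * (H2 i j - dl i * dl j / Delta)"

lemma Delta_pos: "0 < Delta"
proof -
  have "tens (0, 1, -1, 0) (0, 1, -1, 0) = of_real Delta"
    by (simp add: tens_def sesq_def Delta_def)
  then have "complex_of_real Delta \<in> \<real>\<^sub>\<ge>\<^sub>0" "complex_of_real Delta \<noteq> 0"
    using tens_positive[of "(0, 1, -1, 0)"] by auto
  then show ?thesis by auto
qed

lemmas eval_simps = wedge_simps chi_bas ce_diff_simps bracket_bas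

lemma h_ip_0: "h_ip g 0 x y = vec_index x 0 * cnj (vec_index y 0)"
proof -
  let ?R = "\<lambda>x vs. vec_index x 0 * wedge [] vs"
  have c: "?R x \<in> ce_closed 0" for x :: "complex Matrix.vec" by (intro ce_closed_scale wedge_closed_0)
  have "h_ip g 0 x y = form_ip g 0 (?R x) (?R y)"
  proof (rule h_ip_eqI)
    show "?R x \<in> coh_class 0 (?R x)" for x by (intro coh_class_self ce_closed_forms c)
    show "?R x \<in> harmonic g 0" for x by (rule harmonicI[OF c]) simp
  qed (simp_all add: coh_basis_eq)
  then show ?thesis by (simp add: form_ip_0 wedge_Nil)
qed

lemma h_ip_1: "h_ip g 1 x y = P (vec_index x 0, vec_index x 1) (vec_index y 0, vec_index y 1)"
proof -
  let ?R = "\<lambda>x vs. vec_index x 0 * wedge [1] vs + vec_index x 1 * wedge [2] vs"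
  have c: "?R x \<in> ce_closed 1" for x :: "complex Matrix.vec"
    by (intro ce_closed_add ce_closed_scale wedge_closed_1)
  have "h_ip g 1 x y = form_ip g 1 (?R x) (?R y)"
  proof (rule h_ip_eqI)
    show "?R x \<in> coh_class 1 (?R x)" for x by (intro coh_class_self ce_closed_forms c)
    show "?R x \<in> harmonic g 1" for x
      by (rule harmonicI[OF c]) (simp add: form_ip_1 eval_simps sesq_def del: One_nat_def)
  qed (simp_all add: coh_basis_eq lessThan_Suc fun_eq_iff del: One_nat_def, simp)
  then show ?thesis by (simp add: form_ip_1 eval_simps sesq_def del: One_nat_def)
qed

text \<open>The classes have weight 4, while the differentials of \<chi>^3, \<chi>^4, \<chi>^5 have
  weights 2 and 3. In the evaluation this appears as the vanishing of the brackets of X_1, X_2 with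
  X_4, X_5.\<close>

lemma h_ip_2: "h_ip g 2 x y =
    tens (vec_index x 0, rt * vec_index x 1, rt * vec_index x 1, vec_index x 2)
      (vec_index y 0, rt * vec_index y 1, rt * vec_index y 1, vec_index y 2)"
proof -
  let ?R = "\<lambda>x vs. vec_index x 0 * wedge [1, 4] vs + (of_real rt * vec_index x 1) * (wedge [1, 5] vs + wedge [2, 4] vs)
     + vec_index x 2 * wedge [2, 5] vs"
  have c: "?R x \<in> ce_closed 2" for x :: "complex Matrix.vec"
    by (intro ce_closed_add ce_closed_scale wedge_closed_2)
  have "h_ip g 2 x y = form_ip g 2 (?R x) (?R y)"
  proof (rule h_ip_eqI)
    show "?R x \<in> coh_class 2 (?R x)" for x by (intro coh_class_self ce_closed_forms c)
    show "?R x \<in> harmonic g 2" for x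
    proof (rule harmonicI[OF c])
      fix l \<theta> assume "2 = Suc l" and \<theta>: "\<theta> \<in> forms l"
      show "form_ip g 2 (ce_diff \<theta>) (?R x) = 0"
        by (simp add: form_ip_2 eval_simps sesq_def tens_def forms_zero_arg[OF \<theta>] del: One_nat_def)
    qed
    show "(\<lambda>vs. \<Sum>i<length (coh_basis 2). vec_index x i * (coh_basis 2 ! i) vs) = ?R x" for x
      by (simp add: coh_basis_eq fun_eq_iff rt_def lessThan_Suc del: One_nat_def)
        (simp add: numeral_2_eq_2 algebra_simps)
  qed simp
  then show ?thesis by (simp add: form_ip_2 eval_simps sesq_def tens_def del: One_nat_def)
qed

text \<open>The classes have weight 9, but 3-forms have weight at most 8, so no exact form can meet
  them.\<close>

lemma h_ip_4: "h_ip g 4 x y =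
    of_real (k * dQ) * P (vec_index x 0, vec_index x 1) (vec_index y 0, vec_index y 1)"
proof -
  let ?R = "\<lambda>x vs. vec_index x 0 * wedge [1, 3, 4, 5] vs + vec_index x 1 * wedge [2, 3, 4, 5] vs"
  have c: "?R x \<in> ce_closed 4" for x :: "complex Matrix.vec"
    by (intro ce_closed_add ce_closed_scale wedge_closed_4)
  have "h_ip g 4 x y = form_ip g 4 (?R x) (?R y)"
  proof (rule h_ip_eqI)
    show "?R x \<in> coh_class 4 (?R x)" for x by (intro coh_class_self ce_closed_forms c)
    show "?R x \<in> harmonic g 4" for x
    proof (rule harmonicI[OF c])
      fix l \<theta> assume "4 = Suc l" and \<theta>: "\<theta> \<in> forms l"
      show "form_ip g 4 (ce_diff \<theta>) (?R x) = 0"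
        by (simp add: form_ip_4 eval_simps sesq_def forms_zero_arg[OF \<theta>] forms_repeated[OF \<theta>] del: One_nat_def)
    qed
    show "(\<lambda>vs. \<Sum>i<length (coh_basis 4). vec_index x i * (coh_basis 4 ! i) vs) = ?R x" for x
      by (simp add: coh_basis_eq fun_eq_iff lessThan_Suc del: One_nat_def) simp
  qed simp
  then show ?thesis by (simp add: form_ip_4 eval_simps sesq_def del: One_nat_def)
qed

lemma h_ip_5: "h_ip g 5 x y = of_real (k * dP * dQ) * (vec_index x 0 * cnj (vec_index y 0))"
proof -
  let ?R = "\<lambda>x vs. vec_index x 0 * wedge [1, 2, 3, 4, 5] vs"
  have c: "?R x \<in> ce_closed 5" for x :: "complex Matrix.vec"
    by (intro ce_closed_scale wedge_closed_5)
  have "h_ip g 5 x y = form_ip g 5 (?R x) (?R y)"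
  proof (rule h_ip_eqI)
    show "?R x \<in> coh_class 5 (?R x)" for x by (intro coh_class_self ce_closed_forms c)
    show "?R x \<in> harmonic g 5" for x
    proof (rule harmonicI[OF c])
      fix l \<theta> assume "5 = Suc l" and \<theta>: "\<theta> \<in> forms l"
      show "form_ip g 5 (ce_diff \<theta>) (?R x) = 0"
        by (simp add: form_ip_5 eval_simps forms_zero_arg[OF \<theta>] forms_repeated[OF \<theta>] del: One_nat_def)
    qed
    show "(\<lambda>vs. \<Sum>i<length (coh_basis 5). vec_index x i * (coh_basis 5 ! i) vs) = ?R x" for x
      by (simp add: coh_basis_eq fun_eq_iff)
  qed simp
  then show ?thesis by (simp add: form_ip_5 eval_simps del: One_nat_def)
qed

text \<open>The shift adds m times the skew tensor (0, 1, -1, 0). The linear terms contain its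
  products with symmetric tensors, the last term its squared norm.\<close>

lemma tens_shift: "tens (a, b + m, b - m, c) (a', b' + m', b' - m', c') =
    tens (a, b, b, c) (a', b', b', c')
    + m * cnj (of_real (p * t - q * s) * a' + of_real (p * u - r * s) * b' + of_real (q * u - r * t) * c')
    + cnj m' * (of_real (p * t - q * s) * a + of_real (p * u - r * s) * b + of_real (q * u - r * t) * c)
    + m * cnj m' * of_real Delta"
  by (simp add: tens_def sesq_def Delta_def algebra_simps)

text \<open>The coefficient of \<open>\<chi>\<^sup>1\<^sup>3\<^sup>5 - \<chi>\<^sup>2\<^sup>3\<^sup>4\<close> that makes a class in degree 3 harmonic.\<close>

definition kappa :: "complex Matrix.vec \<Rightarrow> complex" where
  "kappa x = - (of_real (p * t - q * s) * vec_index x 0 + of_real (p * u - r * s) * (rt * vec_index x 1)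
     + of_real (q * u - r * t) * vec_index x 2) / of_real Delta"

lemma h_ip_3: "h_ip g 3 x y = of_real k *
    tens (vec_index x 0, rt * vec_index x 1 + kappa x, rt * vec_index x 1 - kappa x, vec_index x 2)
      (vec_index y 0, rt * vec_index y 1 + kappa y, rt * vec_index y 1 - kappa y, vec_index y 2)"
proof -
  let ?F = "\<lambda>x vs. vec_index x 0 * wedge [1, 3, 4] vs + (of_real rt * vec_index x 1) * (wedge [1, 3, 5] vs + wedge [2, 3, 4] vs)
     + vec_index x 2 * wedge [2, 3, 5] vs"
  let ?R = "\<lambda>x vs. ?F x vs + kappa x * (wedge [1, 3, 5] vs - wedge [2, 3, 4] vs)"
  have c: "?R x \<in> ce_closed 3" for x :: "complex Matrix.vec"
    by (intro ce_closed_add ce_closed_diff ce_closed_scale wedge_closed_3)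
  have "h_ip g 3 x y = form_ip g 3 (?R x) (?R y)"
  proof (rule h_ip_eqI)
    show "?R x \<in> coh_class 3 (?F x)" for x
    proof -
      \<comment> \<open>The sign matches the differential \<chi>^234 - \<chi>^135 of \<chi>^45; the
        zero summand makes the multiple an instance of \<open>ce_diff_lincomb\<close>.\<close>
      have "(\<lambda>vs. ?R x vs - ?F x vs) = ce_diff (\<lambda>vs. (- kappa x) * wedge [4, 5] vs + 0 * wedge [4, 5] vs)"
        unfolding ce_diff_lincomb ce_diff_wedge_45 by (simp add: fun_eq_iff algebra_simps)
      moreover have "(\<lambda>vs. (- kappa x) * wedge [4, 5] vs + 0 * wedge [4, 5] vs) \<in> forms 2"
        by (intro forms_lincomb wedge_forms') auto
      ultimately show ?thesis
        using ce_closed_forms[OF c] unfolding coh_class_def ce_exact_def by (auto simp: eval_nat_numeral)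
    qed
    show "?R x \<in> harmonic g 3" for x
    proof (rule harmonicI[OF c])
      fix l \<theta> assume l: "3 = Suc l" and \<theta>: "\<theta> \<in> forms l"
      have sw: "\<theta> [bas 5, bas 4] = - \<theta> [bas 4, bas 5]"
        using forms_swap[OF \<theta>, of "[bas 4, bas 5]" 0 1] l by simp
      \<comment> \<open>Orthogonality to the skew tensor is the equation solved by
        \<open>kappa\<close>. It suffices because [X_1, X_3] = X_4 and [X_2, X_3] = X_5 give the
        differential of \<theta> the components (0, -z, z, 0) with z = \<theta>(X_4, X_5).\<close>
      have "tens (0, 0 + 1, 0 - 1, 0) (vec_index x 0, rt * vec_index x 1 + kappa x, rt * vec_index x 1 - kappa x, vec_index x 2) = 0"
        unfolding tens_shift using Delta_pos by (simp add: kappa_def tens_def sesq_def)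
      moreover have "tens (0, - z, z, 0) w = - z * tens (0, 0 + 1, 0 - 1, 0) w" for z w
        by (cases w) (simp add: tens_def sesq_def algebra_simps)
      ultimately have "tens (0, - z, z, 0) (vec_index x 0, rt * vec_index x 1 + kappa x, rt * vec_index x 1 - kappa x, vec_index x 2) = 0" for z
        by simp
      then show "form_ip g 3 (ce_diff \<theta>) (?R x) = 0"
        by (simp add: form_ip_3 eval_simps sesq_def sw forms_zero_arg[OF \<theta>] forms_repeated[OF \<theta>] del: One_nat_def)
    qed
    show "(\<lambda>vs. \<Sum>i<length (coh_basis 3). vec_index x i * (coh_basis 3 ! i) vs) = ?F x" for x
      by (simp add: coh_basis_eq fun_eq_iff rt_def lessThan_Suc del: One_nat_def)
        (simp add: numeral_2_eq_2 algebra_simps)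
  qed simp
  then show ?thesis by (simp add: form_ip_3 eval_simps sesq_def del: One_nat_def)
qed

lemma h_ip_gram:
  "h_ip g 0 = gram_ip 1 (\<lambda>i j. 1)"
  "h_ip g 1 = gram_ip 2 H1"
  "h_ip g 2 = gram_ip 3 H2"
  "h_ip g 3 = gram_ip 3 H3"
  "h_ip g 4 = gram_ip 2 (\<lambda>i j. k * dQ * H1 i j)"
  "h_ip g 5 = gram_ip 1 (\<lambda>i j. k * dP * dQ)"
proof -
  show "h_ip g 0 = gram_ip 1 (\<lambda>i j. 1)"
    by (intro ext) (simp add: h_ip_0 gram_ip_def)
  show "h_ip g 1 = gram_ip 2 H1"
    by (intro ext) (unfold h_ip_1 gram_ip_def sum_lt, simp add: sesq_def H1_def algebra_simps)
  show "h_ip g 2 = gram_ip 3 H2"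
    by (intro ext) (unfold h_ip_2 gram_ip_def sum_lt, simp add: tens_def sesq_def H2_def algebra_simps)
  show "h_ip g 4 = gram_ip 2 (\<lambda>i j. k * dQ * H1 i j)"
    by (intro ext) (unfold h_ip_4 gram_ip_def sum_lt, simp add: sesq_def H1_def algebra_simps)
  show "h_ip g 5 = gram_ip 1 (\<lambda>i j. k * dP * dQ)"
    by (intro ext) (simp add: h_ip_5 gram_ip_def)
  show "h_ip g 3 = gram_ip 3 H3"
  proof (intro ext)
    fix x y :: "complex Matrix.vec"
    let ?D = "\<lambda>x. complex_of_real (p * t - q * s) * vec_index x 0
      + complex_of_real (p * u - r * s) * (complex_of_real rt * vec_index x 1)
      + complex_of_real (q * u - r * t) * vec_index x 2"
    \<comment> \<open>With \<open>kappa\<close> = - ?D / \<open>Delta\<close> the three corrections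
      in \<open>tens_shift\<close> have signs -, -, + and collapse to one: the effect of projecting
      away from the skew tensor.\<close>
    have "h_ip g 3 x y = of_real k * (h_ip g 2 x y - ?D x * cnj (?D y) / of_real Delta)"
      unfolding h_ip_3 tens_shift h_ip_2 kappa_def using Delta_pos by (simp add: field_simps)
    also have "h_ip g 2 x y = gram_ip 3 H2 x y" using \<open>h_ip g 2 = gram_ip 3 H2\<close> by simp
    also have "of_real k * (gram_ip 3 H2 x y - ?D x * cnj (?D y) / of_real Delta) = gram_ip 3 H3 x y"
      unfolding gram_ip_def sum_lt by (simp add: H3_def dl_def algebra_simps add_divide_distrib diff_divide_distrib)
    finally show "h_ip g 3 x y = gram_ip 3 H3 x y" .
  qed
qed

lemma hermitian_h_ip:
  "hermitian_ip 1 (h_ip g 0)" "hermitian_ip 2 (h_ip g 1)" "hermitian_ip 3 (h_ip g 2)"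
  "hermitian_ip 3 (h_ip g 3)" "hermitian_ip 2 (h_ip g 4)" "hermitian_ip 1 (h_ip g 5)"
proof -
  have kd: "0 < k * dQ" "0 < k * dP * dQ" using pos(5) dPQ_pos by auto
  note block_positive[intro] of_real_mult_nonneg[intro]
  show "hermitian_ip 1 (h_ip g 0)" unfolding h_ip_gram(1)
    by (rule hermitian_gramI; (unfold h_ip_gram(1)[symmetric] h_ip_0)?) auto
  show "hermitian_ip 1 (h_ip g 5)" unfolding h_ip_gram(6)
    by (rule hermitian_gramI; (unfold h_ip_gram(6)[symmetric] h_ip_5)?) (use kd in \<open>auto simp del: of_real_mult\<close>)
  have 2: "i < 2 \<longleftrightarrow> i = 0 \<or> i = 1" for i :: nat by auto
  have 3: "i < 3 \<longleftrightarrow> i = 0 \<or> i = 1 \<or> i = 2" for i :: nat by auto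
  show "hermitian_ip 2 (h_ip g 1)" unfolding h_ip_gram(2)
    by (rule hermitian_gramI; (unfold h_ip_gram(2)[symmetric] h_ip_1)?)
      (auto simp: 2 H1_def block_definite)
  show "hermitian_ip 2 (h_ip g 4)" unfolding h_ip_gram(5)
    by (rule hermitian_gramI; (unfold h_ip_gram(5)[symmetric] h_ip_4)?)
      (use kd in \<open>auto simp: 2 H1_def block_definite simp del: of_real_mult\<close>)
  show "hermitian_ip 3 (h_ip g 2)" unfolding h_ip_gram(3)
    by (rule hermitian_gramI; (unfold h_ip_gram(3)[symmetric] h_ip_2)?)
      (auto simp: 3 H2_def block_definite rt_nonzero)
  show "hermitian_ip 3 (h_ip g 3)" unfolding h_ip_gram(4)
  proof (rule hermitian_gramI; (unfold h_ip_gram(4)[symmetric] h_ip_3)?)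
    fix x and i :: nat
    let ?z = "(vec_index x 0, rt * vec_index x 1 + kappa x, rt * vec_index x 1 - kappa x, vec_index x 2)"
    show "of_real k * tens ?z ?z \<in> \<real>\<^sub>\<ge>\<^sub>0" using pos(5) by auto
    assume "of_real k * tens ?z ?z = 0" and i: "i < 3"
    then have "tens ?z ?z = 0" using pos(5) by (metis mult_eq_0_iff of_real_eq_0_iff less_irrefl)
    then have z: "?z = (0, 0, 0, 0)" by (rule block_definite(3)[THEN iffD1])
    let ?w = "complex_of_real rt * vec_index x 1"
    have w: "?w + kappa x = 0" "?w - kappa x = 0" "vec_index x 0 = 0" "vec_index x 2 = 0"
      using z by (simp_all only: prod.inject)
    have "2 * ?w = (?w + kappa x) + (?w - kappa x)" by simp
    also have "\<dots> = 0" unfolding w by simp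
    finally have "vec_index x 1 = 0" using rt_nonzero by simp
    then show "vec_index x i = 0" using w i by (auto simp: 3)
  qed (auto simp: 3 H3_def H2_def)
qed

end

section \<open>Parameters of a graded inner product\<close>

definition vec2 :: "real \<Rightarrow> real \<Rightarrow> real ^ 2" where
  "vec2 a b = vector [a, b]"

lemma vec2_nth [simp]: "vec2 a b $ 1 = a" "vec2 a b $ 2 = b"
  by (simp_all add: vec2_def)

lemma vec2_eqI: "x $ 1 = y $ 1 \<Longrightarrow> x $ 2 = y $ 2 \<Longrightarrow> x = (y :: real ^ 2)"
  by (simp add: Finite_Cartesian_Product.vec_eq_iff forall_2)

lemma vec2_expansion:
  fixes x :: "real ^ 2"
  shows "x = x $ 1 *\<^sub>R axis 1 1 + x $ 2 *\<^sub>R axis 2 (1::real)"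
  by (rule vec2_eqI) (simp_all add: axis_def)

lemma linear_vec2:
  fixes x :: "real ^ 2"
  assumes "linear \<phi>"
  shows "\<phi> x = x $ 1 *\<^sub>R \<phi> (axis 1 1) + x $ 2 *\<^sub>R \<phi> (axis 2 1)"
  by (subst vec2_expansion[of x]) (simp add: linear_add[OF assms] linear_scale[OF assms])

lemma inner_productD:
  assumes "inner_product b"
  shows "linear (b u)" "linear (\<lambda>u. b u v)" "b u v = b v u" "u \<noteq> 0 \<Longrightarrow> 0 < b u u"
  using assms unfolding inner_product_def by auto

text \<open>Definiteness makes b injective, so any vector representing \<phi> is the value of the
  inverse.\<close>

lemma inv_into_inner_product:
  assumes b: "inner_product b" and u: "b u = \<phi>"
  shows "inv_into UNIV b \<phi> = u"
proof -
  note bD = inner_productD[OF b]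
  have "inj b"
  proof (rule injI)
    fix v w assume eq: "b v = b w"
    have "b (v - w) (v - w) = b v (v - w) - b w (v - w)" by (rule linear_diff[OF bD(2)])
    then show "v = w" using bD(4)[of "v - w"] eq by auto
  qed
  then show ?thesis using inv_into_f_f[of b UNIV u] u by simp
qed

text \<open>\<open>gram2 b p q r\<close>: the inner product \<open>b\<close> has the matrix inverse to \<open>((p, q), (q, r))\<close>.\<close>

definition gram2 :: "(real ^ 2 \<Rightarrow> real ^ 2 \<Rightarrow> real) \<Rightarrow> real \<Rightarrow> real \<Rightarrow> real \<Rightarrow> bool" where
  "gram2 b p q r \<longleftrightarrow> 0 < p \<and> 0 < p * r - q\<^sup>2 \<and>
     (\<forall>x y. b x y = (r * x $ 1 * y $ 1 - q * (x $ 1 * y $ 2 + x $ 2 * y $ 1) + p * x $ 2 * y $ 2) / (p * r - q\<^sup>2))"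

lemma gram2_exists:
  assumes b: "inner_product b"
  obtains p q r where "gram2 b p q r"
proof -
  note bD = inner_productD[OF b]
  let ?e = "axis 1 1 :: real ^ 2" and ?f = "axis 2 1 :: real ^ 2"
  define A B C d where "A = b ?e ?e" and "B = b ?e ?f" and "C = b ?f ?f" and "d = A * C - B\<^sup>2"
  have ne: "?e \<noteq> 0" "vec2 (- B) A \<noteq> 0" if "A > 0"
    using that by (auto simp: axis_def Finite_Cartesian_Product.vec_eq_iff forall_2)
  have A: "A > 0" unfolding A_def by (rule bD(4)) simp
  have eq: "b x y = A * x $ 1 * y $ 1 + B * (x $ 1 * y $ 2 + x $ 2 * y $ 1) + C * x $ 2 * y $ 2" for x y
  proof -
    have "b x y = x $ 1 * b ?e y + x $ 2 * b ?f y" using linear_vec2[OF bD(2)[of y], of x] by simp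
    moreover have "b v y = y $ 1 * b v ?e + y $ 2 * b v ?f" for v
      using linear_vec2[OF bD(1)[of v], of y] by simp
    ultimately show ?thesis
      by (simp add: A_def B_def C_def bD(3)[of ?f ?e] algebra_simps)
  qed
  \<comment> \<open>This vector is b-orthogonal to the first axis vector, so its norm isolates the
    determinant d.\<close>
  have "0 < b (vec2 (- B) A) (vec2 (- B) A)" by (rule bD(4)[OF ne(2)[OF A]])
  also have "\<dots> = A * d" by (simp add: eq d_def power2_eq_square algebra_simps)
  finally have d: "d > 0" using A by (simp add: zero_less_mult_iff)
  have C: "C > 0"
  proof -
    have "A * C > 0" using d zero_le_power2[of B] unfolding d_def by linarith
    then show ?thesis using A by (simp add: zero_less_mult_iff)
  qed
  have D: "C / d * (A / d) - (- B / d)\<^sup>2 = 1 / d"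
  proof -
    have "C / d * (A / d) - (- B / d)\<^sup>2 = d / (d * d)"
      by (simp add: d_def power2_eq_square diff_divide_distrib mult.commute)
    then show ?thesis using d by simp
  qed
  have "gram2 b (C / d) (- B / d) (A / d)"
    unfolding gram2_def D using C d by (auto simp: eq field_simps)
  then show thesis by (rule that)
qed

lemma gram2_rep:
  assumes g: "gram2 b p q r" and \<phi>: "linear \<phi>"
  shows "b (vec2 (p * \<phi> (axis 1 1) + q * \<phi> (axis 2 1)) (q * \<phi> (axis 1 1) + r * \<phi> (axis 2 1))) = \<phi>"
proof
  fix y
  have d: "p * r - q\<^sup>2 \<noteq> 0" using g by (simp add: gram2_def)
  have b: "b x y = (r * x $ 1 * y $ 1 - q * (x $ 1 * y $ 2 + x $ 2 * y $ 1) + p * x $ 2 * y $ 2) / (p * r - q\<^sup>2)" for x y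
    using g by (simp add: gram2_def)
  show "b (vec2 (p * \<phi> (axis 1 1) + q * \<phi> (axis 2 1)) (q * \<phi> (axis 1 1) + r * \<phi> (axis 2 1))) y = \<phi> y"
    unfolding b linear_vec2[OF \<phi>, of y] using d by (simp add: field_simps power2_eq_square)
qed

lemma gram2_dual_norm:
  assumes b: "inner_product b" and g: "gram2 b p q r" and \<phi>: "linear \<phi>"
    and x: "\<phi> (axis 1 1) = x" "\<phi> (axis 2 1) = y"
  shows "dual_norm b \<phi> = sqrt (p * x\<^sup>2 + 2 * q * x * y + r * y\<^sup>2)"
proof -
  let ?v = "vec2 (p * \<phi> (axis 1 1) + q * \<phi> (axis 2 1)) (q * \<phi> (axis 1 1) + r * \<phi> (axis 2 1))"
  have "inv_into UNIV b \<phi> = ?v" by (rule inv_into_inner_product[OF b gram2_rep[OF g \<phi>]])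
  then have "dual_ip b \<phi> \<phi> = \<phi> ?v" by (simp add: dual_ip_def gram2_rep[OF g \<phi>])
  also have "\<dots> = p * x\<^sup>2 + 2 * q * x * y + r * y\<^sup>2"
    by (subst linear_vec2[OF \<phi>]) (simp add: x power2_eq_square algebra_simps)
  finally show ?thesis by (simp add: dual_norm_def)
qed

text \<open>The trace of ((s, t), (t, u)), the inverse of the matrix of b, times the matrix of c,
  which is the adjugate of ((p, q), (q, r)) over its determinant.\<close>

lemma gram2_tr_inv:
  assumes b: "inner_product b" and g: "gram2 b s t u" and c: "inner_product c" and h: "gram2 c p q r"
  shows "tr_inv b c = (p * u - 2 * q * t + r * s) / (p * r - q\<^sup>2)"
proof -
  have inv: "inv_into UNIV b (c x) =
      vec2 (s * c x (axis 1 1) + t * c x (axis 2 1)) (t * c x (axis 1 1) + u * c x (axis 2 1))" for x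
    by (rule inv_into_inner_product[OF b gram2_rep[OF g inner_productD(1)[OF c]]])
  have c: "c x y = (r * x $ 1 * y $ 1 - q * (x $ 1 * y $ 2 + x $ 2 * y $ 1) + p * x $ 2 * y $ 2) / (p * r - q\<^sup>2)" for x y
    using h by (simp add: gram2_def)
  show ?thesis
    unfolding tr_inv_def trace_def inv sum_2 matrix_def
    by (simp add: c axis_def add_divide_distrib diff_divide_distrib algebra_simps)
qed

text \<open>With c = g(X_3, X_3) the dual metric on \<chi>^3 is k = 1 / c. Brackets of degree -1
  give c times a squared area, whereas the Gram determinant is the squared area over p r - q^2; the
  quotient is a_g. Brackets into degree -3 identify b with B / c, so its dual metric is c times that
  of B.\<close>

lemma graded_parameters:
  assumes "graded_inner_product g"
  obtains p q r s t u k where "dual_metric g p q r s t u k"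
    and "a_coeff g = (p * r - q\<^sup>2) / k"
    and "\<And>\<phi> x y. linear \<phi> \<Longrightarrow> \<phi> (axis 1 1) = x \<Longrightarrow> \<phi> (axis 2 1) = y \<Longrightarrow>
      dual_norm (g_m1 g) \<phi> = sqrt (p * x\<^sup>2 + 2 * q * x * y + r * y\<^sup>2)"
    and "\<And>\<phi> x y. linear \<phi> \<Longrightarrow> \<phi> (axis 1 1) = x \<Longrightarrow> \<phi> (axis 2 1) = y \<Longrightarrow>
      dual_norm (b_form g) \<phi> = sqrt ((s * x\<^sup>2 + 2 * t * x * y + u * y\<^sup>2) / k)"
    and "tr_inv (b_form g) (g_m1 g) = (p * u - 2 * q * t + r * s) / (k * (p * r - q\<^sup>2))"
proof -
  have g: "inner_product g" and orth: "\<And>x z. g (deg1 x) (deg2 z) = 0"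
    "\<And>x w. g (deg1 x) (deg3 w) = 0" "\<And>z w. g (deg2 z) (deg3 w) = 0"
    using assms by (auto simp: graded_inner_product_def)
  note gD = inner_productD[OF g]
  have orth': "g (deg2 z) (deg1 x) = 0" "g (deg3 w) (deg1 x) = 0" "g (deg3 w) (deg2 z) = 0" for x z w
    using orth gD(3) by metis+
  have l1: "linear deg1" and l2: "linear deg2" and l3: "linear deg3"
    by (auto intro!: linearI simp: deg1_def deg2_def deg3_def)
  have ip_comp: "inner_product (\<lambda>x y. g (f x) (f y))" if f: "linear f" "\<And>x. f x = 0 \<Longrightarrow> x = 0"
    for f :: "'c::real_vector \<Rightarrow> g5"
    unfolding inner_product_def
  proof (intro conjI allI impI)
    show "linear (\<lambda>v. g (f u) (f v))" for u
      using linear_compose[OF f(1) gD(1)] by (simp add: o_def)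
    show "linear (\<lambda>u. g (f u) (f v))" for v
      using linear_compose[OF f(1) gD(2)] by (simp add: o_def)
    show "g (f u) (f v) = g (f v) (f u)" for u v by (rule gD(3))
    show "0 < g (f u) (f u)" if "u \<noteq> 0" for u using f(2) gD(4) that by blast
  qed
  have A: "inner_product (g_m1 g)"
    unfolding g_m1_def by (rule ip_comp[OF l1]) (simp add: deg1_def zero_prod_def)
  define B where "B x y = g (deg3 x) (deg3 y)" for x y
  have B: "inner_product B" unfolding B_def[abs_def] by (rule ip_comp[OF l3]) (simp add: deg3_def zero_prod_def)
  obtain p q r where P: "gram2 (g_m1 g) p q r" using gram2_exists[OF A] .
  obtain s t u where Q: "gram2 B s t u" using gram2_exists[OF B] .
  define c where "c = g (deg2 1) (deg2 1)"
  have c: "c > 0" unfolding c_def by (rule gD(4)) (simp add: deg2_def zero_prod_def)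
  have g2: "g (deg2 z) (deg2 z') = c * z * z'" for z z'
  proof -
    have z: "deg2 z = z *\<^sub>R deg2 1" for z by (simp add: deg2_def)
    have "g (deg2 z) (deg2 z') = g (z *\<^sub>R deg2 1) (z' *\<^sub>R deg2 1)" by (simp only: z[symmetric])
    then show ?thesis by (simp add: linear_scale[OF gD(1)] linear_scale[OF gD(2)] c_def)
  qed
  have decomp: "v = deg1 (fst v) + deg2 (fst (snd v)) + deg3 (snd (snd v))" for v
    by (simp add: deg1_def deg2_def deg3_def prod_eq_iff)
  have g_eq: "g v w = g_m1 g (fst v) (fst w) + c * fst (snd v) * fst (snd w) + B (snd (snd v)) (snd (snd w))" for v w
    by (subst decomp[of v], subst decomp[of w])
      (simp add: linear_add[OF gD(1)] linear_add[OF gD(2)] orth orth' g2 g_m1_def B_def)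
  have dP: "p * r - q\<^sup>2 > 0" "p > 0" and dQ: "s * u - t\<^sup>2 > 0" "s > 0"
    using P Q by (simp_all add: gram2_def)
  have Aeq: "g_m1 g x y = (r * x $ 1 * y $ 1 - q * (x $ 1 * y $ 2 + x $ 2 * y $ 1) + p * x $ 2 * y $ 2) / (p * r - q\<^sup>2)" for x y
    using P by (simp add: gram2_def)
  have Beq: "B x y = (u * x $ 1 * y $ 1 - t * (x $ 1 * y $ 2 + x $ 2 * y $ 1) + s * x $ 2 * y $ 2) / (s * u - t\<^sup>2)" for x y
    using Q by (simp add: gram2_def)
  \<comment> \<open>\<open>D i\<close> represents \<open>chi i\<close>; the entries are rows of the
    inverse Gram matrices.\<close>
  define D where "D i = [deg1 (vec2 p q), deg1 (vec2 q r), deg2 (1 / c), deg3 (vec2 s t), deg3 (vec2 t u)] ! (i - 1)" for i :: nat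
  have lin: "linear (\<lambda>x :: real ^ 2. x $ i)" for i by (rule linearI) simp_all
  have AB: "g_m1 g (vec2 p q) x = x $ 1" "g_m1 g (vec2 q r) x = x $ 2"
    "B (vec2 s t) x = x $ 1" "B (vec2 t u) x = x $ 2" for x
    using fun_cong[OF gram2_rep[OF P lin], of 1 x] fun_cong[OF gram2_rep[OF P lin], of 2 x]
      fun_cong[OF gram2_rep[OF Q lin], of 1 x] fun_cong[OF gram2_rep[OF Q lin], of 2 x]
    by (simp_all add: axis_def)
  have AB0: "g_m1 g 0 x = 0" "B 0 x = 0" for x
    using linear_0[OF inner_productD(2)[OF A]] linear_0[OF inner_productD(2)[OF B]] by auto
  have rep: "g (D i) = chi i" if "i \<in> {1..5}" for i
  proof
    fix v :: g5
    obtain x z w where v: "v = (x, z, w)" by (cases v)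
    have "g (D 1) v = chi 1 v" "g (D 2) v = chi 2 v" "g (D 3) v = chi 3 v"
      "g (D 4) v = chi 4 v" "g (D 5) v = chi 5 v"
      using c by (simp_all add: g_eq v D_def deg1_def deg2_def deg3_def chi_def AB AB0)
    moreover have "i = 1 \<or> i = 2 \<or> i = 3 \<or> i = 4 \<or> i = 5" using that by auto
    ultimately show "g (D i) v = chi i v" by blast
  qed
  have dual: "dual_ip g (chi i) (chi j) = chi i (D j)" if "i \<in> {1..5}" "j \<in> {1..5}" for i j
    unfolding dual_ip_def inv_into_inner_product[OF g rep[OF that(1)]] inv_into_inner_product[OF g rep[OF that(2)]]
    by (simp only: rep[OF that(1)])
  have dm: "dual_metric g p q r s t u (1 / c)"
    using dP dQ c
    by unfold_locales (simp_all add: dual, simp_all add: D_def chi_def deg1_def deg2_def deg3_def)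
  have a: "a_coeff g = (p * r - q\<^sup>2) / (1 / c)"
    unfolding a_coeff_def
  proof (rule the_equality)
    have *: "g_m1 g x x * g_m1 g y y - (g_m1 g x y)\<^sup>2 = (x $ 1 * y $ 2 - x $ 2 * y $ 1)\<^sup>2 / (p * r - q\<^sup>2)" for x y
      unfolding Aeq using dP(1) by (simp add: divide_simps) (simp add: power2_eq_square algebra_simps)
    have **: "g (bracket (deg1 x) (deg1 y)) (bracket (deg1 x) (deg1 y)) = c * (x $ 1 * y $ 2 - x $ 2 * y $ 1)\<^sup>2" for x y
    proof -
      have "bracket (deg1 x) (deg1 y) = deg2 (x $ 1 * y $ 2 - x $ 2 * y $ 1)"
        by (simp add: deg1_def deg2_def)
      then show ?thesis by (simp add: g2 power2_eq_square)
    qed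
    show 1: "\<forall>x y. g (bracket (deg1 x) (deg1 y)) (bracket (deg1 x) (deg1 y)) =
        (p * r - q\<^sup>2) / (1 / c) * (g_m1 g x x * g_m1 g y y - (g_m1 g x y)\<^sup>2)"
      unfolding * ** using dP(1) by simp
    fix a assume a: "\<forall>x y. g (bracket (deg1 x) (deg1 y)) (bracket (deg1 x) (deg1 y)) =
       a * (g_m1 g x x * g_m1 g y y - (g_m1 g x y)\<^sup>2)"
    \<comment> \<open>A single pair of vectors spanning nonzero area determines the
      constant.\<close>
    from a[unfolded * **, rule_format, of "vec2 1 0" "vec2 0 1"]
    show "a = (p * r - q\<^sup>2) / (1 / c)" using dP(1) by (simp add: field_simps)
  qed
  have bf: "b_form g = (\<lambda>x y. B x y / c)"
    unfolding b_form_def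
  proof (rule the_equality)
    have *: "g (bracket (deg1 x) (deg2 z)) (bracket (deg1 y) (deg2 z)) = z\<^sup>2 * B x y" for x y z
    proof -
      have "bracket (deg1 x) (deg2 z) = deg3 (z *\<^sub>R x)" for x
        by (simp add: deg1_def deg2_def deg3_def)
      then show ?thesis
        by (simp add: linear_scale[OF l3] linear_scale[OF gD(1)] linear_scale[OF gD(2)] power2_eq_square B_def)
    qed
    show "\<forall>x y z. g (bracket (deg1 x) (deg2 z)) (bracket (deg1 y) (deg2 z)) = g (deg2 z) (deg2 z) * (B x y / c)"
      unfolding * g2 using c by (simp add: power2_eq_square)
    fix b assume b: "\<forall>x y z. g (bracket (deg1 x) (deg2 z)) (bracket (deg1 y) (deg2 z)) = g (deg2 z) (deg2 z) * b x y"
    show "b = (\<lambda>x y. B x y / c)"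
      using b[unfolded * g2, rule_format, of 1] c by (simp add: fun_eq_iff field_simps)
  qed
  have bi: "inner_product (b_form g)"
    using B c unfolding bf inner_product_def by (auto intro!: linearI simp: linear_add linear_scale add_divide_distrib)
  have bg: "gram2 (b_form g) (c * s) (c * t) (c * u)"
  proof -
    define n where "n = s * u - t\<^sup>2"
    have n: "n > 0" using dQ(1) by (simp add: n_def)
    have E: "c * s * (c * u) - (c * t)\<^sup>2 = c * c * n"
      by (simp add: n_def power2_eq_square algebra_simps)
    show ?thesis unfolding gram2_def bf Beq E n_def[symmetric] using n dQ(2) c by (auto simp: field_simps)
  qed
  show thesis
  proof (rule that[OF dm a])
    show "dual_norm (g_m1 g) \<phi> = sqrt (p * x\<^sup>2 + 2 * q * x * y + r * y\<^sup>2)"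
      if "linear \<phi>" "\<phi> (axis 1 1) = x" "\<phi> (axis 2 1) = y" for \<phi> x y
      by (rule gram2_dual_norm[OF A P that])
    show "dual_norm (b_form g) \<phi> = sqrt ((s * x\<^sup>2 + 2 * t * x * y + u * y\<^sup>2) / (1 / c))"
      if "linear \<phi>" "\<phi> (axis 1 1) = x" "\<phi> (axis 2 1) = y" for \<phi> x y
      unfolding gram2_dual_norm[OF bi bg that] by (simp add: algebra_simps)
    show "tr_inv (b_form g) (g_m1 g) = (p * u - 2 * q * t + r * s) / (1 / c * (p * r - q\<^sup>2))"
    proof -
      have "p * (c * u) - 2 * q * (c * t) + r * (c * s) = c * (p * u - 2 * q * t + r * s)"
        by (simp add: algebra_simps)
      then show ?thesis unfolding gram2_tr_inv[OF bi bg A P] by simp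
    qed
  qed
qed

section \<open>The Rumin differentials in a scalar representation\<close>

lemma scalar_rep_XU:
  "scalar_rep \<alpha> (XU js) = prod_list (map (\<lambda>j. \<i> * of_real (blinfun_apply \<alpha> (fst (bas j)))) js)"
  by (induction js) (simp_all add: XU_def scalar_rep_hom scalar_rep_incl)

lemma fst_bas:
  "fst (bas 1) = axis 1 1" "fst (bas 2) = axis 2 1" "fst (bas 3) = 0" "fst (bas 4) = 0" "fst (bas 5) = 0"
  by (simp_all add: bas_def deg1_def deg2_def deg3_def)

lemma i_powers: "\<i> * (\<i> * z) = - z" for z
  by (simp add: mult.assoc[symmetric])

text \<open>The coefficient of \<open>z\<close> in \<open>det (z H - H M) = det H det (z - M)\<close>.\<close>

lemma e2_pencil:
  fixes H M :: "'a::comm_ring_1 mat"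
  assumes "H \<in> carrier_mat 3 3" "M \<in> carrier_mat 3 3" and N: "N = H * M"
  shows "det H * e2 M =
     (N $$ (1,1) * N $$ (2,2) - N $$ (1,2) * N $$ (2,1)) * H $$ (0,0)
   + (N $$ (0,2) * N $$ (2,1) - N $$ (0,1) * N $$ (2,2)) * H $$ (1,0)
   + (N $$ (0,1) * N $$ (1,2) - N $$ (0,2) * N $$ (1,1)) * H $$ (2,0)
   + (N $$ (1,2) * N $$ (2,0) - N $$ (1,0) * N $$ (2,2)) * H $$ (0,1)
   + (N $$ (0,0) * N $$ (2,2) - N $$ (0,2) * N $$ (2,0)) * H $$ (1,1)
   + (N $$ (0,2) * N $$ (1,0) - N $$ (0,0) * N $$ (1,2)) * H $$ (2,1)
   + (N $$ (1,0) * N $$ (2,1) - N $$ (1,1) * N $$ (2,0)) * H $$ (0,2)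
   + (N $$ (0,1) * N $$ (2,0) - N $$ (0,0) * N $$ (2,1)) * H $$ (1,2)
   + (N $$ (0,0) * N $$ (1,1) - N $$ (0,1) * N $$ (1,0)) * H $$ (2,2)"
proof -
  have i: "N $$ (i, j) = H $$ (i,0) * M $$ (0,j) + H $$ (i,1) * M $$ (1,j) + H $$ (i,2) * M $$ (2,j)"
    if "i < 3" "j < 3" for i j
    using that assms by (simp add: scalar_prod_def eval_nat_numeral)
  show ?thesis
    unfolding det_carrier_3[OF assms(1)] e2_def by (simp add: i) (simp add: algebra_simps)
qed

context dual_metric
begin

abbreviation "NP x y \<equiv> p * x\<^sup>2 + 2 * q * x * y + r * y\<^sup>2"
abbreviation "NQ x y \<equiv> s * x\<^sup>2 + 2 * t * x * y + u * y\<^sup>2"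

lemma norm_pos:
  assumes "x \<noteq> 0 \<or> y \<noteq> 0"
  shows "0 < NP x y" "0 < NQ x y"
proof -
  have *: "0 < a * x\<^sup>2 + 2 * b * x * y + c * y\<^sup>2" if "0 < a" "0 < a * c - b\<^sup>2" for a b c :: real
  proof -
    have "a * (a * x\<^sup>2 + 2 * b * x * y + c * y\<^sup>2) = (a * x + b * y)\<^sup>2 + (a * c - b\<^sup>2) * y\<^sup>2"
      by (simp add: power2_eq_square algebra_simps)
    also have "\<dots> > 0"
    proof (cases "y = 0")
      case True
      then show ?thesis using assms that by simp
    next
      case False
      then show ?thesis using that by (intro add_nonneg_pos) auto
    qed
    finally show ?thesis using that by (simp add: zero_less_mult_iff)
  qed
  show "0 < NP x y" "0 < NQ x y" using * pos by auto
qed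

lemma rt_simps: "rt * (rt * z) = z / 2" "rt\<^sup>2 = 1 / 2" "sqrt 2 = 2 * rt" "1 / sqrt 2 = rt"
proof -
  show "rt * (rt * z) = z / 2" using rt_mult by (simp add: mult.assoc[symmetric])
  show "rt\<^sup>2 = 1 / 2" using rt_mult by (simp add: power2_eq_square)
  show "1 / sqrt 2 = rt" by (simp add: rt_def)
  show "sqrt 2 = 2 * rt" by (simp add: rt_def real_div_sqrt)
qed

lemma div_rt: "z / (complex_of_real rt * 2) = of_real rt * z"
proof -
  have "complex_of_real rt * of_real rt = of_real (1 / 2)" by (simp only: of_real_mult[symmetric] rt_mult)
  then show ?thesis using rt_nonzero by (simp add: field_simps)
qed

text \<open>For diagonal \<open>P\<close> and \<open>Q\<close> the matrix is diag (p s, Delta / 2, r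
  u), which explains the value.\<close>

lemma det_H2: "H2 0 0 * (H2 1 1 * H2 2 2 - H2 2 1 * H2 1 2) - H2 1 0 * (H2 0 1 * H2 2 2 - H2 2 1 * H2 0 2)
    + H2 2 0 * (H2 0 1 * H2 1 2 - H2 1 1 * H2 0 2) = dP * dQ * Delta / 2"
  by (simp add: H2_def dP_def dQ_def Delta_def power2_eq_square algebra_simps rt_simps)

text \<open>The left side is w^T adj(H3) w for the vector w annihilating the image of
  \<open>DD x y\<close>. It equals det H3 = 2 k^3 dP^2 dQ^2 / Delta times the squared dual norm NP
  NQ / (k dP dQ) of w.\<close>

lemma H3_adj:
  fixes x y :: real
  defines "w0 \<equiv> y\<^sup>2" and "w1 \<equiv> - 2 * rt * x * y" and "w2 \<equiv> x\<^sup>2"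
  shows "w0 * w0 * (H3 1 1 * H3 2 2 - H3 1 2 * H3 1 2) + w1 * w1 * (H3 0 0 * H3 2 2 - H3 0 2 * H3 0 2)
    + w2 * w2 * (H3 0 0 * H3 1 1 - H3 0 1 * H3 0 1)
    + 2 * (w0 * w1 * (H3 0 2 * H3 1 2 - H3 0 1 * H3 2 2) + w0 * w2 * (H3 0 1 * H3 1 2 - H3 0 2 * H3 1 1)
      + w1 * w2 * (H3 0 2 * H3 0 1 - H3 0 0 * H3 1 2))
    = 2 * k\<^sup>2 * dP * dQ * NP x y * NQ x y / Delta"
proof -
  have D: "Delta \<noteq> 0" using Delta_pos by simp
  \<comment> \<open>Clearing the denominator of \<open>H3\<close>; every 2 by 2 minor of
    \<open>K\<close> still contains the factor Delta dP dQ.\<close>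
  define K where "K i j = Delta * H2 i j - dl i * dl j" for i j
  have H: "H3 i j = k * K i j / Delta" for i j
    using D by (simp add: H3_def K_def field_simps)
  have k0: "K 1 1 * K 2 2 - K 1 2 * K 1 2 = 2 * Delta * dP * dQ * (r * u)"
    "K 0 0 * K 2 2 - K 0 2 * K 0 2 = Delta * dP * dQ * (p * u + 2 * q * t + r * s)"
    "K 0 0 * K 1 1 - K 0 1 * K 0 1 = 2 * Delta * dP * dQ * (p * s)"
    "K 0 2 * K 1 2 - K 0 1 * K 2 2 = 2 * Delta * dP * dQ * (- rt * (q * u + r * t))"
    "K 0 1 * K 1 2 - K 0 2 * K 1 1 = 2 * Delta * dP * dQ * (q * t)"
    "K 0 2 * K 0 1 - K 0 0 * K 1 2 = 2 * Delta * dP * dQ * (- rt * (p * t + q * s))"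
    by (simp_all add: K_def H2_def dl_def Delta_def dP_def dQ_def)
      (simp_all add: power2_eq_square algebra_simps rt_simps rt_mult, (simp_all add: field_simps)?)
  have H2: "H3 a b * H3 c d - H3 e f * H3 i j = (k / Delta)\<^sup>2 * (K a b * K c d - K e f * K i j)" for a b c d e f i j
    by (simp add: H power2_eq_square algebra_simps diff_divide_distrib)
  have "w0 * w0 * (r * u) * 2 + w1 * w1 * (p * u + 2 * q * t + r * s) + w2 * w2 * (p * s) * 2
    + 4 * (w0 * w1 * (- rt * (q * u + r * t)) + w0 * w2 * (q * t) + w1 * w2 * (- rt * (p * t + q * s)))
    = 2 * (NP x y * NQ x y)"
    unfolding w0_def w1_def w2_def
    by (simp add: power2_eq_square algebra_simps rt_simps rt_mult)
  then have "(k / Delta)\<^sup>2 * Delta * dP * dQ * (w0 * w0 * (r * u) * 2 + w1 * w1 * (p * u + 2 * q * t + r * s) + w2 * w2 * (p * s) * 2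
    + 4 * (w0 * w1 * (- rt * (q * u + r * t)) + w0 * w2 * (q * t) + w1 * w2 * (- rt * (p * t + q * s))))
    = (k / Delta)\<^sup>2 * Delta * dP * dQ * (2 * (NP x y * NQ x y))" by simp
  also have "\<dots> = 2 * k\<^sup>2 * dP * dQ * NP x y * NQ x y / Delta"
    using D by (simp add: power2_eq_square)
  finally show ?thesis
    unfolding H2 k0 by (simp only: distrib_left mult_ac)
qed

text \<open>Words of length two contribute \<i>^2 = -1, so the matrix in degree 2 is real.\<close>

definition "DD x y i j = [[x * y, - rt * x\<^sup>2, 0], [rt * y\<^sup>2, 0, - rt * x\<^sup>2], [0, rt * y\<^sup>2, - (x * y)]] ! i ! (j::nat)"

text \<open>Only words in X_1 and X_2 survive, and these commute, so outside degree 2 each matrix is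
  a column times a row. The products, including the factor 1 in degree 0, follow the pattern of
  \<open>det_star_abs_rank_1\<close>.\<close>

lemma rho_D_eq:
  fixes \<alpha> :: "(real ^ 2) \<Rightarrow>\<^sub>L real"
  assumes x: "blinfun_apply \<alpha> (axis 1 1) = x" and y: "blinfun_apply \<alpha> (axis 2 1) = y"
  shows "rho_D \<alpha> 0 = mat 2 1 (\<lambda>(i, j). [\<i> * of_real x, \<i> * of_real y] ! i * 1)"
    and "rho_D \<alpha> 1 = mat 3 2 (\<lambda>(i, j). [\<i> * of_real (x\<^sup>2), \<i> * of_real (2 * rt * x * y), \<i> * of_real (y\<^sup>2)] ! i *
      [of_real y, - of_real x] ! j)"
    and "rho_D \<alpha> 2 = mat 3 3 (\<lambda>(i, j). of_real (DD x y i j))"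
    and "rho_D \<alpha> 3 = mat 2 3 (\<lambda>(i, j). [- \<i> * of_real x, - \<i> * of_real y] ! i *
      [of_real (y\<^sup>2), - of_real (2 * rt * x * y), of_real (x\<^sup>2)] ! j)"
    and "rho_D \<alpha> 4 = mat 1 2 (\<lambda>(i, j). - \<i> * [of_real y, - of_real x] ! j)"
proof -
  note e = rho_D_def rumin_def mat_of_rows_list_def scalar_rep_hom scalar_rep_XU fst_bas x y
    blinfun.zero_right scaleR_conv_of_real[where 'a = complex] rt_simps power2_eq_square i_powers
  have 2: "i < 2 \<longleftrightarrow> i = 0 \<or> i = 1" for i :: nat by auto
  have 3: "i < 3 \<longleftrightarrow> i = 0 \<or> i = 1 \<or> i = 2" for i :: nat by auto
  show "rho_D \<alpha> 0 = mat 2 1 (\<lambda>(i, j). [\<i> * of_real x, \<i> * of_real y] ! i * 1)"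
    by (rule eq_matI) (auto simp: e 2 simp del: One_nat_def)
  show "rho_D \<alpha> 1 = mat 3 2 (\<lambda>(i, j). [\<i> * of_real (x\<^sup>2), \<i> * of_real (2 * rt * x * y), \<i> * of_real (y\<^sup>2)] ! i *
      [of_real y, - of_real x] ! j)"
    by (rule eq_matI) (auto simp: e 2 3 nth_1 simp del: One_nat_def, (simp_all add: algebra_simps i_powers)?)
  show "rho_D \<alpha> 2 = mat 3 3 (\<lambda>(i, j). of_real (DD x y i j))"
    by (rule eq_matI) (auto simp: e 3 DD_def nth_1 simp del: One_nat_def, (simp_all add: algebra_simps i_powers div_rt)?)
  show "rho_D \<alpha> 3 = mat 2 3 (\<lambda>(i, j). [- \<i> * of_real x, - \<i> * of_real y] ! i *
      [of_real (y\<^sup>2), - of_real (2 * rt * x * y), of_real (x\<^sup>2)] ! j)"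
    by (rule eq_matI) (auto simp: e 2 3 nth_1 simp del: One_nat_def, (simp_all add: algebra_simps i_powers)?)
  show "rho_D \<alpha> 4 = mat 1 2 (\<lambda>(i, j). - \<i> * [of_real y, - of_real x] ! j)"
    by (rule eq_matI) (auto simp: e 2 nth_1 simp del: One_nat_def, (simp_all add: algebra_simps i_powers)?)
qed

text \<open>The cofactors of \<open>N = D\<^sup>T H D\<close> with \<open>D = DD x y\<close> form the rank one matrix \<open>W v v\<^sup>T\<close>, where
  \<open>v = (x\<^sup>2, 2 rt x y, y\<^sup>2)\<close> spans the kernel of \<open>D\<close>.\<close>

lemma adj_N:
  fixes h00 h01 h02 h11 h12 h22 x y :: real
  defines "a0 \<equiv> x * y" and "a1 \<equiv> rt * y\<^sup>2" and "b0 \<equiv> - rt * x\<^sup>2"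
  defines "W \<equiv> (y\<^sup>2 * y\<^sup>2 * (h11 * h22 - h12 * h12) + (- 2 * rt * x * y) * (- 2 * rt * x * y) * (h00 * h22 - h02 * h02)
    + x\<^sup>2 * x\<^sup>2 * (h00 * h11 - h01 * h01)
    + 2 * (y\<^sup>2 * (- 2 * rt * x * y) * (h02 * h12 - h01 * h22) + y\<^sup>2 * x\<^sup>2 * (h01 * h12 - h02 * h11)
      + (- 2 * rt * x * y) * x\<^sup>2 * (h02 * h01 - h00 * h12))) / 4"
  defines "n00 \<equiv> a0 * a0 * h00 + 2 * a0 * a1 * h01 + a1 * a1 * h11"
    and "n11 \<equiv> b0 * b0 * h00 + 2 * b0 * a1 * h02 + a1 * a1 * h22"
    and "n22 \<equiv> b0 * b0 * h11 - 2 * b0 * a0 * h12 + a0 * a0 * h22"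
    and "n01 \<equiv> a0 * b0 * h00 + a0 * a1 * h02 + a1 * b0 * h01 + a1 * a1 * h12"
    and "n02 \<equiv> a0 * b0 * h01 - a0 * a0 * h02 + a1 * b0 * h11 - a1 * a0 * h12"
    and "n12 \<equiv> b0 * b0 * h01 - b0 * a0 * h02 + a1 * b0 * h12 - a1 * a0 * h22"
  shows "n11 * n22 - n12 * n12 = W * (x\<^sup>2 * x\<^sup>2)"
    and "n02 * n12 - n01 * n22 = W * (x\<^sup>2 * (2 * rt * x * y))"
    and "n01 * n12 - n02 * n11 = W * (x\<^sup>2 * y\<^sup>2)"
    and "n00 * n22 - n02 * n02 = W * ((2 * rt * x * y) * (2 * rt * x * y))"
    and "n02 * n01 - n00 * n12 = W * ((2 * rt * x * y) * y\<^sup>2)"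
    and "n00 * n11 - n01 * n01 = W * (y\<^sup>2 * y\<^sup>2)"
  unfolding assms by (simp_all add: power2_eq_square algebra_simps rt_simps rt_mult)

end

section \<open>Determinants of the five differentials\<close>

lemma det_star_abs_Suc:
  "Suc n = m \<Longrightarrow> det_star_abs g \<alpha> n = det_star (abs_wrt (h_ip g n) (h_ip g m) (rho_D \<alpha> n))"
  by (auto simp: det_star_abs_def)

context dual_metric
begin

text \<open>The vector u is the inverse of the Gram matrix c \<open>P\<close> applied to (y, -x),
  written with the adjugate. The scale c is 1 in degree 1 and k dQ in degree 4.\<close>

lemma riesz_H1:
  fixes x y c :: real
  assumes c: "c \<noteq> 0"
  defines "u0 \<equiv> (r * y + q * x) / (c * dP)" and "u1 \<equiv> - (q * y + p * x) / (c * dP)"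
  shows "gram_ip 2 (\<lambda>i j. c * H1 i j) v (Matrix.vec 2 ((!) [of_real u0, of_real u1])) =
      (\<Sum>j<2. [of_real y, - of_real x] ! j * vec_index v j)"
    and "(\<Sum>j<2. [of_real y, - of_real x] ! j * [of_real u0, of_real u1] ! j) =
      complex_of_real ((p * x\<^sup>2 + 2 * q * x * y + r * y\<^sup>2) / (c * dP))"
proof -
  have d: "dP \<noteq> 0" using dPQ_pos by simp
  have "c * (p * u0 + q * u1) = (p * (r * y + q * x) - q * (q * y + p * x)) / dP"
    "c * (q * u0 + r * u1) = (q * (r * y + q * x) - r * (q * y + p * x)) / dP"
    using c d by (simp_all add: u0_def u1_def field_simps)
  moreover have "p * (r * y + q * x) - q * (q * y + p * x) = y * dP" "q * (r * y + q * x) - r * (q * y + p * x) = - x * dP"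
    by (simp_all add: dP_def power2_eq_square algebra_simps)
  ultimately have e: "c * (p * u0 + q * u1) = y" "c * (q * u0 + r * u1) = - x" using d by simp_all
  have "gram_ip 2 (\<lambda>i j. c * H1 i j) v (Matrix.vec 2 ((!) [of_real a, of_real b])) =
      vec_index v 0 * of_real (c * (p * a + q * b)) + vec_index v 1 * of_real (c * (q * a + r * b))" for a b
    unfolding gram_ip_def sum_lt by (simp add: H1_def) (simp add: algebra_simps)
  from this[of u0 u1] show "gram_ip 2 (\<lambda>i j. c * H1 i j) v (Matrix.vec 2 ((!) [of_real u0, of_real u1])) =
      (\<Sum>j<2. [of_real y, - of_real x] ! j * vec_index v j)"
    unfolding e sum_lt by simp
  have "(\<Sum>j<2. [of_real y, - of_real x] ! j * [of_real u0, of_real u1] ! j) = complex_of_real (y * u0 - x * u1)"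
    unfolding sum_lt by simp
  also have "y * u0 - x * u1 = (p * x\<^sup>2 + 2 * q * x * y + r * y\<^sup>2) / (c * dP)"
    by (simp add: u0_def u1_def add_divide_distrib diff_divide_distrib power2_eq_square algebra_simps)
  finally show "(\<Sum>j<2. [of_real y, - of_real x] ! j * [of_real u0, of_real u1] ! j) =
      complex_of_real ((p * x\<^sup>2 + 2 * q * x * y + r * y\<^sup>2) / (c * dP))" .
qed

context
  fixes \<alpha> :: "(real ^ 2) \<Rightarrow>\<^sub>L real" and x y :: real
  assumes x: "blinfun_apply \<alpha> (axis 1 1) = x" and y: "blinfun_apply \<alpha> (axis 2 1) = y"
    and nz: "x \<noteq> 0 \<or> y \<noteq> 0"
begin

lemmas NPQ = norm_pos[OF nz]

lemma det_star_abs_0: "det_star_abs g \<alpha> 0 = of_real (sqrt (NP x y))"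
proof -
  have "det_star (abs_wrt (gram_ip 1 (\<lambda>i j. 1)) (gram_ip 2 H1) (rho_D \<alpha> 0)) = of_real (sqrt (NP x y * 1))"
  proof (rule det_star_abs_rank_1[OF _ _ _ rho_D_eq(1)[OF x y]])
    show "hermitian_ip 1 (gram_ip 1 (\<lambda>i j. 1))" "hermitian_ip 2 (gram_ip 2 H1)"
      using hermitian_h_ip by (simp_all add: h_ip_gram[symmetric] del: One_nat_def)
    show "gram_ip 1 (\<lambda>i j. 1) v (Matrix.vec 1 (\<lambda>_. 1)) = (\<Sum>j<1. 1 * vec_index v j)" for v
      by (simp add: gram_ip_def)
    show "gram_ip 2 H1 (Matrix.vec 2 ((!) [\<i> * of_real x, \<i> * of_real y]))
        (Matrix.vec 2 ((!) [\<i> * of_real x, \<i> * of_real y])) = of_real (NP x y)"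
      unfolding gram_ip_def sum_lt
      by (simp add: H1_def power2_eq_square) (simp add: algebra_simps i_powers)
  qed (use NPQ in auto)
  moreover have "Suc 0 = 1" by simp
  ultimately show ?thesis by (simp only: det_star_abs_Suc h_ip_gram mult_1_right)
qed

text \<open>The column is \<i> times the coordinates of \<alpha> \<otimes> \<alpha> as a symmetric
  tensor, with squared norm NP NQ; the row (y, -x) contributes NP / dP.\<close>

lemma det_star_abs_1: "det_star_abs g \<alpha> 1 = of_real (sqrt (NP x y * NQ x y * (NP x y / dP)))"
proof -
  let ?v = "(!) [\<i> * of_real (x\<^sup>2), \<i> * of_real (2 * rt * x * y), \<i> * of_real (y\<^sup>2)]"
  have H1: "(\<lambda>i j. 1 * H1 i j) = H1" by simp
  have "det_star (abs_wrt (gram_ip 2 H1) (gram_ip 3 H2) (rho_D \<alpha> 1)) = of_real (sqrt (NP x y * NQ x y * (NP x y / (1 * dP))))"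
  proof (rule det_star_abs_rank_1[OF _ _ _ rho_D_eq(2)[OF x y] riesz_H1(1)[of 1, unfolded H1] _ riesz_H1(2)[of 1]])
    show "hermitian_ip 2 (gram_ip 2 H1)" "hermitian_ip 3 (gram_ip 3 H2)"
      using hermitian_h_ip by (simp_all add: h_ip_gram[symmetric] del: One_nat_def)
    show "gram_ip 3 H2 (Matrix.vec 3 ?v) (Matrix.vec 3 ?v) = of_real (NP x y * NQ x y)"
    proof -
      let ?z = "[x\<^sup>2, 2 * rt * x * y, y\<^sup>2]"
      have "gram_ip 3 H2 (Matrix.vec 3 ?v) (Matrix.vec 3 ?v) = of_real (\<Sum>i<3. \<Sum>j<3. H2 i j * ?z ! i * ?z ! j)"
        unfolding gram_ip_def sum_lt by (simp add: nth_1 del: One_nat_def) (simp add: algebra_simps i_powers)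
      also have "(\<Sum>i<3. \<Sum>j<3. H2 i j * ?z ! i * ?z ! j) = NP x y * NQ x y"
        unfolding sum_lt by (simp add: H2_def power2_eq_square) (simp add: algebra_simps rt_simps rt_mult)
      finally show ?thesis .
    qed
  qed (use NPQ dPQ_pos in auto)
  moreover have "Suc 1 = 2" by simp
  ultimately show ?thesis by (simp only: det_star_abs_Suc h_ip_gram mult_1)
qed

text \<open>The scale k dQ in degree 4 and the factor dP in the dual norm of (y, -x) cancel against
  the norm k dP dQ in degree 5.\<close>

lemma det_star_abs_4: "det_star_abs g \<alpha> 4 = of_real (sqrt (NP x y))"
proof -
  have d: "dP \<noteq> 0" "dQ \<noteq> 0" "k \<noteq> 0" "k * dQ \<noteq> 0" using dPQ_pos pos by auto
  have "det_star (abs_wrt (gram_ip 2 (\<lambda>i j. k * dQ * H1 i j)) (gram_ip 1 (\<lambda>i j. k * dP * dQ)) (rho_D \<alpha> 4)) =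
      of_real (sqrt (k * dP * dQ * (NP x y / (k * dQ * dP))))"
  proof (rule det_star_abs_rank_1[OF _ _ _ rho_D_eq(5)[OF x y] riesz_H1(1)[OF d(4)] _ riesz_H1(2)[OF d(4)]])
    show "hermitian_ip 2 (gram_ip 2 (\<lambda>i j. k * dQ * H1 i j))" "hermitian_ip 1 (gram_ip 1 (\<lambda>i j. k * dP * dQ))"
      using hermitian_h_ip by (simp_all add: h_ip_gram[symmetric] del: One_nat_def)
    show "gram_ip 1 (\<lambda>i j. k * dP * dQ) (Matrix.vec 1 (\<lambda>_. - \<i>)) (Matrix.vec 1 (\<lambda>_. - \<i>)) = of_real (k * dP * dQ)"
      by (simp add: gram_ip_def mult.assoc)
  qed (use NPQ dPQ_pos pos in auto)
  moreover have "k * dP * dQ * (NP x y / (k * dQ * dP)) = NP x y" using d by simp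
  moreover have "Suc 4 = 5" by simp
  ultimately show ?thesis by (simp only: det_star_abs_Suc h_ip_gram)
qed

lemma det_star_abs_3: "det_star_abs g \<alpha> 3 = of_real (sqrt (NP x y * NQ x y * (NP x y / dP)))"
proof -
  have d: "dP \<noteq> 0" "dQ \<noteq> 0" "k \<noteq> 0" "Delta \<noteq> 0" using dPQ_pos pos Delta_pos by auto
  let ?c = "k * dP * dQ"
  let ?v = "(!) [- \<i> * of_real x, - \<i> * of_real y]"
  let ?w = "(!) [of_real (y\<^sup>2), - complex_of_real (2 * rt * x * y), of_real (x\<^sup>2)]"
  \<comment> \<open>The symmetrised tensor product of adj(P) (y, -x) and adj(Q) (y, -x). Dualising a
    quotient metric restricts the inverse metric, here to symmetric tensors, so U / ?c represents
    (y, -x) \<otimes> (y, -x), the row of the matrix.\<close>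
  define U where "U i = [(r * y + q * x) * (u * y + t * x),
    - rt * ((r * y + q * x) * (t * y + s * x) + (q * y + p * x) * (u * y + t * x)),
    (q * y + p * x) * (t * y + s * x)] ! i" for i :: nat
  let ?u = "\<lambda>i. complex_of_real (U i / ?c)"
  have HU: "H3 i 0 * U 0 + H3 i 1 * U 1 + H3 i 2 * U 2 = ?c * [y\<^sup>2, - 2 * rt * x * y, x\<^sup>2] ! i" if "i < 3" for i
  proof -
    have "Delta * (H2 i 0 * U 0 + H2 i 1 * U 1 + H2 i 2 * U 2) - dl i * (dl 0 * U 0 + dl 1 * U 1 + dl 2 * U 2)
        = Delta * dP * dQ * [y\<^sup>2, - 2 * rt * x * y, x\<^sup>2] ! i"
    proof -
      have dlU: "dl 0 * U 0 + dl 1 * U 1 + dl 2 * U 2 =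
          (p * t - q * s) * U 0 - (p * u - r * s) / 2 * ((r * y + q * x) * (t * y + s * x) + (q * y + p * x) * (u * y + t * x))
          + (q * u - r * t) * U 2"
        by (simp add: dl_def U_def algebra_simps rt_simps)
            (simp add: field_simps)
      have i: "i = 0 \<or> i = 1 \<or> i = 2" using that by auto
      then show ?thesis unfolding dlU
        by (elim disjE; simp add: U_def H2_def dl_def Delta_def dP_def dQ_def)
          (simp_all add: power2_eq_square algebra_simps rt_simps rt_mult, (simp_all add: field_simps)?)
    qed
    then have "k * (Delta * (H2 i 0 * U 0 + H2 i 1 * U 1 + H2 i 2 * U 2) - dl i * (dl 0 * U 0 + dl 1 * U 1 + dl 2 * U 2)) / Delta
        = ?c * [y\<^sup>2, - 2 * rt * x * y, x\<^sup>2] ! i"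
      using d by simp
    moreover have "k * (Delta * (H2 i 0 * U 0 + H2 i 1 * U 1 + H2 i 2 * U 2) - dl i * (dl 0 * U 0 + dl 1 * U 1 + dl 2 * U 2)) / Delta
        = H3 i 0 * U 0 + H3 i 1 * U 1 + H3 i 2 * U 2"
      using d by (simp add: H3_def field_simps)
    ultimately show ?thesis by simp
  qed
  have HU': "(H3 i 0 * U 0 + H3 i 1 * U 1 + H3 i 2 * U 2) / ?c = [y\<^sup>2, - 2 * rt * x * y, x\<^sup>2] ! i" if "i < 3" for i
    unfolding HU[OF that] using d by simp
  have "det_star (abs_wrt (gram_ip 3 H3) (gram_ip 2 (\<lambda>i j. k * dQ * H1 i j)) (rho_D \<alpha> 3)) =
      of_real (sqrt (k * dQ * NP x y * (NP x y * NQ x y / ?c)))"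
  proof (rule det_star_abs_rank_1[OF _ _ _ rho_D_eq(4)[OF x y]])
    show "hermitian_ip 3 (gram_ip 3 H3)" "hermitian_ip 2 (gram_ip 2 (\<lambda>i j. k * dQ * H1 i j))"
      using hermitian_h_ip by (simp_all add: h_ip_gram[symmetric] del: One_nat_def)
    show "gram_ip 3 H3 v (Matrix.vec 3 ?u) = (\<Sum>j<3. ?w j * vec_index v j)" for v
    proof -
      have "gram_ip 3 H3 v (Matrix.vec 3 ?u) =
          (\<Sum>i<3. vec_index v i * of_real ((H3 i 0 * U 0 + H3 i 1 * U 1 + H3 i 2 * U 2) / ?c))"
        unfolding gram_ip_def
        by (intro sum.cong refl) (unfold sum_lt, simp add: add_divide_distrib algebra_simps)
      also have "\<dots> = (\<Sum>i<3. vec_index v i * of_real ([y\<^sup>2, - 2 * rt * x * y, x\<^sup>2] ! i))"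
        by (intro sum.cong refl) (simp only: HU' lessThan_iff)
      also have "\<dots> = (\<Sum>j<3. ?w j * vec_index v j)"
        unfolding sum_lt by simp
      finally show ?thesis .
    qed
    show "gram_ip 2 (\<lambda>i j. k * dQ * H1 i j) (Matrix.vec 2 ?v) (Matrix.vec 2 ?v) = of_real (k * dQ * NP x y)"
      unfolding gram_ip_def sum_lt
      by (simp add: H1_def power2_eq_square) (simp add: algebra_simps i_powers)
    have "y\<^sup>2 * U 0 - 2 * rt * x * y * U 1 + x\<^sup>2 * U 2 = NP x y * NQ x y"
      by (simp add: U_def power2_eq_square) (simp add: algebra_simps rt_simps rt_mult)
    then have "(y\<^sup>2 * U 0 - 2 * rt * x * y * U 1 + x\<^sup>2 * U 2) / ?c = NP x y * NQ x y / ?c" by simp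
    moreover have "(\<Sum>j<3. ?w j * ?u j) = of_real ((y\<^sup>2 * U 0 - 2 * rt * x * y * U 1 + x\<^sup>2 * U 2) / ?c)"
      unfolding sum_lt by (simp add: add_divide_distrib diff_divide_distrib)
    ultimately show "(\<Sum>j<3. ?w j * ?u j) = of_real (NP x y * NQ x y / ?c)" by (simp only:)
  qed (use NPQ dPQ_pos pos in auto)
  moreover have "k * dQ * NP x y * (NP x y * NQ x y / ?c) = NP x y * NQ x y * (NP x y / dP)"
    using d by (simp add: field_simps)
  moreover have "Suc 3 = 4" by simp
  ultimately show ?thesis by (simp only: det_star_abs_Suc h_ip_gram)
qed

text \<open>For N = A^T H3 A the product of det H2 and e2 M is the trace of adj(N) H2. As adj(N) = W
  v v^T with v the coordinates of \<alpha> \<otimes> \<alpha>, this trace is W NP NQ, and division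
  by det H2 leaves a perfect square.\<close>

lemma det_star_abs_2: "det_star_abs g \<alpha> 2 = of_real (k * NP x y * NQ x y / Delta)"
proof -
  let ?h = "gram_ip 3 H2" and ?h' = "gram_ip 3 H3"
  let ?s = "k * NP x y * NQ x y / Delta"
  define A where "A = rho_D \<alpha> 2"
  have A_eq: "A = mat 3 3 (\<lambda>(i, j). of_real (DD x y i j))" unfolding A_def by (rule rho_D_eq(3)[OF x y])
  have A: "A \<in> carrier_mat 3 3" by (simp add: A_eq)
  have h: "hermitian_ip 3 ?h" and h': "hermitian_ip 3 ?h'"
    using hermitian_h_ip by (simp_all add: h_ip_gram[symmetric] del: One_nat_def)
  obtain B where B: "B \<in> carrier_mat 3 3"
    and adj: "\<And>v w. v \<in> carrier_vec 3 \<Longrightarrow> w \<in> carrier_vec 3 \<Longrightarrow> ?h' (A *\<^sub>v v) w = ?h v (B *\<^sub>v w)"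
    using adjoint_gram_exists[OF h A] by metis
  have adj': "\<forall>v\<in>carrier_vec 3. \<forall>w\<in>carrier_vec 3. ?h' (A *\<^sub>v v) w = ?h v (B *\<^sub>v w)"
    using adj by auto
  define M where "M = B * A"
  have M: "M \<in> carrier_mat 3 3" using A B by (simp add: M_def)
  note psd = adjoint_product_psd[OF h h' A B adj', folded M_def]
  define H where "H = mat 3 3 (\<lambda>(i, j). complex_of_real (H2 i j))"
  \<comment> \<open>\<open>gram_ip\<close> is conjugate linear in its second argument, so the
    pulled-back form has the matrix \<open>H * C\<close>; the conjugation is undone once
    \<open>e2 C\<close> is seen to be real.\<close>
  define C where "C = map_mat cnj M"
  have HC: "H \<in> carrier_mat 3 3" "C \<in> carrier_mat 3 3" using M by (simp_all add: H_def C_def)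
  define n where "n i j = (\<Sum>a<3. \<Sum>b<3. H3 a b * DD x y a i * DD x y b j)" for i j
  have N: "(H * C) $$ (i, j) = of_real (n i j)" if ij: "i < 3" "j < 3" for i j
  proof -
    have "?h (unit_vec 3 i) (M *\<^sub>v unit_vec 3 j) = ?h' (A *\<^sub>v unit_vec 3 i) (A *\<^sub>v unit_vec 3 j)"
      using psd(1,2)[of "unit_vec 3 i" "unit_vec 3 j"] by simp
    moreover have "?h (unit_vec 3 i) (M *\<^sub>v unit_vec 3 j) = (H * C) $$ (i, j)"
    proof -
      have "?h (unit_vec 3 i) (M *\<^sub>v unit_vec 3 j) =
          (\<Sum>a<3. if a = i then (\<Sum>b<3. of_real (H2 a b) * cnj (vec_index (M *\<^sub>v unit_vec 3 j) b)) else 0)"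
        unfolding gram_ip_def using ij by (intro sum.cong refl) (auto intro!: sum.cong)
      also have "\<dots> = (\<Sum>b<3. of_real (H2 i b) * cnj (vec_index (M *\<^sub>v unit_vec 3 j) b))"
        using ij by simp
      also have "\<dots> = (\<Sum>b<3. of_real (H2 i b) * cnj (M $$ (b, j)))"
        using ij M by (intro sum.cong refl) simp
      also have "\<dots> = (H * C) $$ (i, j)"
        using ij M by (simp add: H_def C_def scalar_prod_def atLeast0LessThan)
      finally show ?thesis .
    qed
    moreover have "?h' (A *\<^sub>v unit_vec 3 i) (A *\<^sub>v unit_vec 3 j) = of_real (n i j)"
    proof -
      have "vec_index (A *\<^sub>v unit_vec 3 i) a = of_real (DD x y a i)" if "a < 3" "i < 3" for a i
        using that by (simp add: A_eq)
      then show ?thesis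
        unfolding gram_ip_def n_def of_real_sum using ij
        by (intro sum.cong refl) simp
    qed
    ultimately show ?thesis by simp
  qed
  have sym: "H3 1 0 = H3 0 1" "H3 2 0 = H3 0 2" "H3 2 1 = H3 1 2"
    by (simp_all add: H3_def H2_def)
  \<comment> \<open>A quarter of the value in \<open>H3_adj\<close>: the factor one half in the
    adjugate of A enters twice.\<close>
  define W where "W = k\<^sup>2 * dP * dQ * NP x y * NQ x y / (2 * Delta)"
  have W: "2 * k\<^sup>2 * dP * dQ * NP x y * NQ x y / Delta / 4 = W" by (simp add: W_def)
  define a0 a1 b0 where "a0 = x * y" and "a1 = rt * y\<^sup>2" and "b0 = - rt * x\<^sup>2"
  have n_eq: "n 0 0 = a0 * a0 * H3 0 0 + 2 * a0 * a1 * H3 0 1 + a1 * a1 * H3 1 1"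
    "n 1 1 = b0 * b0 * H3 0 0 + 2 * b0 * a1 * H3 0 2 + a1 * a1 * H3 2 2"
    "n 2 2 = b0 * b0 * H3 1 1 - 2 * b0 * a0 * H3 1 2 + a0 * a0 * H3 2 2"
    "n 0 1 = a0 * b0 * H3 0 0 + a0 * a1 * H3 0 2 + a1 * b0 * H3 0 1 + a1 * a1 * H3 1 2"
    "n 0 2 = a0 * b0 * H3 0 1 - a0 * a0 * H3 0 2 + a1 * b0 * H3 1 1 - a1 * a0 * H3 1 2"
    "n 1 2 = b0 * b0 * H3 0 1 - b0 * a0 * H3 0 2 + a1 * b0 * H3 1 2 - a1 * a0 * H3 2 2"
    "n 1 0 = n 0 1" "n 2 0 = n 0 2" "n 2 1 = n 1 2"
    unfolding n_def sum_lt by (simp_all add: DD_def sym[unfolded One_nat_def] flip: a0_def a1_def)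
      (simp_all add: b0_def algebra_simps)
  note adjN = adj_N[where x = x and y = y and ?h00.0 = "H3 0 0" and ?h01.0 = "H3 0 1" and ?h02.0 = "H3 0 2"
      and ?h11.0 = "H3 1 1" and ?h12.0 = "H3 1 2" and ?h22.0 = "H3 2 2", unfolded H3_adj[where x = x and y = y] W,
      folded a0_def a1_def b0_def, folded n_eq(1-6)]
  have dH: "det H = of_real (dP * dQ * Delta / 2)"
    unfolding det_H2[symmetric] by (subst det_carrier_3[OF HC(1)]) (simp add: H_def)
  have "det H * e2 C = of_real (W * (NP x y * NQ x y))"
  proof -
    have Hi: "H $$ (i, j) = of_real (H2 i j)" if "i < 3" "j < 3" for i j using that by (simp add: H_def)
    have "det H * e2 C = of_real (
       (n 1 1 * n 2 2 - n 1 2 * n 1 2) * H2 0 0 + 2 * (n 0 2 * n 1 2 - n 0 1 * n 2 2) * H2 0 1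
       + 2 * (n 0 1 * n 1 2 - n 0 2 * n 1 1) * H2 0 2 + (n 0 0 * n 2 2 - n 0 2 * n 0 2) * H2 1 1
       + 2 * (n 0 2 * n 0 1 - n 0 0 * n 1 2) * H2 1 2 + (n 0 0 * n 1 1 - n 0 1 * n 0 1) * H2 2 2)"
    proof -
      have "H2 1 0 = H2 0 1" "H2 2 0 = H2 0 2" "H2 2 1 = H2 1 2" by (simp_all add: H2_def)
      then show ?thesis
        unfolding e2_pencil[OF HC refl] by (simp add: N Hi n_eq(7-9)[unfolded One_nat_def]) (simp add: algebra_simps)
    qed
    also have "(n 1 1 * n 2 2 - n 1 2 * n 1 2) * H2 0 0 + 2 * (n 0 2 * n 1 2 - n 0 1 * n 2 2) * H2 0 1
       + 2 * (n 0 1 * n 1 2 - n 0 2 * n 1 1) * H2 0 2 + (n 0 0 * n 2 2 - n 0 2 * n 0 2) * H2 1 1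
       + 2 * (n 0 2 * n 0 1 - n 0 0 * n 1 2) * H2 1 2 + (n 0 0 * n 1 1 - n 0 1 * n 0 1) * H2 2 2
       = W * (NP x y * NQ x y)"
      unfolding adjN by (simp add: H2_def power2_eq_square) (simp add: algebra_simps rt_simps rt_mult)
    finally show ?thesis .
  qed
  moreover have "k\<^sup>2 * dP * dQ * a * b / (2 * Delta) * (a * b) = dP * dQ * Delta / 2 * (k * a * b / Delta)\<^sup>2" for a b
    using Delta_pos by (simp add: field_simps power2_eq_square)
  ultimately have "of_real (dP * dQ * Delta / 2) * e2 C = of_real (dP * dQ * Delta / 2) * of_real (?s\<^sup>2)"
    by (simp only: dH W_def of_real_mult)
  moreover have "complex_of_real (dP * dQ * Delta / 2) \<noteq> 0" using dPQ_pos Delta_pos by simp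
  ultimately have "e2 C = of_real (?s\<^sup>2)" by (metis mult_left_cancel)
  moreover have "e2 C = cnj (e2 M)" using M by (simp add: e2_def C_def)
  ultimately have e2: "e2 M = of_real (?s\<^sup>2)" by (metis complex_cnj_cnj complex_cnj_complex_of_real)
  have "det A = 0"
    by (subst det_carrier_3[OF A]) (simp add: A_eq DD_def power2_eq_square algebra_simps)
  then have "det M = 0" using det_mult[OF B A] by (simp add: M_def)
  moreover have "?s > 0" using NPQ pos Delta_pos by simp
  ultimately have "det_star (sqrt_wrt ?h M) = of_real ?s"
    using det_star_sqrt_rank_2[OF h M psd(2,3) _ e2] by blast
  moreover have "adjoint_wrt ?h ?h' A = B" by (rule adjoint_wrt_eqI[OF h A B adj])
  moreover have "Suc 2 = 3" by simp
  ultimately show ?thesis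
    by (simp only: det_star_abs_Suc h_ip_gram abs_wrt_def A_def[symmetric] M_def)
qed

end

end

section \<open>Comparison with the invariants of the metric\<close>

theorem theorem2:
  fixes g :: "g5 \<Rightarrow> g5 \<Rightarrow> real" and \<alpha> :: "(real ^ 2) \<Rightarrow>\<^sub>L real"
  assumes "graded_inner_product g" and "\<alpha> \<noteq> 0"
  shows "det_star_abs g \<alpha> 4 = det_star_abs g \<alpha> 0 \<and>
         det_star_abs g \<alpha> 0 = of_real (dual_norm (g_m1 g) \<alpha>) \<and>
         det_star_abs g \<alpha> 3 = det_star_abs g \<alpha> 1 \<and>
         det_star_abs g \<alpha> 1 =
           of_real ((dual_norm (g_m1 g) \<alpha>)\<^sup>2 * dual_norm (b_form g) \<alpha> / sqrt (a_coeff g)) \<and>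
         det_star_abs g \<alpha> 2 =
           of_real ((dual_norm (g_m1 g) \<alpha>)\<^sup>2 * (dual_norm (b_form g) \<alpha>)\<^sup>2 /
                    (a_coeff g * tr_inv (b_form g) (g_m1 g))) \<and>
         torsion g \<alpha> = of_real (1 / tr_inv (b_form g) (g_m1 g))"
proof -
  define x y where "x = blinfun_apply \<alpha> (axis 1 1)" and "y = blinfun_apply \<alpha> (axis 2 1)"
  have lin: "linear (blinfun_apply \<alpha>)"
    using blinfun.bounded_linear_right bounded_linear.linear by blast
  have nz: "x \<noteq> 0 \<or> y \<noteq> 0"
  proof (rule ccontr)
    assume "\<not> (x \<noteq> 0 \<or> y \<noteq> 0)"
    then have "blinfun_apply \<alpha> v = 0" for v
      by (subst linear_vec2[OF lin]) (simp add: x_def y_def)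
    then show False using assms(2) by (auto intro: blinfun_eqI)
  qed
  obtain p q r s t u k where dm: "dual_metric g p q r s t u k"
    and a: "a_coeff g = (p * r - q\<^sup>2) / k"
    and P: "dual_norm (g_m1 g) \<alpha> = sqrt (p * x\<^sup>2 + 2 * q * x * y + r * y\<^sup>2)"
    and Q: "dual_norm (b_form g) \<alpha> = sqrt ((s * x\<^sup>2 + 2 * t * x * y + u * y\<^sup>2) / k)"
    and tr: "tr_inv (b_form g) (g_m1 g) = (p * u - 2 * q * t + r * s) / (k * (p * r - q\<^sup>2))"
    using graded_parameters[OF assms(1)] lin x_def y_def by metis
  interpret dual_metric g p q r s t u k by (rule dm)
  define D E where "D = p * x\<^sup>2 + 2 * q * x * y + r * y\<^sup>2" and "E = s * x\<^sup>2 + 2 * t * x * y + u * y\<^sup>2"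
  have DE: "D > 0" "E > 0" using norm_pos[OF nz] by (simp_all add: D_def E_def)
  note dd = x_def[symmetric] y_def[symmetric] nz
  have d: "det_star_abs g \<alpha> 0 = of_real (sqrt D)"
    "det_star_abs g \<alpha> 1 = of_real (sqrt (D * E * (D / dP)))"
    "det_star_abs g \<alpha> 2 = of_real (k * D * E / Delta)"
    "det_star_abs g \<alpha> 3 = of_real (sqrt (D * E * (D / dP)))"
    "det_star_abs g \<alpha> 4 = of_real (sqrt D)"
    using det_star_abs_0[OF dd] det_star_abs_1[OF dd] det_star_abs_2[OF dd] det_star_abs_3[OF dd] det_star_abs_4[OF dd]
    by (simp_all only: D_def E_def)
  have a: "a_coeff g = dP / k" and tr: "tr_inv (b_form g) (g_m1 g) = Delta / (k * dP)"
    using a tr by (simp_all add: dP_def Delta_def)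
  have P: "dual_norm (g_m1 g) \<alpha> = sqrt D" and Q: "dual_norm (b_form g) \<alpha> = sqrt (E / k)"
    using P Q by (simp_all add: D_def E_def)
  \<comment> \<open>The factor k cancels between the b-norm and a_g.\<close>
  have 1: "(sqrt D)\<^sup>2 * sqrt (E / k) / sqrt (dP / k) = sqrt (D * E * (D / dP))"
  proof -
    have "sqrt (D * E * (D / dP)) = sqrt (D\<^sup>2 * (E / dP))" by (simp add: power2_eq_square)
    also have "\<dots> = D * sqrt (E / dP)" using DE by (simp add: real_sqrt_mult del: times_divide_eq_right)
    also have "E / dP = (E / k) / (dP / k)" using pos dPQ_pos by simp
    finally show ?thesis using DE by (simp add: real_sqrt_divide del: divide_divide_eq_left divide_divide_eq_right)
  qed
  have 2: "(sqrt D)\<^sup>2 * (sqrt (E / k))\<^sup>2 / (dP / k * (Delta / (k * dP))) = k * D * E / Delta"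
    using DE pos dPQ_pos Delta_pos by (simp add: field_simps)
  \<comment> \<open>Degrees 0, 2, 4 and degrees 1, 3 both contribute D^2 E, so the dependence on
    \<alpha> cancels and k dP / Delta remains.\<close>
  have "torsion g \<alpha> = of_real (sqrt D * (k * D * E / Delta) * sqrt D / (sqrt (D * E * (D / dP)) * sqrt (D * E * (D / dP))))"
    by (simp only: torsion_def d of_real_mult of_real_divide)
  also have "sqrt D * (k * D * E / Delta) * sqrt D = D * (k * D * E / Delta)" using DE by (simp add: mult.commute mult.left_commute)
  also have "sqrt (D * E * (D / dP)) * sqrt (D * E * (D / dP)) = D * E * (D / dP)" using DE dPQ_pos by simp
  also have "D * (k * D * E / Delta) / (D * E * (D / dP)) = 1 / (Delta / (k * dP))"
    using DE pos dPQ_pos Delta_pos by (simp add: field_simps)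
  finally show ?thesis unfolding a tr P Q d 1 2 by simp
qed

end
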